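(* Let $n,k,t\ge 1$ be integers with $2k-t\le n<3k-3t+3$. If $f_{n,k,t}\ge\left(\frac14+\frac1{62}\right)\binom{n}{k}$, then every inflation $G$ of $K(n,k,\ge t)$ with $\alpha(G)=2$ satisfies $\mathrm{had}(G)\ge\chi(G)$.
   Context: $K(n,k,\ge t)$ is the graph whose vertices are the $k$-element subsets of $[n]=\{1,\dots,n\}$, two distinct subsets being adjacent iff they share at least $t$ elements. For an integer $r\ge 0$ with $t+2r\le n$, let $\mathcal{F}_{n,k,t,r}=\{A\subseteq[n]: |A|=k,\ |A\cap\{1,\dots,t+2r\}|\ge t+r\}$, and let $f_{n,k,t}=\max\{|\mathcal{F}_{n,k,t,r}| : r\ge 0,\ t+2r\le n\}$. An inflation of a graph $H$ is obtained by choosing integers $c_x\ge 0$ for $x\in V(H)$, replacing each $x$ by a clique $C_x$ of order $c_x$, with every vertex of $C_x$ adjacent to every vertex of $C_y$ ($x\neq y$) if $xy\in E(H)$ and no edges between them otherwise. $\mathrm{had}(G)$ is the largest $t$ such that $K_t$ is a minor of $G$. *)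

theory Defs
  imports Complex_Main "HOL-Library.Disjoint_Sets" "Graph_Theory.Graph_Theory"
begin

text \<open>
  A finite simple graph is a value of type \<open>'a pair_pre_digraph\<close> satisfying \<^locale>\<open>pair_graph\<close>:
  the edge \<open>uv\<close> is represented by the two arcs \<open>(u, v)\<close> and \<open>(v, u)\<close>.
\<close>

definition independent_set :: "'a pair_pre_digraph \<Rightarrow> 'a set \<Rightarrow> bool" where
  "independent_set G S \<longleftrightarrow> S \<subseteq> pverts G \<and> (\<forall>u\<in>S. \<forall>v\<in>S. (u, v) \<notin> parcs G)"

definition independence_number :: "'a pair_pre_digraph \<Rightarrow> nat" where
  "independence_number G = Max {card S | S. independent_set G S}"

definition proper_coloring :: "'a pair_pre_digraph \<Rightarrow> nat \<Rightarrow> ('a \<Rightarrow> nat) \<Rightarrow> bool" where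
  "proper_coloring G m f \<longleftrightarrow>
     (\<forall>v\<in>pverts G. f v < m) \<and> (\<forall>(u, v)\<in>parcs G. f u \<noteq> f v)"

definition chromatic_number :: "'a pair_pre_digraph \<Rightarrow> nat" where
  "chromatic_number G = (LEAST m. \<exists>f. proper_coloring G m f)"

text \<open>
  \<open>B x\<close> is the branch set of the vertex \<open>x\<close>. Nonemptiness of branch sets is part of
  \<^const>\<open>Digraph_Component.connected\<close>.
\<close>

definition is_minor :: "'b pair_pre_digraph \<Rightarrow> 'a pair_pre_digraph \<Rightarrow> bool" where
  "is_minor H G \<longleftrightarrow>
     (\<exists>B. (\<forall>x\<in>pverts H. B x \<subseteq> pverts G \<and>
              Digraph_Component.connected (with_proj G \<restriction> B x)) \<and>
          disjoint_family_on B (pverts H) \<and>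
          (\<forall>(x, y)\<in>parcs H. \<exists>u\<in>B x. \<exists>v\<in>B y. (u, v) \<in> parcs G))"

definition hadwiger_number :: "'a pair_pre_digraph \<Rightarrow> nat" where
  "hadwiger_number G =
     Max {m. \<exists>H :: nat pair_pre_digraph. complete_digraph m (with_proj H) \<and> is_minor H G}"

text \<open>
  In an inflation, \<open>C x\<close> is the clique that replaces \<open>x\<close>; its order \<open>card (C x)\<close> may be \<open>0\<close>.
\<close>

definition is_inflation :: "'a pair_pre_digraph \<Rightarrow> 'b pair_pre_digraph \<Rightarrow> bool" where
  "is_inflation G H \<longleftrightarrow>
     (\<exists>C. (\<forall>x\<in>pverts H. finite (C x)) \<and>
          disjoint_family_on C (pverts H) \<and>
          pverts G = (\<Union>x\<in>pverts H. C x) \<and>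
          parcs G = {(u, v). \<exists>x\<in>pverts H. \<exists>y\<in>pverts H. u \<in> C x \<and> v \<in> C y \<and>
                       (if x = y then u \<noteq> v else (x, y) \<in> parcs H)})"

definition intersection_graph_ge :: "nat \<Rightarrow> nat \<Rightarrow> nat \<Rightarrow> nat set pair_pre_digraph" where
  "intersection_graph_ge n k t =
     \<lparr> pverts = {A. A \<subseteq> {1..n} \<and> card A = k},
       parcs = {(A, B). A \<subseteq> {1..n} \<and> card A = k \<and> B \<subseteq> {1..n} \<and> card B = k \<and>
                  A \<noteq> B \<and> t \<le> card (A \<inter> B)} \<rparr>"

definition frankl_family :: "nat \<Rightarrow> nat \<Rightarrow> nat \<Rightarrow> nat \<Rightarrow> nat set set" where
  "frankl_family n k t r =
     {A. A \<subseteq> {1..n} \<and> card A = k \<and> t + r \<le> card (A \<inter> {1..t + 2 * r})}"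

definition frankl_max :: "nat \<Rightarrow> nat \<Rightarrow> nat \<Rightarrow> nat" where
  "frankl_max n k t = Max {card (frankl_family n k t r) | r. t + 2 * r \<le> n}"

lemma pair_graphI:
  assumes "finite (pverts G)" "parcs G \<subseteq> pverts G \<times> pverts G"
    and "\<And>u v. (u, v) \<in> parcs G \<Longrightarrow> (v, u) \<in> parcs G"
    and "\<And>v. (v, v) \<notin> parcs G"
  shows "pair_graph G"
proof
  show "finite (parcs G)"
    using assms(1,2) by (meson finite_SigmaI finite_subset)
  show "symmetric (with_proj G)"
    unfolding symmetric_def with_proj_simps by (rule symI) (rule assms(3))
  show "fst e \<noteq> snd e" if "e \<in> parcs G" for e
    using that assms(4) by (cases e) auto
qed (use assms(1,2) in auto)

lemma pair_graph_intersection_graph_ge: "pair_graph (intersection_graph_ge n k t)"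
proof (rule pair_graphI)
  show "finite (pverts (intersection_graph_ge n k t))"
    by (simp add: intersection_graph_ge_def)
  show "(B, A) \<in> parcs (intersection_graph_ge n k t)"
    if "(A, B) \<in> parcs (intersection_graph_ge n k t)" for A B
    using that by (auto simp add: intersection_graph_ge_def Int_commute)
qed (auto simp: intersection_graph_ge_def)

lemma pair_graph_inflation:
  assumes "pair_graph H" "is_inflation G H"
  shows "pair_graph G"
proof -
  interpret H: pair_graph H by fact
  obtain C where fin: "\<forall>x\<in>pverts H. finite (C x)"
    and disj: "disjoint_family_on C (pverts H)"
    and V: "pverts G = (\<Union>x\<in>pverts H. C x)"
    and E: "parcs G = {(u, v). \<exists>x\<in>pverts H. \<exists>y\<in>pverts H. u \<in> C x \<and> v \<in> C y \<and>
                    (if x = y then u \<noteq> v else (x, y) \<in> parcs H)}"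
    using assms(2) unfolding is_inflation_def by blast
  have symH: "(y, x) \<in> parcs H" if "(x, y) \<in> parcs H" for x y
    using H.pair_sym_arcs that unfolding symmetric_def with_proj_simps by (rule symD)
  show ?thesis
  proof (rule pair_graphI)
    show "finite (pverts G)"
      unfolding V using fin H.pair_finite_verts by blast
    show "parcs G \<subseteq> pverts G \<times> pverts G"
      unfolding V E by blast
    show "(v, u) \<in> parcs G" if "(u, v) \<in> parcs G" for u v
    proof -
      obtain x y where "x \<in> pverts H" "y \<in> pverts H" "u \<in> C x" "v \<in> C y"
        and "if x = y then u \<noteq> v else (x, y) \<in> parcs H"
        using \<open>(u, v) \<in> parcs G\<close> unfolding E by blast
      moreover from this have "if y = x then v \<noteq> u else (y, x) \<in> parcs H"
        using symH by (metis (full_types))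
      ultimately show ?thesis unfolding E by blast
    qed
    show "(v, v) \<notin> parcs G" for v
    proof
      assume "(v, v) \<in> parcs G"
      then obtain x y where "x \<in> pverts H" "y \<in> pverts H" "v \<in> C x" "v \<in> C y"
        and "if x = y then v \<noteq> v else (x, y) \<in> parcs H"
        unfolding E by blast
      moreover from this have "x \<noteq> y" by metis
      ultimately show False using disj unfolding disjoint_family_on_def by blast
    qed
  qed
qed

end

theory Submission
  imports Defs "HOL-Combinatorics.Permutations"
begin

text \<open>
  Let \<open>T\<close> be the non-adjacency relation of \<open>G\<close>; as \<open>\<alpha>(G) = 2\<close>, it is triangle-free, and the cliques
  of \<open>G\<close> are the independent sets of \<open>T\<close>. A matching of \<open>T\<close> with \<open>\<nu>\<close> edges colours \<open>G\<close> with \<open>|V| - \<nu>\<close>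
  colours, and by the Tutte--Berge formula it suffices to find, in every induced subgraph on \<open>N\<close>
  vertices, a complete minor of order \<open>\<lceil>N/2\<rceil>\<close>. Averaging the largest Frankl family over all permutations
  of the ground set shows that each such subgraph has a clique with at least \<open>(1/4 + 1/62) N\<close>
  vertices. Take a maximum clique \<open>Z\<close> and complete its vertices by disjoint seagulls (induced paths
  on three vertices of \<open>G\<close>) outside \<open>Z\<close>: since \<open>T\<close> is triangle-free, a seagull has a neighbour of
  every other vertex, so singletons of \<open>Z\<close> and seagulls form a complete minor. The seagulls come from
  a weak form of the Chudnovsky--Seymour packing theorem, proved with Hall's theorem and the
  Tutte--Berge formula. Where this loses a vertex too many, one either uses a pair of adjacent
  vertices that dominates \<open>Z\<close> as a branch set, or sets aside five vertices which together with any
  sixth one split into two seagulls. For \<open>N \<le> 15\<close> the density bound is replaced by Ramsey's bound.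
\<close>

section \<open>Hall's theorem and the Tutte--Berge formula\<close>

text \<open>The critical quantity is a spare vertex. In a subgraph with \<open>2h - 1\<close>
  vertices let the maximum clique have \<open>z\<close> vertices and put \<open>s = h - z\<close>.
  Outside it there are \<open>2s + z - 1\<close> vertices, and \<open>s\<close> seagulls are wanted
  there. The packing theorem used asks for \<open>3s + 1\<close> vertices: without the spare one and
  the extra matching edge its induction would meet tight exceptional configurations. Hence
  \<open>z \<ge> s + 2\<close> is comfortable, while \<open>z = s + 1\<close> leaves exactly
  \<open>3s\<close> vertices; the dominating pair (small \<open>s\<close>) and the absorber (large
  \<open>s\<close>) serve to save one vertex in that case.

  The density constant enters solely through \<open>z \<ge> s + 1\<close>. If this fails there are
  at least \<open>4z - 1\<close> vertices, and \<open>33 (4z - 1) \<le> 124 z\<close> holds only for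
  \<open>z \<le> 4\<close>. Density must pass to all induced subgraphs, since the parts that
  Tutte--Berge delivers are arbitrary; this is why the averaging is done with weights.\<close>

theorem hall_marriage:
  assumes "finite I" "\<And>i. i \<in> I \<Longrightarrow> finite (S i)"
    and "\<And>J. J \<subseteq> I \<Longrightarrow> card J \<le> card (\<Union>(S ` J))"
  shows "\<exists>f. inj_on f I \<and> (\<forall>i\<in>I. f i \<in> S i)"
  using assms
proof (induction "card I" arbitrary: I S rule: less_induct)
  case less
  note fin = less.prems(1) and finS = less.prems(2) and hall = less.prems(3)
  show ?case
  \<comment> \<open>Halmos--Vaughan dichotomy: a tight proper subfamily is matched on its own and
    the rest keeps Hall's condition outside its union; if no such subfamily is tight, spending one
    element on one index leaves Hall's condition intact for the others.\<close>
  proof (cases "\<exists>J. J \<subset> I \<and> J \<noteq> {} \<and> card (\<Union>(S ` J)) = card J")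
    case True
    then obtain J where J: "J \<subset> I" "J \<noteq> {}" and tight: "card (\<Union>(S ` J)) = card J" by blast
    have finJ: "finite J" and JI: "J \<subseteq> I" using J(1) fin finite_subset by auto
    have "\<exists>f. inj_on f J \<and> (\<forall>i\<in>J. f i \<in> S i)"
      by (rule less.hyps) (use J fin finS hall in \<open>auto intro: psubset_card_mono finite_subset\<close>)
    then obtain f where f: "inj_on f J" "\<forall>i\<in>J. f i \<in> S i" by blast
    define U where "U = \<Union>(S ` J)"
    have finU: "finite U" unfolding U_def using finJ finS JI by auto
    have "\<exists>g. inj_on g (I - J) \<and> (\<forall>i\<in>I - J. g i \<in> S i - U)"
    proof (rule less.hyps)
      show "card (I - J) < card I"
        using J fin by (intro psubset_card_mono) auto
      show "card L \<le> card (\<Union>i\<in>L. S i - U)" if L: "L \<subseteq> I - J" for L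
      proof -
        have finL: "finite L" using L fin finite_subset by blast
        have finSL: "finite (\<Union>(S ` L))" using L finS finL by auto
        have "card L + card J = card (L \<union> J)"
          by (subst card_Un_disjoint) (use L finL finJ in auto)
        also have "\<dots> \<le> card (\<Union>(S ` (L \<union> J)))"
          using L JI by (intro hall) auto
        also have "\<Union>(S ` (L \<union> J)) = (\<Union>i\<in>L. S i - U) \<union> U" unfolding U_def by auto
        also have "card \<dots> = card (\<Union>i\<in>L. S i - U) + card U"
          by (subst card_Un_disjoint) (use finL L finS finU in auto)
        finally show ?thesis using tight U_def by simp
      qed
    qed (use fin finS in auto)
    then obtain g where g: "inj_on g (I - J)" "\<forall>i\<in>I - J. g i \<in> S i - U" by blast
    define h where "h i = (if i \<in> J then f i else g i)" for i
    have "inj_on h (J \<union> (I - J))"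
      unfolding inj_on_Un
    proof (intro conjI)
      show "inj_on h J" using f(1) by (simp add: h_def inj_on_def)
      show "inj_on h (I - J)" using g(1) by (simp add: h_def inj_on_def)
      have "h ` J \<subseteq> U" "h ` (I - J) \<inter> U = {}"
        using f(2) g(2) unfolding h_def U_def by auto
      then show "h ` (J - (I - J)) \<inter> h ` (I - J - J) = {}" by blast
    qed
    then have "inj_on h I" using JI by (simp add: Un_absorb1)
    moreover have "\<forall>i\<in>I. h i \<in> S i"
      using f g unfolding h_def by auto
    ultimately show ?thesis by blast
  next
    case False
    show ?thesis
    proof (cases "I = {}")
      case True
      then show ?thesis by simp
    next
      case ne: False
      then obtain i0 where i0: "i0 \<in> I" by blast
      have "card {i0} \<le> card (\<Union>(S ` {i0}))" by (rule hall) (use i0 in auto)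
      then obtain s where s: "s \<in> S i0" by (cases "S i0 = {}") auto
      have "\<exists>g. inj_on g (I - {i0}) \<and> (\<forall>i\<in>I - {i0}. g i \<in> S i - {s})"
      proof (rule less.hyps)
        show "card (I - {i0}) < card I" using i0 fin by (intro psubset_card_mono) auto
        show "card L \<le> card (\<Union>i\<in>L. S i - {s})" if L: "L \<subseteq> I - {i0}" for L
        proof (cases "L = {}")
          case False
          have LI: "L \<subset> I" using L i0 by auto
          have finSL: "finite (\<Union>(S ` L))"
            using LI finS finite_subset[OF psubset_imp_subset[OF LI] fin] by auto
          have "card L < card (\<Union>(S ` L))"
            using hall[of L] LI False \<open>\<nexists>J. J \<subset> I \<and> J \<noteq> {} \<and> card (\<Union>(S ` J)) = card J\<close>
            by (metis le_neq_implies_less psubset_imp_subset)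
          moreover have "(\<Union>i\<in>L. S i - {s}) = \<Union>(S ` L) - {s}" by auto
          ultimately show ?thesis using finSL
            by (auto simp: card_Diff_singleton_if)
        qed simp
      qed (use fin finS in auto)
      then obtain g where g: "inj_on g (I - {i0})" "\<forall>i\<in>I - {i0}. g i \<in> S i - {s}" by blast
      have "inj_on (g(i0 := s)) I" using g i0 unfolding inj_on_def by auto
      moreover have "\<forall>i\<in>I. (g(i0 := s)) i \<in> S i" using g s by auto
      ultimately show ?thesis by blast
    qed
  qed
qed

section \<open>Matchings of a relation\<close>

definition matching :: "('a \<Rightarrow> 'a \<Rightarrow> bool) \<Rightarrow> 'a set \<Rightarrow> 'a set set \<Rightarrow> bool" where
  "matching R S M \<longleftrightarrow> finite M \<and> \<Union>M \<subseteq> S \<and> (\<forall>e\<in>M. \<exists>x y. x \<noteq> y \<and> R x y \<and> e = {x, y}) \<and>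
     pairwise disjnt M"

lemma matching_finite: "matching R S M \<Longrightarrow> finite M"
  and matching_subset: "matching R S M \<Longrightarrow> \<Union>M \<subseteq> S"
  by (auto simp: matching_def)

lemma matching_edgeE:
  assumes "matching R S M" "e \<in> M"
  obtains x y where "x \<noteq> y" "R x y" "e = {x, y}"
proof -
  have "\<exists>x y. x \<noteq> y \<and> R x y \<and> e = {x, y}" using assms by (simp add: matching_def)
  then show thesis using that by (elim exE conjE)
qed

lemma matching_empty [simp]: "matching R S {}"
  by (simp add: matching_def)

lemma matching_mono: "matching R S M \<Longrightarrow> S \<subseteq> S' \<Longrightarrow> matching R S' M"
  unfolding matching_def by blast

lemma matching_sub: "matching R S M \<Longrightarrow> M' \<subseteq> M \<Longrightarrow> \<Union>M' \<subseteq> S' \<Longrightarrow> matching R S' M'"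
  unfolding matching_def by (auto intro: finite_subset pairwise_subset)

lemma matching_same_edge:
  assumes "matching R S M" "e \<in> M" "e' \<in> M" "x \<in> e" "x \<in> e'"
  shows "e = e'"
  using assms unfolding matching_def pairwise_def disjnt_def by blast

lemma matching_insert:
  assumes "matching R S M" "x \<noteq> y" "R x y" "x \<in> S" "y \<in> S" "x \<notin> \<Union>M" "y \<notin> \<Union>M"
  shows "matching R S (insert {x, y} M)" and "card (insert {x, y} M) = card M + 1"
proof -
  show "matching R S (insert {x, y} M)"
    using assms unfolding matching_def pairwise_insert by (auto simp: disjnt_def)
  have "{x, y} \<notin> M" using assms by blast
  then show "card (insert {x, y} M) = card M + 1"
    using matching_finite[OF assms(1)] by simp
qed

lemma card_Union_matching:
  assumes "matching R S M"
  shows "card (\<Union>M) = 2 * card M"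
proof -
  have "card (\<Union>M) = (\<Sum>e\<in>M. card e)"
    using assms unfolding matching_def by (intro card_Union_disjoint) auto
  also have "\<dots> = (\<Sum>e\<in>M. 2)"
    using assms by (intro sum.cong) (auto elim!: matching_edgeE)
  finally show ?thesis by simp
qed

lemma matching_card_le:
  assumes "matching R S M" "finite S"
  shows "2 * card M \<le> card S"
  using assms card_Union_matching[OF assms(1)] matching_subset card_mono by metis

lemma matching_Un:
  assumes "matching R S M" "matching R S' M'" "S \<inter> S' = {}" "finite S"
  shows "matching R (S \<union> S') (M \<union> M')" and "card (M \<union> M') = card M + card M'"
proof -
  have "M \<inter> M' = {}"
  proof (rule ccontr)
    assume "M \<inter> M' \<noteq> {}"
    then obtain e where "e \<in> M" "e \<in> M'" by blast
    moreover from this obtain x y where "e = {x, y}" using assms(1) by (meson matching_edgeE)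
    ultimately show False using assms matching_subset by blast
  qed
  then show "card (M \<union> M') = card M + card M'"
    using assms matching_finite by (metis card_Un_disjoint)
  have "disjnt e e'" if "e \<in> M" "e' \<in> M'" for e e'
    using that matching_subset[OF assms(1)] matching_subset[OF assms(2)] assms(3)
    unfolding disjnt_def by blast
  then have "pairwise disjnt (M \<union> M')"
    using assms(1,2) unfolding matching_def pairwise_def by (metis Un_iff disjnt_sym)
  then show "matching R (S \<union> S') (M \<union> M')"
    using assms(1,2) unfolding matching_def by (simp add: ball_Un subset_iff)
qed

definition max_matching :: "('a \<Rightarrow> 'a \<Rightarrow> bool) \<Rightarrow> 'a set \<Rightarrow> 'a set set \<Rightarrow> bool" where
  "max_matching R S M \<longleftrightarrow> matching R S M \<and> (\<forall>M'. matching R S M' \<longrightarrow> card M' \<le> card M)"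

lemma max_matching_exists:
  assumes "finite S"
  shows "\<exists>M. max_matching R S M"
proof -
  have "\<exists>M. matching R S M \<and> (\<forall>M'. matching R S M' \<longrightarrow> card M' \<le> card M)"
  proof (rule ex_has_greatest_nat[of "matching R S" "{}" card "card S + 1"])
    show "\<forall>M. matching R S M \<longrightarrow> card M < card S + 1"
    proof (intro allI impI)
      fix M assume "matching R S M"
      then have "2 * card M \<le> card S" using assms matching_card_le by metis
      then show "card M < card S + 1" by linarith
    qed
  qed simp
  then show ?thesis unfolding max_matching_def by blast
qed

lemma max_matching_card_eq:
  "max_matching R S M \<Longrightarrow> max_matching R S N \<Longrightarrow> card M = card N"
  unfolding max_matching_def by (meson order_antisym)

lemma max_matching_missing_adjacent:
  assumes "max_matching R S M" "x \<in> S - \<Union>M" "y \<in> S - \<Union>M" "x \<noteq> y"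
  shows "\<not> R x y"
proof
  assume "R x y"
  have m: "matching R S M" using assms(1) by (simp add: max_matching_def)
  note ins = matching_insert[OF m assms(4) \<open>R x y\<close>]
  have "card (insert {x, y} M) \<le> card M"
    using assms ins(1) by (simp add: max_matching_def)
  then show False using ins(2) assms by simp
qed

text \<open>Gallai's lemma: being missed together by no maximum matching is a transitive relation
  through any vertex that some maximum matching misses.\<close>

lemma gallai_transitive:
  assumes fin: "finite S" and sym: "\<And>x y. R x y \<Longrightarrow> R y x"
    and t: "max_matching R S N0" "t \<in> S - \<Union>N0"
    and ut: "\<And>N. max_matching R S N \<Longrightarrow> \<not> (u \<notin> \<Union>N \<and> t \<notin> \<Union>N)"
    and tv: "\<And>N. max_matching R S N \<Longrightarrow> \<not> (t \<notin> \<Union>N \<and> v \<notin> \<Union>N)"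
    and M: "max_matching R S M" "u \<notin> \<Union>M" "v \<notin> \<Union>M"
  shows "u = v"
proof (rule ccontr)
  assume uv: "u \<noteq> v"
  have mM: "matching R S M" using M(1) unfolding max_matching_def by blast
  \<comment> \<open>Among the maximum matchings missing \<open>t\<close>, take one that shares most
    edges with \<open>M\<close>; the contradiction will be one that shares more.\<close>
  have "\<exists>N. (max_matching R S N \<and> t \<notin> \<Union>N) \<and>
      (\<forall>N'. max_matching R S N' \<and> t \<notin> \<Union>N' \<longrightarrow> card (M \<inter> N') \<le> card (M \<inter> N))"
  proof (rule ex_has_greatest_nat[of "\<lambda>N. max_matching R S N \<and> t \<notin> \<Union>N" N0
        "\<lambda>N. card (M \<inter> N)" "card M + 1"])
    show "\<forall>N. max_matching R S N \<and> t \<notin> \<Union>N \<longrightarrow> card (M \<inter> N) < card M + 1"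
      using matching_finite[OF mM] by (metis Suc_eq_plus1 card_mono inf_le1 le_imp_less_Suc)
  qed (use t in auto)
  then obtain N where N: "max_matching R S N" "t \<notin> \<Union>N"
    and Nmax: "\<And>N'. max_matching R S N' \<Longrightarrow> t \<notin> \<Union>N' \<Longrightarrow> card (M \<inter> N') \<le> card (M \<inter> N)"
    by blast
  have mN: "matching R S N" using N(1) unfolding max_matching_def by blast
  have finM: "finite (\<Union>M)" and finN: "finite (\<Union>N)"
    using mM mN matching_subset fin finite_subset by metis+
  have uN: "u \<in> \<Union>N" "v \<in> \<Union>N" using ut tv N by blast+
  have eq: "card (\<Union>M) = card (\<Union>N)"
    using card_Union_matching[OF mM] card_Union_matching[OF mN] max_matching_card_eq[OF M(1) N(1)]
    by simp
  \<comment> \<open>Both matchings cover equally many vertices, and \<open>u\<close>,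
    \<open>v\<close> are covered by \<open>N\<close> only, so at least two vertices are covered by
    \<open>M\<close> only; one of them is not \<open>t\<close>.\<close>
  have "card (\<Union>M - \<Union>N) = card (\<Union>N - \<Union>M)"
    using eq finM finN by (metis Int_commute card_Diff_subset_Int finite_Int)
  moreover have "card {u, v} \<le> card (\<Union>N - \<Union>M)"
    using uN M finN by (intro card_mono) auto
  ultimately have "card (\<Union>M - \<Union>N) \<ge> 2" using uv by simp
  then have "\<not> \<Union>M - \<Union>N \<subseteq> {t}"
    by (metis Suc_1 card.empty card_mono finite.emptyI finite.insertI card_insert_disjoint
        empty_iff not_less_eq_eq One_nat_def)
  then obtain x where x: "x \<in> \<Union>M" "x \<notin> \<Union>N" "x \<noteq> t" by blast
  obtain e where e: "e \<in> M" "x \<in> e" using x by blast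
  obtain y where y: "e = {x, y}" "R x y" "x \<noteq> y"
    using mM e sym by (elim matching_edgeE[of R S M e]) (auto simp: doubleton_eq_iff)
  have yS: "x \<in> S" "y \<in> S" using e y mM matching_subset by blast+
  have yN: "y \<in> \<Union>N"
    using max_matching_missing_adjacent[OF N(1), of x y] x y yS by blast
  then obtain e' where e': "e' \<in> N" "y \<in> e'" by blast
  \<comment> \<open>Trading \<open>e'\<close> for the edge \<open>{x, y}\<close> of \<open>M\<close>
    keeps the size and still misses \<open>t\<close>, since the only newly covered vertex is
    \<open>x\<close>.\<close>
  define N' where "N' = insert {x, y} (N - {e'})"
  have yN': "y \<notin> \<Union>(N - {e'})"
    using e' matching_same_edge[OF mN] by blast
  have mNd: "matching R S (N - {e'})"
    using mN by (rule matching_sub) (use matching_subset[OF mN] in auto)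
  have mN': "matching R S N'" "card N' = card (N - {e'}) + 1"
    unfolding N'_def using matching_insert[OF mNd y(3,2) yS _ yN'] x by auto
  have "card N' = card N" using mN' e' matching_finite[OF mN]
    by (metis card.remove Suc_eq_plus1)
  then have "max_matching R S N'" using N(1) mN' unfolding max_matching_def by simp
  moreover have "t \<notin> \<Union>N'"
    using N(2) x(3) yN unfolding N'_def by auto
  ultimately have "card (M \<inter> N') \<le> card (M \<inter> N)" by (rule Nmax)
  moreover have "M \<inter> N' = insert {x, y} (M \<inter> N)"
  proof -
    have "e' \<notin> M" using matching_same_edge[OF mM, of e' e y] e e' y x(2) by blast
    then show ?thesis using e y unfolding N'_def by auto
  qed
  moreover have "{x, y} \<notin> M \<inter> N" using x(2) by blast
  ultimately show False using matching_finite[OF mM] by simp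
qed

section \<open>Barriers and the Tutte--Berge formula\<close>

definition edgeless_partition :: "('a \<Rightarrow> 'a \<Rightarrow> bool) \<Rightarrow> 'a set \<Rightarrow> 'a set set \<Rightarrow> bool" where
  "edgeless_partition R S P \<longleftrightarrow> \<Union>P = S \<and> pairwise disjnt P \<and>
     (\<forall>K\<in>P. \<forall>L\<in>P. K \<noteq> L \<longrightarrow> (\<forall>x\<in>K. \<forall>y\<in>L. \<not> R x y))"

definition odd_parts :: "'a set set \<Rightarrow> nat" where
  "odd_parts P = card {K \<in> P. odd (card K)}"

lemma edgeless_partition_finite:
  "edgeless_partition R S P \<Longrightarrow> finite S \<Longrightarrow> finite P \<and> (\<forall>K\<in>P. finite K)"
  unfolding edgeless_partition_def by (meson Union_upper finite_UnionD finite_subset)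

text \<open>The blocks of \<open>P\<close> need not be connected: only the absence of edges between different
  blocks matters.\<close>

theorem tutte_berge:
  assumes "finite S" and sym: "\<And>x y. R x y \<Longrightarrow> R y x"
  shows "\<exists>M Y P. matching R S M \<and> Y \<subseteq> S \<and> edgeless_partition R (S - Y) P \<and>
     card S + card Y \<le> 2 * card M + odd_parts P"
  using assms(1)
proof (induction "card S" arbitrary: S rule: less_induct)
  case less
  note fin = less.prems
  \<comment> \<open>If \<open>S\<close> splits, both sides are solved separately; a vertex covered
    by all maximum matchings goes into the barrier \<open>Y\<close>; otherwise Gallai's lemma makes
    \<open>S\<close> a single odd part in which a maximum matching misses one vertex.\<close>
  consider (split) A where "A \<subset> S" "A \<noteq> {}" "\<forall>x\<in>A. \<forall>y\<in>S - A. \<not> R x y"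
    | (ess) v where "v \<in> S" "\<And>M. max_matching R S M \<Longrightarrow> v \<in> \<Union>M"
    | (crit) "\<And>A. A \<subset> S \<Longrightarrow> A \<noteq> {} \<Longrightarrow> \<exists>x\<in>A. \<exists>y\<in>S - A. R x y"
        "\<And>v. v \<in> S \<Longrightarrow> \<exists>M. max_matching R S M \<and> v \<notin> \<Union>M"
    by metis
  then show ?case
  proof cases
    case split
    define B where "B = S - A"
    have AB: "A \<inter> B = {}" "A \<union> B = S" "finite A" "finite B" "A \<subset> S" "B \<subset> S"
      using split fin unfolding B_def by (auto intro: finite_subset)
    have cl: "card A < card S" "card B < card S" using AB fin psubset_card_mono by metis+
    from less.hyps[OF cl(1) AB(3)] obtain M1 Y1 P1 where 1: "matching R A M1" "Y1 \<subseteq> A"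
      "edgeless_partition R (A - Y1) P1" "card A + card Y1 \<le> 2 * card M1 + odd_parts P1" by blast
    from less.hyps[OF cl(2) AB(4)] obtain M2 Y2 P2 where 2: "matching R B M2" "Y2 \<subseteq> B"
      "edgeless_partition R (B - Y2) P2" "card B + card Y2 \<le> 2 * card M2 + odd_parts P2" by blast
    have m: "matching R S (M1 \<union> M2)" "card (M1 \<union> M2) = card M1 + card M2"
      using matching_Un[OF 1(1) 2(1) AB(1,3)] AB by auto
    have cY: "card (Y1 \<union> Y2) = card Y1 + card Y2" 
      using 1(2) 2(2) AB finite_subset by (intro card_Un_disjoint) blast+
    have cS: "card S = card A + card B" using AB by (metis card_Un_disjoint)
    have U12: "\<Union>P1 = A - Y1" "\<Union>P2 = B - Y2" "pairwise disjnt P1" "pairwise disjnt P2"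
      using 1(3) 2(3) by (simp_all add: edgeless_partition_def)
    have cross: "K \<inter> L = {}" "\<forall>x\<in>K. \<forall>y\<in>L. \<not> R x y \<and> \<not> R y x"
      if "K \<in> P1" "L \<in> P2" for K L
    proof -
      have sub: "K \<subseteq> A" "L \<subseteq> B" using that U12 by blast+
      show "K \<inter> L = {}" using sub AB(1) by blast
      show "\<forall>x\<in>K. \<forall>y\<in>L. \<not> R x y \<and> \<not> R y x"
      proof (intro ballI)
        fix x y assume "x \<in> K" "y \<in> L"
        then have "\<not> R x y" using sub split(3) unfolding B_def by blast
        then show "\<not> R x y \<and> \<not> R y x" using sym by blast
      qed
    qed
    have part: "edgeless_partition R (S - (Y1 \<union> Y2)) (P1 \<union> P2)"
      unfolding edgeless_partition_def
    proof (intro conjI)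
      show "\<Union>(P1 \<union> P2) = S - (Y1 \<union> Y2)"
        using U12 1(2) 2(2) AB(1,2) by auto
      show "pairwise disjnt (P1 \<union> P2)"
        unfolding pairwise_def disjnt_def
      proof (intro ballI impI)
        fix K L assume "K \<in> P1 \<union> P2" "L \<in> P1 \<union> P2" "K \<noteq> L"
        then consider "K \<in> P1" "L \<in> P1" | "K \<in> P2" "L \<in> P2" | "K \<in> P1" "L \<in> P2" | "L \<in> P1" "K \<in> P2"
          by blast
        then show "K \<inter> L = {}"
        proof cases
          case 4
          then show ?thesis using cross(1) by (metis Int_commute)
        qed (use U12(3,4) cross(1) \<open>K \<noteq> L\<close> in \<open>simp_all add: pairwise_def disjnt_def\<close>)
      qed
      show "\<forall>K\<in>P1 \<union> P2. \<forall>L\<in>P1 \<union> P2. K \<noteq> L \<longrightarrow> (\<forall>x\<in>K. \<forall>y\<in>L. \<not> R x y)"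
      proof (intro ballI impI)
        fix K L x y assume KL: "K \<in> P1 \<union> P2" "L \<in> P1 \<union> P2" "K \<noteq> L" and xy: "x \<in> K" "y \<in> L"
        consider "K \<in> P1" "L \<in> P1" | "K \<in> P2" "L \<in> P2" | "K \<in> P1" "L \<in> P2" | "K \<in> P2" "L \<in> P1"
          using KL by blast
        then show "\<not> R x y"
        proof cases
          case 1
          then show ?thesis using \<open>edgeless_partition R (A - Y1) P1\<close> KL(3) xy
            by (simp add: edgeless_partition_def)
        next
          case 2
          then show ?thesis using \<open>edgeless_partition R (B - Y2) P2\<close> KL(3) xy
            by (simp add: edgeless_partition_def)
        qed (use cross(2) xy in blast)+
      qed
    qed
    have "odd_parts (P1 \<union> P2) = odd_parts P1 + odd_parts P2"
    proof -
      have f: "finite P1" "finite P2" using 1 2 AB edgeless_partition_finite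
        by (metis finite_Diff)+
      have "{K \<in> P1 \<union> P2. odd (card K)} = {K \<in> P1. odd (card K)} \<union> {K \<in> P2. odd (card K)}"
        by auto
      moreover have "{K \<in> P1. odd (card K)} \<inter> {K \<in> P2. odd (card K)} = {}"
        using cross(1) by (metis (no_types, lifting) Int_emptyI card.empty even_zero inf.idem
            mem_Collect_eq)
      ultimately show ?thesis unfolding odd_parts_def using f by (simp add: card_Un_disjoint)
    qed
    then show ?thesis using m cY cS part 1 2 AB
      by (intro exI[of _ "M1 \<union> M2"] exI[of _ "Y1 \<union> Y2"] exI[of _ "P1 \<union> P2"]) auto
  next
    case ess
    have "card (S - {v}) < card S" using ess fin by (meson card_Diff1_less)
    from less.hyps[OF this] obtain M Y P where 1: "matching R (S - {v}) M" "Y \<subseteq> S - {v}"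
      "edgeless_partition R (S - {v} - Y) P"
      "card (S - {v}) + card Y \<le> 2 * card M + odd_parts P" using fin by auto
    obtain M0 where M0: "max_matching R S M0" using max_matching_exists fin by blast
    have mM: "matching R S M" using 1(1) by (rule matching_mono) auto
    have "card M \<noteq> card M0"
    proof
      assume "card M = card M0"
      then have "max_matching R S M" using M0 mM unfolding max_matching_def by simp
      then show False using ess(2) 1(1) matching_subset by blast
    qed
    then have "card M < card M0" using M0 mM unfolding max_matching_def by (meson le_neq_implies_less)
    moreover have "card (insert v Y) = card Y + 1"
      using 1 fin by (subst card_insert_disjoint) (auto intro: finite_subset)
    moreover have "card S = card (S - {v}) + 1"
      using ess fin by (metis Suc_eq_plus1 card.remove)
    moreover have "S - insert v Y = S - {v} - Y" by auto
    ultimately show ?thesis using 1 ess M0 unfolding max_matching_def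
      by (intro exI[of _ M0] exI[of _ "insert v Y"] exI[of _ P]) auto
  next
    case crit
    show ?thesis
    proof (cases "S = {}")
      case True
      then show ?thesis
        by (intro exI[of _ "{}"]) (auto simp: edgeless_partition_def)
    next
      case False
      then obtain u where u: "u \<in> S" by blast
      \<comment> \<open>Gallai's lemma closes \<open>U\<close> under \<open>R\<close>, so without a
        split it is all of \<open>S\<close>, and a maximum matching that misses \<open>u\<close>
        misses nothing else.\<close>
      define U where "U = {v \<in> S. v = u \<or> (\<forall>N. max_matching R S N \<longrightarrow> \<not> (u \<notin> \<Union>N \<and> v \<notin> \<Union>N))}"
      have "U = S"
      proof (rule ccontr)
        assume "U \<noteq> S"
        then have "U \<subset> S" "U \<noteq> {}" using u unfolding U_def by auto
        then obtain t y where ty: "t \<in> U" "y \<in> S - U" "R t y" using crit(1) by blast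
        have yu: "y \<noteq> u" "t \<noteq> y" "y \<in> S" "t \<in> S" using ty u unfolding U_def by auto
        have adj: "\<not> (t \<notin> \<Union>N \<and> y \<notin> \<Union>N)" if "max_matching R S N" for N
          using max_matching_missing_adjacent[OF that, of t y] ty yu by blast
        obtain N1 where N1: "max_matching R S N1" "u \<notin> \<Union>N1" "y \<notin> \<Union>N1"
          using ty yu unfolding U_def by blast
        have "t \<noteq> u" using adj N1 by blast
        then have ut: "\<not> (u \<notin> \<Union>N \<and> t \<notin> \<Union>N)" if "max_matching R S N" for N
          using that ty unfolding U_def by blast
        obtain N0 where N0: "max_matching R S N0" "t \<in> S - \<Union>N0" using crit(2) yu by blast
        have "u = y"
          by (rule gallai_transitive[of S R N0 t u y N1]) (use fin sym N0 ut adj N1 in auto)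
        then show False using yu by simp
      qed
      obtain M where M: "max_matching R S M" "u \<notin> \<Union>M" using crit(2) u by blast
      have "S - \<Union>M = {u}" using M u \<open>U = S\<close> unfolding U_def by blast
      moreover have "\<Union>M \<subseteq> S" using M matching_subset unfolding max_matching_def by blast
      ultimately have "S = insert u (\<Union>M)" by auto
      moreover have "finite (\<Union>M)" using \<open>\<Union>M \<subseteq> S\<close> fin finite_subset by blast
      ultimately have "card S = 2 * card M + 1"
        using M card_Union_matching unfolding max_matching_def
        by (metis Suc_eq_plus1 card_insert_disjoint)
      moreover from this have "odd_parts {S} = 1"
        unfolding odd_parts_def by (simp add: Collect_conv_if)
      moreover have "edgeless_partition R (S - {}) {S}" by (simp add: edgeless_partition_def)
      moreover have "matching R S M" using M by (simp add: max_matching_def)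
      ultimately show ?thesis
        by (intro exI[of _ M] exI[of _ "{}"] exI[of _ "{S}"]) simp
    qed
  qed
qed

section \<open>Seagulls and cutsets\<close>

locale triangle_free =
  fixes T :: "'a \<Rightarrow> 'a \<Rightarrow> bool"
  assumes T_sym: "T x y \<Longrightarrow> T y x"
    and T_irrefl: "\<not> T x x"
    and T_triangle: "T x y \<Longrightarrow> T y z \<Longrightarrow> \<not> T x z"
begin

definition indep :: "'a set \<Rightarrow> bool" where
  "indep C \<longleftrightarrow> (\<forall>x\<in>C. \<forall>y\<in>C. \<not> T x y)"

definition joined :: "'a set \<Rightarrow> 'a set \<Rightarrow> bool" where
  "joined A B \<longleftrightarrow> A \<noteq> {} \<and> B \<noteq> {} \<and> (\<forall>a\<in>A. \<forall>b\<in>B. T a b)"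

text \<open>The induced path of \<open>G\<close> with ends \<open>a\<close>, \<open>b\<close> and
  middle vertex \<open>c\<close>.\<close>

definition seagull :: "'a set \<Rightarrow> bool" where
  "seagull Q \<longleftrightarrow> (\<exists>a b c. Q = {a, b, c} \<and> T a b \<and> \<not> T a c \<and> \<not> T b c \<and> c \<noteq> a \<and> c \<noteq> b)"

definition packs :: "'a set \<Rightarrow> nat \<Rightarrow> bool" where
  "packs V k \<longleftrightarrow> (\<exists>F. finite F \<and> card F = k \<and> pairwise disjnt F \<and> (\<forall>Q\<in>F. seagull Q \<and> Q \<subseteq> V))"

text \<open>If \<open>A\<close> and \<open>B\<close> are joined by \<open>T\<close>, then
  \<open>G\<close> has no edge between them and \<open>V - (A \<union> B)\<close> is a vertex cut;
  so this says that every vertex cut has at least \<open>k\<close> vertices.\<close>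

definition highly_connected :: "'a set \<Rightarrow> nat \<Rightarrow> bool" where
  "highly_connected V k \<longleftrightarrow> (\<forall>A B. A \<subseteq> V \<longrightarrow> B \<subseteq> V \<longrightarrow> joined A B \<longrightarrow> card A + card B + k \<le> card V)"

definition mixed :: "'a set \<Rightarrow> 'a set \<Rightarrow> 'a set" where
  "mixed V C = {v \<in> V - C. (\<exists>c\<in>C. T v c) \<and> (\<exists>c\<in>C. \<not> T v c)}"

text \<open>The packing obstruction at a clique: a seagull with two vertices in \<open>C\<close> has
  a mixed third vertex, and any other has at least two vertices outside \<open>C\<close>. So each
  seagull uses up at least 2 of the weight, and \<open>k\<close> disjoint ones need
  \<open>2 * k\<close>.\<close>

definition weight :: "'a set \<Rightarrow> 'a set \<Rightarrow> nat" where
  "weight V C = card (V - C) + card (mixed V C)"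

definition heavy_cliques :: "'a set \<Rightarrow> nat \<Rightarrow> bool" where
  "heavy_cliques V m \<longleftrightarrow> (\<forall>C. C \<subseteq> V \<longrightarrow> C \<noteq> {} \<longrightarrow> indep C \<longrightarrow> m \<le> weight V C)"

lemma T_neq: "T x y \<Longrightarrow> x \<noteq> y"
  using T_irrefl by blast

lemma indepD: "indep C \<Longrightarrow> x \<in> C \<Longrightarrow> y \<in> C \<Longrightarrow> \<not> T x y"
  by (simp add: indep_def)

lemma indep_subset: "indep C \<Longrightarrow> D \<subseteq> C \<Longrightarrow> indep D"
  unfolding indep_def by blast

lemma joined_sym: "joined A B \<Longrightarrow> joined B A"
  unfolding joined_def using T_sym by blast

lemma joined_indep: "joined A B \<Longrightarrow> indep A"
  unfolding joined_def indep_def using T_triangle T_sym by blast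

lemma joined_disjoint: "joined A B \<Longrightarrow> A \<inter> B = {}"
  unfolding joined_def using T_irrefl by blast

lemma seagullI: "T a b \<Longrightarrow> \<not> T a c \<Longrightarrow> \<not> T b c \<Longrightarrow> c \<noteq> a \<Longrightarrow> c \<noteq> b \<Longrightarrow> seagull {a, b, c}"
  unfolding seagull_def by blast

lemma seagull_card: "seagull Q \<Longrightarrow> card Q = 3 \<and> finite Q"
  unfolding seagull_def using T_neq by auto

lemma seagull_nonempty: "seagull Q \<Longrightarrow> Q \<noteq> {}"
  unfolding seagull_def by blast

lemma packs_0: "packs V 0"
  unfolding packs_def by (intro exI[of _ "{}"]) auto

lemma packs_mono: "packs V k \<Longrightarrow> V \<subseteq> V' \<Longrightarrow> packs V' k"
  unfolding packs_def by (elim exE) (metis subset_trans)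

lemma packs_Un:
  assumes "packs V k" "packs V' k'" "V \<inter> V' = {}"
  shows "packs (V \<union> V') (k + k')"
proof -
  obtain F where F: "finite F" "card F = k" "pairwise disjnt F" "\<forall>Q\<in>F. seagull Q \<and> Q \<subseteq> V"
    using assms unfolding packs_def by auto
  obtain F' where F': "finite F'" "card F' = k'" "pairwise disjnt F'"
    "\<forall>Q\<in>F'. seagull Q \<and> Q \<subseteq> V'"
    using assms unfolding packs_def by auto
  have dj: "Q \<inter> Q' = {}" if "Q \<in> F" "Q' \<in> F'" for Q Q'
    using that F F' assms(3) by blast
  have "F \<inter> F' = {}"
  proof (rule ccontr)
    assume "F \<inter> F' \<noteq> {}"
    then obtain Q where "Q \<in> F" "Q \<in> F'" by blast
    then show False using dj[of Q Q] F seagull_nonempty by auto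
  qed
  then have "card (F \<union> F') = k + k'" using F F' by (simp add: card_Un_disjoint)
  moreover have "pairwise disjnt (F \<union> F')"
    unfolding pairwise_def disjnt_def
  proof (intro ballI impI)
    fix K L assume "K \<in> F \<union> F'" "L \<in> F \<union> F'" "K \<noteq> L"
    then consider "K \<in> F" "L \<in> F" | "K \<in> F'" "L \<in> F'" | "K \<in> F" "L \<in> F'" | "L \<in> F" "K \<in> F'"
      by blast
    then show "K \<inter> L = {}"
    proof cases
      case 4
      then show ?thesis using dj by (metis Int_commute)
    qed (use F F' dj \<open>K \<noteq> L\<close> in \<open>simp_all add: pairwise_def disjnt_def\<close>)
  qed
  moreover have "\<forall>Q\<in>F \<union> F'. seagull Q \<and> Q \<subseteq> V \<union> V'" using F(4) F'(4) by blast
  ultimately show ?thesis unfolding packs_def using F(1) F'(1)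
    by (intro exI[of _ "F \<union> F'"]) auto
qed

lemma packs_family:
  assumes "finite I" "\<And>i. i \<in> I \<Longrightarrow> seagull (q i)" "\<And>i. i \<in> I \<Longrightarrow> q i \<subseteq> V"
    and "\<And>i j. i \<in> I \<Longrightarrow> j \<in> I \<Longrightarrow> i \<noteq> j \<Longrightarrow> q i \<inter> q j = {}"
  shows "packs V (card I)"
proof -
  have "inj_on q I"
  proof (rule inj_onI, rule ccontr)
    fix i j assume ij: "i \<in> I" "j \<in> I" "q i = q j" "i \<noteq> j"
    then have "q i = {}" using assms(4)[of i j] by simp
    then show False using assms(2) ij seagull_nonempty by blast
  qed
  then have "card (q ` I) = card I" by (rule card_image)
  moreover have "pairwise disjnt (q ` I)"
    using assms(4) unfolding pairwise_def disjnt_def by (metis imageE)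
  ultimately show ?thesis unfolding packs_def using assms(1-3)
    by (intro exI[of _ "q ` I"]) auto
qed

lemma packs_seagull: "seagull Q \<Longrightarrow> packs Q 1"
  unfolding packs_def by (intro exI[of _ "{Q}"]) auto

lemma packs_add_seagull:
  assumes "seagull Q" "Q \<subseteq> V" "packs (V - Q) k"
  shows "packs V (Suc k)"
proof -
  have "packs (Q \<union> (V - Q)) (1 + k)"
    by (rule packs_Un) (use assms packs_seagull in auto)
  then show ?thesis using assms(2) by (simp add: Un_absorb1)
qed

lemma highly_connectedD:
  "highly_connected V k \<Longrightarrow> A \<subseteq> V \<Longrightarrow> B \<subseteq> V \<Longrightarrow> joined A B \<Longrightarrow> card A + card B + k \<le> card V"
  unfolding highly_connected_def by blast

lemma highly_connected_remove:
  assumes "highly_connected V k" "card V \<le> card V' + m" "V' \<subseteq> V" "j + m \<le> k"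
  shows "highly_connected V' j"
  unfolding highly_connected_def
proof (intro allI impI)
  fix A B assume "A \<subseteq> V'" "B \<subseteq> V'" "joined A B"
  then have "card A + card B + k \<le> card V"
    using assms(1,3) highly_connectedD by (meson subset_trans)
  then show "card A + card B + j \<le> card V'" using assms by linarith
qed

text \<open>If \<open>A\<close> and \<open>B\<close> are joined, then \<open>J \<union> B\<close> is joined to the part of \<open>A\<close> that \<open>J\<close> is joined to,
  so connectivity is Hall's condition for matching the cutset into \<open>A\<close> along non-edges.\<close>

lemma cutset_hall:
  assumes fin: "finite V" and conn: "highly_connected V k"
    and sub: "A \<subseteq> V" "B \<subseteq> V" and AB: "joined A B" and cut: "card A + card B + k = card V"
    and J: "J \<subseteq> V - (A \<union> B)" "J \<noteq> {}"
    and ne: "{a \<in> A. \<forall>x\<in>J. T x a} \<noteq> {}"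
  shows "card J \<le> card {a \<in> A. \<exists>x\<in>J. \<not> T x a}"
proof -
  define A0 where "A0 = {a \<in> A. \<forall>x\<in>J. T x a}"
  have finA: "finite A" "finite B" "finite J"
    using sub J(1) fin by (meson Diff_subset finite_subset)+
  have "joined A0 (J \<union> B)"
    using ne AB J(2) T_sym unfolding joined_def A0_def by blast
  then have "card A0 + card (J \<union> B) + k \<le> card V"
    using conn sub J(1) by (intro highly_connectedD) (auto simp: A0_def)
  moreover have "card (J \<union> B) = card J + card B"
    using J finA by (intro card_Un_disjoint) auto
  moreover have "card A0 + card {a \<in> A. \<exists>x\<in>J. \<not> T x a} = card A"
  proof -
    have "card (A0 \<union> {a \<in> A. \<exists>x\<in>J. \<not> T x a}) = card A0 + card {a \<in> A. \<exists>x\<in>J. \<not> T x a}"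
      using finA unfolding A0_def by (intro card_Un_disjoint) auto
    moreover have "A0 \<union> {a \<in> A. \<exists>x\<in>J. \<not> T x a} = A" unfolding A0_def by blast
    ultimately show ?thesis by simp
  qed
  ultimately show ?thesis using cut by linarith
qed

text \<open>\<open>cutset_hall\<close> settles the sets of cutset vertices that have a common
  \<open>T\<close>-neighbour in \<open>A\<close>; any other set sees all of \<open>A\<close>, and
  there \<open>k \<le> card A\<close> suffices because the cutset has \<open>k\<close>
  vertices.\<close>

lemma cutset_matching:
  assumes fin: "finite V" and conn: "highly_connected V k"
    and sub: "A \<subseteq> V" "B \<subseteq> V" and AB: "joined A B" and cut: "card A + card B + k = card V"
    and big: "k \<le> card A"
  shows "\<exists>f. inj_on f (V - (A \<union> B)) \<and> (\<forall>x\<in>V - (A \<union> B). f x \<in> A \<and> \<not> T x (f x))"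
proof -
  have finA: "finite A" "finite B" using fin sub by (meson finite_subset)+
  have "card (A \<union> B) = card A + card B"
    using finA joined_disjoint[OF AB] by (rule card_Un_disjoint)
  then have cX: "card (V - (A \<union> B)) = k"
    using cut sub fin by (subst card_Diff_subset) (auto intro: finite_subset)
  have "\<exists>f. inj_on f (V - (A \<union> B)) \<and> (\<forall>x\<in>V - (A \<union> B). f x \<in> {a \<in> A. \<not> T x a})"
  proof (rule hall_marriage)
    fix J assume J: "J \<subseteq> V - (A \<union> B)"
    have U: "(\<Union>x\<in>J. {a \<in> A. \<not> T x a}) = {a \<in> A. \<exists>x\<in>J. \<not> T x a}" by blast
    show "card J \<le> card (\<Union>x\<in>J. {a \<in> A. \<not> T x a})"
    proof (cases "{a \<in> A. \<forall>x\<in>J. T x a} = {}")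
      case False
      then show ?thesis unfolding U using cutset_hall[OF fin conn sub AB cut J] by (cases "J = {}") simp_all
    next
      case True
      then have "{a \<in> A. \<exists>x\<in>J. \<not> T x a} = A" by blast
      moreover have "card J \<le> k" using J fin cX card_mono by (metis finite_Diff)
      ultimately show ?thesis unfolding U using big by simp
    qed
  qed (use fin finA in auto)
  then show ?thesis by auto
qed

text \<open>Each of the \<open>k\<close> cutset vertices gets its own seagull. If both sides have at
  least \<open>k\<close> vertices, it is the middle vertex between one vertex of \<open>A\<close>
  and one of \<open>B\<close>. If \<open>A\<close> is smaller, only \<open>card A\<close> seagulls
  can be of that kind; the others consist of a cutset vertex and two vertices of the clique
  \<open>B\<close>, one adjacent to it in \<open>G\<close> and one not. Finding those is where the
  weight condition enters.\<close>

lemma packs_cutset: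
  assumes fin: "finite V" and conn: "highly_connected V k" and heavy: "heavy_cliques V (2 * k)"
    and size: "3 * k \<le> card V"
    and sub: "A \<subseteq> V" "B \<subseteq> V" and AB: "joined A B" and cut: "card A + card B + k = card V"
    and le: "card A \<le> card B"
  shows "packs V k"
proof -
  define X where "X = V - (A \<union> B)"
  have finA: "finite A" "finite B" "finite X"
    unfolding X_def using fin sub by (meson finite_subset finite_Diff)+
  have dj: "A \<inter> B = {}" "A \<inter> X = {}" "B \<inter> X = {}"
    using joined_disjoint[OF AB] unfolding X_def by auto
  have "card (A \<union> B) = card A + card B"
    using finA(1,2) dj(1) by (rule card_Un_disjoint)
  then have cX: "card X = k" unfolding X_def
    using cut sub fin by (subst card_Diff_subset) (auto intro: finite_subset)
  have XV: "X \<subseteq> V" unfolding X_def by auto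
  have TAB: "T a b" if "a \<in> A" "b \<in> B" for a b using AB that unfolding joined_def by blast
  have indB: "indep B" using AB joined_sym joined_indep by blast
  show ?thesis
  proof (cases "k \<le> card A")
    case True
    obtain f where f: "inj_on f X" "\<And>x. x \<in> X \<Longrightarrow> f x \<in> A \<and> \<not> T x (f x)"
      using cutset_matching[OF fin conn sub AB cut True] unfolding X_def by blast
    have cut': "card B + card A + k = card V" using cut by simp
    have "B \<union> A = A \<union> B" by blast
    then obtain g where g: "inj_on g X" "\<And>x. x \<in> X \<Longrightarrow> g x \<in> B \<and> \<not> T x (g x)"
      using cutset_matching[OF fin conn sub(2,1) joined_sym[OF AB] cut'] True le unfolding X_def
      by (metis order_trans)
    have "packs V (card X)"
    proof (rule packs_family[where q = "\<lambda>x. {f x, g x, x}"])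
      fix x assume x: "x \<in> X"
      have "f x \<noteq> x" "g x \<noteq> x" using f(2)[OF x] g(2)[OF x] dj x by auto
      then show "seagull {f x, g x, x}"
        using TAB f(2)[OF x] g(2)[OF x] T_sym by (intro seagullI) auto
      show "{f x, g x, x} \<subseteq> V" using f(2)[OF x] g(2)[OF x] sub XV x by auto
    next
      fix x y assume xy: "x \<in> X" "y \<in> X" "x \<noteq> y"
      have "f x \<noteq> f y" "g x \<noteq> g y" using xy f(1) g(1) by (auto dest: inj_onD)
      then show "{f x, g x, x} \<inter> {f y, g y, y} = {}"
        using f(2)[OF xy(1)] f(2)[OF xy(2)] g(2)[OF xy(1)] g(2)[OF xy(2)] dj xy by auto
    qed (use finA in auto)
    then show ?thesis using cX by simp
  next
    case False
    define a where "a = card A"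
    have a: "a < k" using False a_def by simp
    \<comment> \<open>Every cutset vertex asks for two partners: a vertex of \<open>B\<close> not
      \<open>T\<close>-adjacent to it, and either a \<open>T\<close>-adjacent one or one of
      \<open>a\<close> dummies \<open>Inr\<close>. A dummy marks a vertex whose seagull will use
      \<open>A\<close> instead.\<close>
    define S :: "'a \<times> bool \<Rightarrow> ('a + nat) set" where
      "S p = (if snd p then Inl ` {b \<in> B. \<not> T (fst p) b}
              else Inl ` {b \<in> B. T (fst p) b} \<union> Inr ` {..<a})" for p
    have "\<exists>f. inj_on f (X \<times> UNIV) \<and> (\<forall>p\<in>X \<times> UNIV. f p \<in> S p)"
    proof (rule hall_marriage)
      show "finite (X \<times> (UNIV :: bool set))" using finA by simp
      show "finite (S p)" for p unfolding S_def using finA by simp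
      fix J :: "('a \<times> bool) set" assume J: "J \<subseteq> X \<times> UNIV"
      define J1 where "J1 = {x. (x, True) \<in> J}"
      define J2 where "J2 = {x. (x, False) \<in> J}"
      have J12: "J1 \<subseteq> X" "J2 \<subseteq> X" using J unfolding J1_def J2_def by auto
      have finJ: "finite J1" "finite J2" using J12 finA by (meson finite_subset)+
      have cJ: "card J = card J1 + card J2"
      proof -
        have "J = J1 \<times> {True} \<union> J2 \<times> {False}"
          unfolding J1_def J2_def by (auto, (metis (full_types))+)
        moreover have "card (J1 \<times> {True} \<union> J2 \<times> {False}) = card (J1 \<times> {True}) + card (J2 \<times> {False})"
          using finJ by (intro card_Un_disjoint) auto
        ultimately show ?thesis by (simp add: card_cartesian_product)
      qed
      have cJk: "card J1 \<le> k" "card J2 \<le> k" using J12 finA(3) cX card_mono by metis+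
      \<comment> \<open>The vertices of \<open>B\<close> that no request in \<open>J\<close>
        accepts; all of \<open>B - C0\<close> is available to \<open>J\<close>, and so are all
        dummies once \<open>J2\<close> is nonempty.\<close>
      define C0 where "C0 = {b \<in> B. (\<forall>x\<in>J1. T x b) \<and> (\<forall>x\<in>J2. \<not> T x b)}"
      have C0B: "C0 \<subseteq> B" unfolding C0_def by auto
      have cC0: "card (B - C0) + card C0 = card B"
        using C0B finA by (metis card_Diff_subset card_mono finite_subset le_add_diff_inverse2)
      have memU: "Inl ` (B - C0) \<subseteq> \<Union>(S ` J)"
      proof
        fix u :: "'a + nat" assume "u \<in> Inl ` (B - C0)"
        then obtain b where b: "u = Inl b" "b \<in> B" "b \<notin> C0" by blast
        then consider x where "(x, True) \<in> J" "\<not> T x b" | x where "(x, False) \<in> J" "T x b"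
          unfolding C0_def J1_def J2_def by blast
        then show "u \<in> \<Union>(S ` J)"
        proof cases
          case 1
          then have "u \<in> S (x, True)" using b unfolding S_def by simp
          then show ?thesis using 1 by blast
        next
          case 2
          then have "u \<in> S (x, False)" using b unfolding S_def by simp
          then show ?thesis using 2 by blast
        qed
      qed
      have finU: "finite (\<Union>(S ` J))"
      proof -
        have "finite J" using J finA finite_subset by (metis finite_SigmaI finite_UNIV)
        then show ?thesis using \<open>\<And>p. finite (S p)\<close> by simp
      qed
      show "card J \<le> card (\<Union>(S ` J))"
      proof (cases "J2 = {}")
        case True
        have "card J1 \<le> card (B - C0)"
        proof (cases "J1 = {} \<or> C0 = {}")
          case True
          have "k \<le> card B" using le size cut a a_def by linarith
          then show ?thesis using True cJk(1) by auto
        next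
          case False
          have "card J1 \<le> card {b \<in> B. \<exists>x\<in>J1. \<not> T x b}"
          proof (rule cutset_hall[OF fin conn sub(2,1) joined_sym[OF AB]])
            show "card B + card A + k = card V" using cut by simp
            show "J1 \<subseteq> V - (B \<union> A)" using J12 X_def by auto
            show "{b \<in> B. \<forall>x\<in>J1. T x b} \<noteq> {}" using False \<open>J2 = {}\<close> unfolding C0_def by auto
          qed (use False in auto)
          moreover have "{b \<in> B. \<exists>x\<in>J1. \<not> T x b} = B - C0"
            using \<open>J2 = {}\<close> unfolding C0_def by auto
          ultimately show ?thesis by simp
        qed
        also have "\<dots> = card (Inl ` (B - C0) :: ('a + nat) set)"
          by (simp add: card_image)
        also have "\<dots> \<le> card (\<Union>(S ` J))" using memU finU by (rule card_mono[rotated])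
        finally show ?thesis using cJ True by simp
      next
        case False
        then obtain x0 where x0: "(x0, False) \<in> J" unfolding J2_def by blast
        have "Inr ` {..<a} \<subseteq> S (x0, False)" unfolding S_def by simp
        then have "Inr ` {..<a} \<subseteq> \<Union>(S ` J)" using x0 by blast
        then have "card (Inl ` (B - C0) \<union> Inr ` {..<a}) \<le> card (\<Union>(S ` J))"
          using memU finU by (intro card_mono) auto
        moreover have "card (Inl ` (B - C0) \<union> Inr ` {..<a}) = card (B - C0) + a"
          using finA by (subst card_Un_disjoint) (auto simp: card_image)
        moreover have "card J1 + card J2 \<le> card (B - C0) + a"
        proof (cases "C0 = {}")
          case True
          then show ?thesis using cJk size cut a_def by simp
        next
          case ne: False
          then have dJ: "J1 \<inter> J2 = {}" unfolding C0_def by blast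
          \<comment> \<open>\<open>A\<close> is entirely and \<open>B\<close> nowhere
            \<open>T\<close>-adjacent to \<open>C0\<close>, and \<open>J1\<close>, \<open>J2\<close>
            are uniform on it by construction. With so few mixed vertices,
            \<open>2 * k \<le> weight V C0\<close> turns into an upper bound on
            \<open>card C0\<close>.\<close>
          have "mixed V C0 \<subseteq> X - (J1 \<union> J2)"
          proof
            fix v assume v: "v \<in> mixed V C0"
            then obtain c c' where c: "v \<in> V" "c \<in> C0" "T v c" "c' \<in> C0" "\<not> T v c'"
              unfolding mixed_def by blast
            have "v \<notin> A" using TAB c C0B by blast
            moreover have "v \<notin> B" using indB c C0B indepD by blast
            moreover have "v \<notin> J1" using c unfolding C0_def by blast
            moreover have "v \<notin> J2" using c unfolding C0_def by blast
            ultimately show "v \<in> X - (J1 \<union> J2)" using c unfolding X_def by blast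
          qed
          then have "card (mixed V C0) \<le> card (X - (J1 \<union> J2))"
            using finA by (intro card_mono) auto
          also have "card (X - (J1 \<union> J2)) = k - (card J1 + card J2)"
            using J12 finJ cX dJ by (subst card_Diff_subset) (auto simp: card_Un_disjoint)
          finally have m: "card (mixed V C0) \<le> k - (card J1 + card J2)" .
          have "card (J1 \<union> J2) \<le> card X" using J12 finA by (intro card_mono) auto
          then have le12: "card J1 + card J2 \<le> k" using cX dJ finJ by (simp add: card_Un_disjoint)
          have "2 * k \<le> weight V C0"
            using heavy ne C0B sub indep_subset[OF indB C0B] unfolding heavy_cliques_def by blast
          moreover have "card (V - C0) + card C0 = card V"
            using C0B sub fin by (metis card_Diff_subset card_mono finite_subset
                le_add_diff_inverse2 subset_trans)
          ultimately show ?thesis using m le12 cut cC0 a_def unfolding weight_def by linarith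
        qed
        ultimately show ?thesis using cJ by simp
      qed
    qed
    then obtain f where f: "inj_on f (X \<times> UNIV)" "\<And>p. p \<in> X \<times> UNIV \<Longrightarrow> f p \<in> S p" by blast
    define g where "g x = (SOME b. f (x, True) = Inl b)" for x
    have g: "f (x, True) = Inl (g x)" "g x \<in> B" "\<not> T x (g x)" if "x \<in> X" for x
    proof -
      have "f (x, True) \<in> S (x, True)" using f(2) that by simp
      then obtain b where b: "f (x, True) = Inl b" "b \<in> B" "\<not> T x b" unfolding S_def by auto
      then have "g x = b" unfolding g_def by simp
      then show "f (x, True) = Inl (g x)" "g x \<in> B" "\<not> T x (g x)" using b by auto
    qed
    define I where "I = {x \<in> X. \<exists>b. f (x, False) = Inl b}"
    define t where "t x = (SOME b. f (x, False) = Inl b)" for x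
    have t: "f (x, False) = Inl (t x)" "t x \<in> B" "T x (t x)" if xI: "x \<in> I" for x
    proof -
      have x: "x \<in> X" using xI unfolding I_def by auto
      obtain b where b1: "f (x, False) = Inl b" using xI unfolding I_def by blast
      have "f (x, False) \<in> S (x, False)" using f(2) x by simp
      then have b: "f (x, False) = Inl b" "b \<in> B" "T x b"
        unfolding S_def b1 by auto
      then have "t x = b" unfolding t_def by simp
      then show "f (x, False) = Inl (t x)" "t x \<in> B" "T x (t x)" using b by auto
    qed
    have "card (X - I) \<le> a"
    proof -
      have "(\<lambda>x. f (x, False)) ` (X - I) \<subseteq> Inr ` {..<a}"
      proof
        fix u assume "u \<in> (\<lambda>x. f (x, False)) ` (X - I)"
        then obtain x where x: "u = f (x, False)" "x \<in> X" "x \<notin> I" by blast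
        have "u \<in> S (x, False)" using f(2) x by simp
        moreover have "u \<noteq> Inl b" for b using x unfolding I_def by auto
        ultimately show "u \<in> Inr ` {..<a}" unfolding S_def by auto
      qed
      moreover have "inj_on (\<lambda>x. f (x, False)) (X - I)"
        using f(1) unfolding inj_on_def by auto
      ultimately have "card (X - I) \<le> card (Inr ` {..<a} :: ('a + nat) set)"
        by (metis card_image card_mono finite_imageI finite_lessThan)
      then show ?thesis by (simp add: card_image)
    qed
    moreover have "I \<subseteq> X" unfolding I_def by auto
    moreover from this have "card (X - I) = k - card I"
      using card_Diff_subset[of I X] finite_subset[of I X] finA(3) cX by simp
    ultimately have "k - a \<le> card I" by linarith
    \<comment> \<open>Exactly \<open>k - a\<close> vertices keep a true \<open>T\<close>-neighbour
      in \<open>B\<close>, which leaves exactly \<open>a\<close> cutset vertices to be matched with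
      \<open>A\<close>.\<close>
    then obtain I0 where I0: "I0 \<subseteq> I" "card I0 = k - a"
      using obtain_subset_with_card_n by metis
    have I0X: "I0 \<subseteq> X" "finite I0"
      using I0(1) \<open>I \<subseteq> X\<close> finA(3) by (meson finite_subset subset_trans)+
    have t0: "f (x, False) = Inl (t x)" "t x \<in> B" "T x (t x)" "x \<in> X" if "x \<in> I0" for x
      using t[of x] that I0(1) I0X(1) by auto
    have "\<exists>h. inj_on h A \<and> (\<forall>x\<in>A. h x \<in> {y \<in> X - I0. \<not> T x y})"
    proof (rule hall_marriage)
      fix A' assume A': "A' \<subseteq> A"
      show "card A' \<le> card (\<Union>x\<in>A'. {y \<in> X - I0. \<not> T x y})"
      proof (cases "A' = {}")
        case False
        \<comment> \<open>Hall's condition comes from connectivity once more: \<open>A'\<close> is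
          joined to \<open>X0 \<union> B\<close>, so \<open>card A' + card X0 \<le> a\<close>, while
          \<open>X - I0\<close> has \<open>a\<close> elements.\<close>
        define X0 where "X0 = {y \<in> X. \<forall>x\<in>A'. T x y}"
        have X0: "X0 \<subseteq> X" "finite X0" unfolding X0_def using finA by auto
        have "joined A' (X0 \<union> B)"
          using False A' AB unfolding joined_def X0_def by blast
        then have "card A' + card (X0 \<union> B) + k \<le> card V"
          using conn A' sub XV unfolding X0_def by (intro highly_connectedD) auto
        moreover have "card (X0 \<union> B) = card X0 + card B"
          using dj X0 finA by (intro card_Un_disjoint) auto
        ultimately have 1: "card A' + card X0 \<le> a" using cut a_def by simp
        have "(\<Union>x\<in>A'. {y \<in> X - I0. \<not> T x y}) = X - I0 - X0" unfolding X0_def by blast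
        moreover have "card (X - I0) - card X0 \<le> card (X - I0 - X0)"
          using X0(2) by (rule diff_card_le_card_Diff)
        moreover have "card (X - I0) = a"
          using I0X I0 cX a by (subst card_Diff_subset) auto
        ultimately show ?thesis using 1 by simp
      qed simp
    qed (use finA in auto)
    then obtain h where h: "inj_on h A" "\<And>x. x \<in> A \<Longrightarrow> h x \<in> X - I0 \<and> \<not> T x (h x)" by blast
    have g_inj: "g x \<noteq> g y" if "x \<in> X" "y \<in> X" "x \<noteq> y" for x y
    proof
      assume "g x = g y"
      then have "f (x, True) = f (y, True)" using g(1) that by simp
      then show False using f(1) that unfolding inj_on_def by auto
    qed
    have t_inj: "t x \<noteq> t y" if "x \<in> I0" "y \<in> I0" "x \<noteq> y" for x y
    proof
      assume "t x = t y"
      then have "f (x, False) = f (y, False)" using t0(1) that by simp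
      then show False using f(1) that I0X unfolding inj_on_def by auto
    qed
    have gt: "g x \<noteq> t y" if "x \<in> X" "y \<in> I0" for x y
    proof
      assume "g x = t y"
      then have "f (x, True) = f (y, False)" using g(1) t0(1) that by simp
      then show False using f(1) that I0X unfolding inj_on_def by auto
    qed
    define q where "q i = (if i \<in> A then {i, g (h i), h i} else {i, t i, g i})" for i
    have "packs V (card (A \<union> I0))"
    proof (rule packs_family[where q = q])
      show "finite (A \<union> I0)" using finA I0X by auto
      fix i assume i: "i \<in> A \<union> I0"
      show "seagull (q i)"
      proof (cases "i \<in> A")
        case True
        then have hi: "h i \<in> X" "\<not> T i (h i)" using h by auto
        have "seagull {i, g (h i), h i}"
          using TAB[OF True g(2)[OF hi(1)]] hi g[OF hi(1)] T_sym dj True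
          by (intro seagullI) auto
        then show ?thesis unfolding q_def using True by simp
      next
        case False
        then have i0: "i \<in> I0" "i \<in> X" using i I0X by auto
        have "seagull {i, t i, g i}"
          using t0[OF i0(1)] g[OF i0(2)] gt[OF i0(2,1)] dj i0 indepD[OF indB]
          by (intro seagullI) auto
        then show ?thesis unfolding q_def using False by simp
      qed
      show "q i \<subseteq> V"
      proof (cases "i \<in> A")
        case True
        then have "h i \<in> X" "g (h i) \<in> B" using h g by auto
        then show ?thesis using True XV sub unfolding q_def by auto
      next
        case False
        then have "i \<in> X" "g i \<in> B" "t i \<in> B" using i t0[of i] g(2)[of i] by auto
        then show ?thesis using False \<open>i \<in> X\<close> XV sub unfolding q_def by auto
      qed
    next
      fix i j assume ij: "i \<in> A \<union> I0" "j \<in> A \<union> I0" "i \<noteq> j"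
      have AA: "{i, g (h i), h i} \<inter> {j, g (h j), h j} = {}" if "i \<in> A" "j \<in> A"
      proof -
        have "h i \<noteq> h j" using h(1) that ij(3) by (auto dest: inj_onD)
        moreover from this have "g (h i) \<noteq> g (h j)" using g_inj h that by blast
        moreover have "h i \<in> X" "h j \<in> X" "g (h i) \<in> B" "g (h j) \<in> B"
          using h(2)[OF that(1)] h(2)[OF that(2)] g(2) by blast+
        ultimately show ?thesis using dj that ij(3) by auto
      qed
      have AI: "{i, g (h i), h i} \<inter> {j, t j, g j} = {}" if "i \<in> A" "j \<in> I0" for i j
      proof -
        have hi: "h i \<in> X" "h i \<notin> I0" using h that by auto
        then have "g (h i) \<noteq> g j" "g (h i) \<noteq> t j" "h i \<noteq> j"
          using g_inj gt that I0X by blast+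
        moreover have "t j \<in> B" "g j \<in> B" "g (h i) \<in> B" "j \<in> X"
          using t0(2,4)[OF that(2)] g(2) hi by blast+
        ultimately show ?thesis using hi dj that by auto
      qed
      have II: "{i, t i, g i} \<inter> {j, t j, g j} = {}" if "i \<in> I0" "j \<in> I0"
      proof -
        note X = t0(4)[OF that(1)] t0(4)[OF that(2)]
        have "g i \<noteq> g j" "t i \<noteq> t j" "g i \<noteq> t j" "g j \<noteq> t i"
          by (rule g_inj[OF X ij(3)] t_inj[OF that ij(3)] gt[OF X(1) that(2)] gt[OF X(2) that(1)])+
        moreover have "t j \<in> B" "g j \<in> B" "t i \<in> B" "g i \<in> B" "j \<in> X" "i \<in> X"
          using t0(2,4)[OF that(1)] t0(2,4)[OF that(2)] g(2) by blast+
        ultimately show ?thesis using dj ij(3) by auto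
      qed
      have nA: "i \<notin> A" if "i \<in> I0" for i using that I0X dj by blast
      consider "i \<in> A" "j \<in> A" | "i \<in> A" "j \<in> I0" | "i \<in> I0" "j \<in> A" | "i \<in> I0" "j \<in> I0"
        using ij by blast
      then show "q i \<inter> q j = {}"
      proof cases
        case 1
        then show ?thesis unfolding q_def using AA by simp
      next
        case 2
        then show ?thesis unfolding q_def using AI[OF 2] nA by simp
      next
        case 3
        then show ?thesis unfolding q_def using AI[OF 3(2,1)] nA by (simp add: Int_commute)
      next
        case 4
        then show ?thesis unfolding q_def using II nA by simp
      qed
    qed
    moreover have "card (A \<union> I0) = k"
      using finA I0X I0 dj a a_def by (subst card_Un_disjoint) auto
    ultimately show ?thesis by simp
  qed
qed

end

section \<open>Barriers around a clique\<close>

lemma edgeless_partition_sum: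
  assumes "edgeless_partition R S P" "finite S" "Q \<subseteq> P"
  shows "card (\<Union>K\<in>Q. K \<inter> A) = (\<Sum>K\<in>Q. card (K \<inter> A))"
proof (rule card_UN_disjoint)
  show "finite Q" "\<forall>K\<in>Q. finite (K \<inter> A)"
    using assms edgeless_partition_finite by (meson finite_Int finite_subset subsetD)+
  have "pairwise disjnt P" using assms(1) by (simp add: edgeless_partition_def)
  then show "\<forall>K\<in>Q. \<forall>L\<in>Q. K \<noteq> L \<longrightarrow> K \<inter> A \<inter> (L \<inter> A) = {}"
    using assms(3) unfolding pairwise_def disjnt_def by blast
qed

lemma odd_parts_sum:
  assumes "finite P"
  shows "odd_parts P = (\<Sum>K\<in>P. card K mod 2)"
proof -
  have "odd_parts P = (\<Sum>K\<in>P. if odd (card K) then 1 else 0)"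
    unfolding odd_parts_def using assms by (simp add: sum.inter_filter[symmetric])
  also have "\<dots> = (\<Sum>K\<in>P. card K mod 2)"
    by (intro sum.cong) (auto simp: odd_iff_mod_2_eq_one)
  finally show ?thesis .
qed

context triangle_free
begin

text \<open>Adjacency is meant in \<open>T\<close>: in \<open>G\<close> these vertices are complete
  to \<open>C\<close>, and those of \<open>alladjacent\<close> have no neighbour in it.\<close>

definition nonadjacent :: "'a set \<Rightarrow> 'a set \<Rightarrow> 'a set" where
  "nonadjacent V C = {v \<in> V - C. \<forall>c\<in>C. \<not> T v c}"

definition alladjacent :: "'a set \<Rightarrow> 'a set \<Rightarrow> 'a set" where
  "alladjacent V C = {v \<in> V - C. \<forall>c\<in>C. T v c}"

text \<open>The edges of this graph are the pairs that form a seagull with every vertex of \<open>C\<close>.\<close>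

definition gadj :: "'a set \<Rightarrow> 'a set \<Rightarrow> 'a \<Rightarrow> 'a \<Rightarrow> bool" where
  "gadj V C u v \<longleftrightarrow> u \<in> nonadjacent V C \<and> v \<in> nonadjacent V C \<and> T u v \<or>
     u \<in> nonadjacent V C \<and> v \<in> alladjacent V C \<and> \<not> T u v \<or>
     u \<in> alladjacent V C \<and> v \<in> nonadjacent V C \<and> \<not> T u v"

lemma gadj_sym: "gadj V C u v \<Longrightarrow> gadj V C v u"
  unfolding gadj_def using T_sym by blast

lemma clique_classes:
  assumes "C \<noteq> {}"
  shows "V - C = nonadjacent V C \<union> alladjacent V C \<union> mixed V C"
    and "nonadjacent V C \<inter> alladjacent V C = {}"
    and "(nonadjacent V C \<union> alladjacent V C) \<inter> mixed V C = {}"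
  using assms unfolding nonadjacent_def alladjacent_def mixed_def by blast+

lemma weight_classes:
  assumes "finite V" "C \<noteq> {}"
  shows "weight V C = card (nonadjacent V C \<union> alladjacent V C) + 2 * card (mixed V C)"
proof -
  have fin: "finite (nonadjacent V C \<union> alladjacent V C)" "finite (mixed V C)"
    using assms(1) unfolding nonadjacent_def alladjacent_def mixed_def by auto
  show ?thesis unfolding weight_def clique_classes(1)[OF assms(2), of V]
    using card_Un_disjoint[OF fin clique_classes(3)[OF assms(2)]] by simp
qed

lemma weight_card:
  assumes "finite V" "C \<subseteq> V"
  shows "weight V C + card C = card V + card (mixed V C)"
  using assms card_mono[OF assms] finite_subset[OF assms(2,1)] unfolding weight_def
  by (simp add: card_Diff_subset)

lemma gadj_seagull:
  assumes "gadj V C u v" "c \<in> C"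
  shows "seagull (insert c {u, v})"
proof -
  consider "u \<in> nonadjacent V C" "v \<in> nonadjacent V C" "T u v"
    | "u \<in> nonadjacent V C" "v \<in> alladjacent V C" "\<not> T u v"
    | "u \<in> alladjacent V C" "v \<in> nonadjacent V C" "\<not> T u v"
    using assms(1) unfolding gadj_def by blast
  then show ?thesis
  proof cases
    case 1
    then have "seagull {u, v, c}"
      using assms(2) by (intro seagullI) (auto simp: nonadjacent_def)
    then show ?thesis by (simp add: insert_commute)
  next
    case 2
    then have "seagull {v, c, u}"
      using assms(2) T_sym by (intro seagullI) (auto simp: nonadjacent_def alladjacent_def)
    then show ?thesis by (simp add: insert_commute)
  next
    case 3
    then have "seagull {u, c, v}"
      using assms(2) T_sym by (intro seagullI) (auto simp: nonadjacent_def alladjacent_def)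
    then show ?thesis by (simp add: insert_commute)
  qed
qed

text \<open>Each vertex of \<open>D'\<close> takes two private clique vertices, one
  \<open>T\<close>-adjacent to it and one not; each edge of \<open>M\<close> takes one of the
  remaining ones, since it works with any vertex of \<open>C\<close>. \<open>Cs\<close> and
  \<open>D'\<close> may be proper parts, so that a clique vertex can be reserved or a mixed vertex
  left out. Hall's condition is asked only where the missed part of \<open>Cs\<close> is nonempty;
  elsewhere \<open>size\<close> implies it.\<close>

lemma packs_clique_assembly:
  assumes fin: "finite V" and C: "C \<subseteq> V" "indep C" and Cs: "Cs \<subseteq> C"
    and D': "D' \<subseteq> mixed V C"
    and M: "matching (gadj V C) (nonadjacent V C \<union> alladjacent V C) M"
    and hall: "\<And>J1 J2. J1 \<subseteq> D' \<Longrightarrow> J2 \<subseteq> D' \<Longrightarrow> J1 \<inter> J2 = {} \<Longrightarrow>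
      {c \<in> Cs. (\<forall>x\<in>J1. T x c) \<and> (\<forall>x\<in>J2. \<not> T x c)} \<noteq> {} \<Longrightarrow>
      card J1 + card J2 \<le> card (Cs - {c \<in> Cs. (\<forall>x\<in>J1. T x c) \<and> (\<forall>x\<in>J2. \<not> T x c)})"
    and size: "2 * card D' + card M \<le> card Cs"
  shows "packs (Cs \<union> D' \<union> \<Union>M) (card D' + card M)"
proof -
  have finC: "finite Cs" using Cs C(1) fin by (meson finite_subset)
  have DV: "D' \<subseteq> V - C" using D' unfolding mixed_def by auto
  have finD: "finite D'" using DV fin by (meson Diff_subset finite_subset)
  have finM: "finite M" using M by (rule matching_finite)
  define S where "S p = (if snd p then {c \<in> Cs. \<not> T (fst p) c} else {c \<in> Cs. T (fst p) c})"
    for p :: "'a \<times> bool"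
  have "\<exists>f. inj_on f (D' \<times> UNIV) \<and> (\<forall>p\<in>D' \<times> UNIV. f p \<in> S p)"
  proof (rule hall_marriage)
    show "finite (D' \<times> (UNIV :: bool set))" using finD by simp
    show "finite (S p)" for p unfolding S_def using finC by simp
    fix J :: "('a \<times> bool) set" assume J: "J \<subseteq> D' \<times> UNIV"
    define J1 where "J1 = {x. (x, True) \<in> J}"
    define J2 where "J2 = {x. (x, False) \<in> J}"
    have J12: "J1 \<subseteq> D'" "J2 \<subseteq> D'" using J unfolding J1_def J2_def by auto
    have finJ: "finite J1" "finite J2" using J12 finD by (meson finite_subset)+
    have cJ: "card J = card J1 + card J2"
    proof -
      have "J = J1 \<times> {True} \<union> J2 \<times> {False}"
        unfolding J1_def J2_def by (auto, (metis (full_types))+)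
      moreover have "card (J1 \<times> {True} \<union> J2 \<times> {False}) = card (J1 \<times> {True}) + card (J2 \<times> {False})"
        using finJ by (intro card_Un_disjoint) auto
      ultimately show ?thesis by (simp add: card_cartesian_product)
    qed
    define C0 where "C0 = {c \<in> Cs. (\<forall>x\<in>J1. T x c) \<and> (\<forall>x\<in>J2. \<not> T x c)}"
    have U: "\<Union>(S ` J) = Cs - C0"
    proof
      show "\<Union>(S ` J) \<subseteq> Cs - C0"
        unfolding S_def C0_def J1_def J2_def by (auto split: if_splits)
      show "Cs - C0 \<subseteq> \<Union>(S ` J)"
      proof
        fix c assume c: "c \<in> Cs - C0"
        then consider x where "(x, True) \<in> J" "\<not> T x c" | x where "(x, False) \<in> J" "T x c"
          unfolding C0_def J1_def J2_def by blast
        then show "c \<in> \<Union>(S ` J)"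
        proof cases
          case 1
          then have "c \<in> S (x, True)" using c unfolding S_def by simp
          then show ?thesis using 1 by blast
        next
          case 2
          then have "c \<in> S (x, False)" using c unfolding S_def by simp
          then show ?thesis using 2 by blast
        qed
      qed
    qed
    show "card J \<le> card (\<Union>(S ` J))"
    proof (cases "C0 = {}")
      case True
      have "card J1 \<le> card D'" "card J2 \<le> card D'" using J12 finD card_mono by metis+
      then show ?thesis using U True cJ size by simp
    next
      case False
      then have "J1 \<inter> J2 = {}" unfolding C0_def by blast
      then show ?thesis using hall[OF J12] False cJ U unfolding C0_def by simp
    qed
  qed
  then obtain f where f: "inj_on f (D' \<times> UNIV)" "\<And>p. p \<in> D' \<times> UNIV \<Longrightarrow> f p \<in> S p" by blast
  define Im where "Im = f ` (D' \<times> UNIV)"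
  have "S p \<subseteq> Cs" for p unfolding S_def by auto
  then have Im: "Im \<subseteq> Cs" using f(2) unfolding Im_def by blast
  have "card Im = 2 * card D'"
    unfolding Im_def using f(1) by (simp add: card_image card_cartesian_product)
  then have "card M \<le> card (Cs - Im)"
    using Im finC size by (subst card_Diff_subset) (auto intro: finite_subset)
  then obtain h where h: "h ` M \<subseteq> Cs - Im" "inj_on h M"
    using card_le_inj[of M "Cs - Im"] finM finC by auto
  have "packs (D' \<union> Im) (card D')"
  proof (rule packs_family[where q = "\<lambda>d. {d, f (d, False), f (d, True)}"])
    fix d assume d: "d \<in> D'"
    have 1: "f (d, False) \<in> Cs" "T d (f (d, False))" "f (d, True) \<in> Cs" "\<not> T d (f (d, True))"
      using f(2)[of "(d, False)"] f(2)[of "(d, True)"] d unfolding S_def by auto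
    moreover have "\<not> T (f (d, False)) (f (d, True))" 
      using indepD[OF C(2)] 1(1,3) Cs by auto
    moreover have "f (d, True) \<noteq> d" using 1(3) DV d Cs by auto
    moreover have "f (d, True) \<noteq> f (d, False)" 
      using inj_onD[OF f(1), of "(d, True)" "(d, False)"] d by auto
    ultimately show "seagull {d, f (d, False), f (d, True)}" by (intro seagullI) auto
    show "{d, f (d, False), f (d, True)} \<subseteq> D' \<union> Im" using d unfolding Im_def by auto
  next
    fix d d' assume dd: "d \<in> D'" "d' \<in> D'" "d \<noteq> d'"
    have "f (d, x) \<noteq> f (d', y) \<and> f (d', y) \<noteq> f (d, x)" for x y
      using inj_onD[OF f(1), of "(d, x)" "(d', y)"] dd by auto
    moreover have "f (e, x) \<notin> D'" if "e \<in> D'" for e x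
      using Im DV Cs that unfolding Im_def by auto
    ultimately show "{d, f (d, False), f (d, True)} \<inter> {d', f (d', False), f (d', True)} = {}"
      using dd by auto
  qed (rule finD)
  moreover have "packs (\<Union>M \<union> (Cs - Im)) (card M)"
  proof (rule packs_family[where q = "\<lambda>e. insert (h e) e"])
    fix e assume e: "e \<in> M"
    then obtain u v where uv: "gadj V C u v" "e = {u, v}" using M by (meson matching_edgeE)
    have "h e \<in> C" using h(1) e Cs by blast
    then show "seagull (insert (h e) e)" using gadj_seagull uv by simp
    show "insert (h e) e \<subseteq> \<Union>M \<union> (Cs - Im)" using e h(1) by blast
  next
    fix e e' assume ee: "e \<in> M" "e' \<in> M" "e \<noteq> e'"
    have "e \<inter> e' = {}" using M ee unfolding matching_def pairwise_def disjnt_def by blast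
    moreover have "h e \<noteq> h e'" using h(2) ee unfolding inj_on_def by blast
    moreover have "e'' \<inter> C = {}" if "e'' \<in> M" for e''
      using matching_subset[OF M] that unfolding nonadjacent_def alladjacent_def by blast
    moreover have "h e \<in> C" "h e' \<in> C" using h(1) ee Cs by blast+
    ultimately show "insert (h e) e \<inter> insert (h e') e' = {}" using ee by auto
  qed (rule finM)
  moreover have "(D' \<union> Im) \<inter> (\<Union>M \<union> (Cs - Im)) = {}"
  proof -
    have "\<Union>M \<inter> D' = {}"
      using matching_subset[OF M] D' unfolding nonadjacent_def alladjacent_def mixed_def by blast
    moreover have "\<Union>M \<inter> C = {}"
      using matching_subset[OF M] unfolding nonadjacent_def alladjacent_def by blast
    ultimately show ?thesis using Im Cs DV by blast
  qed
  ultimately have "packs (D' \<union> Im \<union> (\<Union>M \<union> (Cs - Im))) (card D' + card M)" by (rule packs_Un)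
  then show ?thesis by (rule packs_mono) (use Im in auto)
qed

text \<open>A Tutte--Berge barrier for \<open>gadj V C\<close> would violate one of three
  certificates: the matching \<open>M\<close> if the barrier swallows
  \<open>alladjacent V C\<close>, the minimality of the weight if the parts yield a larger clique
  around \<open>C\<close>, and connectivity if some part has most of its vertices in
  \<open>alladjacent V C\<close>. The parts are tied together because a missing \<open>gadj\<close>
  edge means \<open>T\<close>-adjacency between the two classes and its absence inside
  \<open>nonadjacent V C\<close>.\<close>

lemma no_barrier:
  assumes fin: "finite V" and C: "C \<subseteq> V" "C \<noteq> {}" "indep C"
    and conn: "highly_connected V q" and M: "matching T V M"
    and minimal: "\<And>C'. C \<subseteq> C' \<Longrightarrow> C' \<subseteq> V \<Longrightarrow> indep C' \<Longrightarrow> weight V C \<le> weight V C'"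
    and Y: "Y \<subseteq> nonadjacent V C \<union> alladjacent V C"
    and P: "edgeless_partition (gadj V C) (nonadjacent V C \<union> alladjacent V C - Y) P"
    and d: "2 \<le> d" "weight V C < 2 * card M + d" "weight V C < 2 * q + d"
  shows "odd_parts P < card Y + d"
proof (rule ccontr)
  assume "\<not> odd_parts P < card Y + d"
  then have odd: "card Y + d \<le> odd_parts P" by simp
  define A where "A = nonadjacent V C"
  define B where "B = alladjacent V C"
  define D where "D = mixed V C"
  have finABD: "finite A" "finite B" "finite D" "finite Y"
    using fin Y unfolding A_def B_def D_def nonadjacent_def alladjacent_def mixed_def
    by (auto intro: finite_subset)
  have dAB: "A \<inter> B = {}" "(A \<union> B) \<inter> D = {}"
    using clique_classes[OF C(2), of V] unfolding A_def B_def D_def by auto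
  have VC: "V - C = A \<union> B \<union> D" using clique_classes(1)[OF C(2)] unfolding A_def B_def D_def by simp
  have YAB: "Y \<subseteq> A \<union> B" using Y unfolding A_def B_def by simp
  have UP: "\<Union>P = A \<union> B - Y" and djP: "pairwise disjnt P"
    and cross: "\<And>K L x y. K \<in> P \<Longrightarrow> L \<in> P \<Longrightarrow> K \<noteq> L \<Longrightarrow> x \<in> K \<Longrightarrow> y \<in> L \<Longrightarrow> \<not> gadj V C x y"
    using P unfolding edgeless_partition_def A_def B_def by blast+
  have finS: "finite (A \<union> B - Y)" using finABD by simp
  have P': "edgeless_partition (gadj V C) (A \<union> B - Y) P" using P unfolding A_def B_def .
  have finP: "finite P" "\<And>K. K \<in> P \<Longrightarrow> finite K"
    using edgeless_partition_finite[OF P' finS] by auto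
  note psum = edgeless_partition_sum[OF P' finS]
  have uniq: "K = L" if "K \<in> P" "L \<in> P" "x \<in> K" "x \<in> L" for K L x
    using djP that unfolding pairwise_def disjnt_def by blast
  have oddsum: "odd_parts P = (\<Sum>K\<in>P. card K mod 2)" using odd_parts_sum finP(1) .
  have cAB: "card (A \<union> B) = card Y + (\<Sum>K\<in>P. card K)"
  proof -
    have "card (A \<union> B) = card Y + card (A \<union> B - Y)"
      using YAB finABD by (metis card_Diff_subset card_mono finite_UnI le_add_diff_inverse)
    also have "A \<union> B - Y = (\<Union>K\<in>P. K \<inter> UNIV)" using UP by simp
    also have "card \<dots> = (\<Sum>K\<in>P. card K)" using psum[of P UNIV] by simp
    finally show ?thesis .
  qed
  have w: "weight V C = card (A \<union> B) + 2 * card D"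
    using weight_classes[OF fin C(2)] unfolding A_def B_def D_def .
  have nG_AB: "T a b" if "a \<in> A" "b \<in> B" "\<not> gadj V C a b" for a b
    using that unfolding gadj_def A_def B_def by blast
  have nG_AA: "\<not> T a b" if "a \<in> A" "b \<in> A" "\<not> gadj V C a b" for a b
    using that unfolding gadj_def A_def B_def by blast
  have AC: "\<not> T a c" "\<not> T c a" if "a \<in> A" "c \<in> C" for a c
    using that T_sym unfolding A_def nonadjacent_def by blast+
  have BC: "T b c" if "b \<in> B" "c \<in> C" for b c
    using that unfolding B_def alladjacent_def by blast
  have ABV: "A \<subseteq> V - C" "B \<subseteq> V - C" "D \<subseteq> V - C" using VC by auto
  \<comment> \<open>Absorbing \<open>A1\<close> into \<open>C\<close> lowers the first summand of
    the weight by \<open>card A1\<close>, so by minimality the number of mixed vertices grows by at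
    least that much.\<close>
  have superclique: "card A1 + card (mixed V C) \<le> card X"
    if A1: "A1 \<subseteq> A" "indep A1" and X: "mixed V (C \<union> A1) \<subseteq> X" "finite X" for A1 X
  proof -
    have "indep (C \<union> A1)"
      using A1 C(3) AC unfolding indep_def by blast
    then have "weight V C \<le> weight V (C \<union> A1)" using C(1) A1(1) ABV by (intro minimal) auto
    moreover have "card (V - (C \<union> A1)) + card A1 = card (V - C)"
    proof -
      have "V - (C \<union> A1) = V - C - A1" by blast
      then show ?thesis using A1(1) ABV fin
        by (metis card_Diff_subset card_mono finite_Diff finite_subset le_add_diff_inverse2 subset_trans)
    qed
    moreover have "card (mixed V (C \<union> A1)) \<le> card X" using X by (meson card_mono)
    ultimately show ?thesis unfolding weight_def by linarith
  qed
  show False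
  proof (cases "B \<subseteq> Y")
    case True
    \<comment> \<open>With \<open>B\<close> inside \<open>Y\<close>, an edge of \<open>M\<close>
      that avoids \<open>D \<union> Y\<close> lies in \<open>A\<close>, is an edge of
      \<open>gadj\<close> and hence stays inside a part; each odd part keeps a vertex not covered by
      such edges.\<close>
    define Mi where "Mi = {e \<in> M. e \<inter> (D \<union> Y) = {}}"
    have finM: "finite M" using M by (rule matching_finite)
    have "card (M - Mi) \<le> card (D \<union> Y)"
    proof -
      have "\<forall>e\<in>M - Mi. \<exists>x. x \<in> e \<and> x \<in> D \<union> Y" unfolding Mi_def by blast
      then obtain x where x: "\<And>e. e \<in> M - Mi \<Longrightarrow> x e \<in> e \<and> x e \<in> D \<union> Y" by metis
      have "inj_on x (M - Mi)"
        using x matching_same_edge[OF M] unfolding inj_on_def by (metis DiffD1)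
      then have "card (M - Mi) = card (x ` (M - Mi))" by (simp add: card_image)
      also have "\<dots> \<le> card (D \<union> Y)" using x finABD by (intro card_mono) auto
      finally show ?thesis .
    qed
    moreover have "card (D \<union> Y) \<le> card D + card Y" by (rule card_Un_le)
    moreover have "card M = card Mi + card (M - Mi)"
      using finM unfolding Mi_def by (metis (no_types, lifting) card_Diff_subset card_mono
          finite_subset le_add_diff_inverse mem_Collect_eq subsetI)
    moreover have "2 * card Mi + odd_parts P \<le> (\<Sum>K\<in>P. card K)"
    proof -
      have inK: "\<exists>K\<in>P. e \<subseteq> K" if e: "e \<in> Mi" for e
      proof -
        obtain u v where uv: "u \<noteq> v" "T u v" "e = {u, v}" and eM: "e \<in> M"
          using e M unfolding Mi_def by (auto elim: matching_edgeE)
        have uvV: "u \<in> V" "v \<in> V" using matching_subset[OF M] eM uv by blast+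
        have out: "u \<notin> D \<union> Y" "v \<notin> D \<union> Y" using e uv unfolding Mi_def by auto
        have uC: "u \<notin> C" if "T u v" "u \<in> V" "v \<in> V" "v \<notin> D \<union> Y" for u v
        proof
          assume "u \<in> C"
          then have "v \<notin> C" "v \<notin> A" using that(1) C(3) indepD AC T_sym by blast+
          then have "v \<in> B" using VC that by blast
          then show False using True that by blast
        qed
        have "u \<in> A" "v \<in> A"
          using uC[OF uv(2) uvV out(2)] uC[OF T_sym[OF uv(2)] uvV(2,1) out(1)] VC uvV out True
          by blast+
        moreover from this have "gadj V C u v" using uv unfolding gadj_def A_def by blast
        moreover obtain K L where "K \<in> P" "u \<in> K" "L \<in> P" "v \<in> L"
          using UP \<open>u \<in> A\<close> \<open>v \<in> A\<close> out by blast
        ultimately show ?thesis using cross[of K L u v] uv by blast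
      qed
      have "\<Union>Mi \<subseteq> V" using matching_subset[OF M] unfolding Mi_def by blast
      then have "matching T V Mi" using M by (intro matching_sub[OF M]) (auto simp: Mi_def)
      then have "2 * card Mi = card (\<Union>Mi)" by (simp add: card_Union_matching)
      also have "\<Union>Mi = (\<Union>K\<in>P. K \<inter> \<Union>Mi)" using inK by blast
      also have "card \<dots> = (\<Sum>K\<in>P. card (K \<inter> \<Union>Mi))" by (rule psum) simp
      also have "\<dots> + odd_parts P = (\<Sum>K\<in>P. card (K \<inter> \<Union>Mi) + card K mod 2)"
        unfolding oddsum by (simp add: sum.distrib)
      also have "\<dots> \<le> (\<Sum>K\<in>P. card K)"
      proof (rule sum_mono)
        fix K assume K: "K \<in> P"
        define MK where "MK = {e \<in> Mi. e \<subseteq> K}"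
        have "K \<inter> \<Union>Mi = \<Union>MK"
        proof
          show "K \<inter> \<Union>Mi \<subseteq> \<Union>MK"
          proof
            fix x assume x: "x \<in> K \<inter> \<Union>Mi"
            then obtain e where e: "e \<in> Mi" "x \<in> e" by blast
            then obtain L where "L \<in> P" "e \<subseteq> L" using inK by blast
            then have "L = K" using uniq[of L K x] K x e by blast
            then show "x \<in> \<Union>MK" using e \<open>e \<subseteq> L\<close> unfolding MK_def by blast
          qed
        qed (auto simp: MK_def)
        moreover have "matching T K MK"
          using M by (rule matching_sub) (auto simp: MK_def Mi_def)
        ultimately have "card (K \<inter> \<Union>Mi) = 2 * card MK" "2 * card MK \<le> card K"
          using card_Union_matching matching_card_le finP(2)[OF K] by metis+
        then show "card (K \<inter> \<Union>Mi) + card K mod 2 \<le> card K" by presburger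
      qed
      finally show ?thesis .
    qed
    ultimately show False using odd d w cAB by linarith
  next
    case BY: False
    show False
    proof (cases "\<exists>K\<in>P. \<exists>a\<in>K \<inter> A. \<exists>a'\<in>K \<inter> A. T a a'")
      case True
      \<comment> \<open>A vertex of \<open>B\<close> in another part would be
        \<open>T\<close>-adjacent to both \<open>a\<close> and \<open>a'\<close>, a triangle. So all
        parts but \<open>K\<close> lie in \<open>A\<close>; they contain no \<open>T\<close>-edge
        for the same reason, and their union extends the clique \<open>C\<close>.\<close>
      have inK: "B - Y \<subseteq> K" if K: "K \<in> P" "a \<in> K \<inter> A" "a' \<in> K \<inter> A" "T a a'" for K a a'
      proof
        fix b assume b: "b \<in> B - Y"
        then obtain L where L: "L \<in> P" "b \<in> L" using UP by blast
        show "b \<in> K"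
        proof (rule ccontr)
          assume "b \<notin> K"
          then have "K \<noteq> L" using L by blast
          then have "\<not> gadj V C a b" "\<not> gadj V C a' b" using cross K L by blast+
          then have "T a b" "T a' b" using nG_AB K b by blast+
          then show False using T_triangle T_sym K(4) by blast
        qed
      qed
      obtain K a a' where K: "K \<in> P" "a \<in> K \<inter> A" "a' \<in> K \<inter> A" "T a a'" using True by blast
      define A1 where "A1 = \<Union>(P - {K})"
      have A1K: "A1 \<inter> K = {}" using uniq K(1) unfolding A1_def by blast
      have A1: "A1 \<subseteq> A"
      proof -
        have "A1 \<subseteq> A \<union> B - Y" using UP unfolding A1_def by blast
        then show ?thesis using inK[OF K] A1K by blast
      qed
      have ind: "indep A1"
        unfolding indep_def
      proof (intro ballI notI)
        fix x y assume xy: "x \<in> A1" "y \<in> A1" "T x y"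
        then obtain L L' where L: "L \<in> P" "L \<noteq> K" "x \<in> L" "L' \<in> P" "y \<in> L'"
          unfolding A1_def by blast
        have "gadj V C x y" using xy A1 unfolding gadj_def A_def by blast
        then have "L = L'" using cross L by blast
        then have "B - Y \<subseteq> L" using inK[of L x y] L xy A1 by blast
        moreover have "B - Y \<subseteq> K" using inK[OF K] .
        ultimately show False using BY uniq[of L K] L K by blast
      qed
      have "mixed V (C \<union> A1) \<subseteq> D \<union> Y"
      proof
        fix v assume v: "v \<in> mixed V (C \<union> A1)"
        then have vV: "v \<in> V" "v \<notin> C" "v \<notin> A1" unfolding mixed_def by auto
        show "v \<in> D \<union> Y"
        proof (rule ccontr)
          assume n: "v \<notin> D \<union> Y"
          then have "v \<in> \<Union>P" using vV VC UP by blast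
          then have vK: "v \<in> K" using vV(3) unfolding A1_def by blast
          have ng: "\<not> gadj V C v x" "\<not> gadj V C x v" if xA1: "x \<in> A1" for x
          proof -
            obtain L where "L \<in> P" "L \<noteq> K" "x \<in> L" using xA1 unfolding A1_def by blast
            then show "\<not> gadj V C v x" "\<not> gadj V C x v" using cross K(1) vK by blast+
          qed
          have "v \<in> A \<or> v \<in> B" using n vV VC by blast
          then show False
          proof
            assume vA: "v \<in> A"
            have "\<not> T v c" if "c \<in> C \<union> A1" for c
              using that AC vA nG_AA[OF vA] ng A1 by blast
            then show False using v unfolding mixed_def by blast
          next
            assume vB: "v \<in> B"
            have "T v c" if "c \<in> C \<union> A1" for c
              using that BC vB nG_AB[of c v] ng A1 T_sym by blast
            then show False using v unfolding mixed_def by blast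
          qed
        qed
      qed
      then have "card A1 + card D \<le> card (D \<union> Y)"
        using superclique[OF A1 ind] finABD unfolding D_def by simp
      then have 1: "card A1 \<le> card Y" using card_Un_le[of D Y] by linarith
      have "odd_parts P = card K mod 2 + (\<Sum>L\<in>P - {K}. card L mod 2)"
        unfolding oddsum using finP K by (simp add: sum.remove)
      also have "(\<Sum>L\<in>P - {K}. card L mod 2) \<le> (\<Sum>L\<in>P - {K}. card L)"
        by (rule sum_mono) simp
      also have "(\<Sum>L\<in>P - {K}. card L) = card A1"
        using psum[of "P - {K}" UNIV] unfolding A1_def by simp
      finally have "odd_parts P \<le> card K mod 2 + card A1" by simp
      moreover have "card K mod 2 \<le> 1" by linarith
      ultimately show False using 1 odd d(1) by linarith
    next
      case noT: False
      have indA: "\<not> T x y" if xy: "x \<in> A - Y" "y \<in> A - Y" for x y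
      proof
        assume T: "T x y"
        have "x \<in> \<Union>P" "y \<in> \<Union>P" using xy UP by auto
        then obtain K L where KL: "K \<in> P" "x \<in> K" "L \<in> P" "y \<in> L" by blast
        have "gadj V C x y" using T xy unfolding gadj_def A_def by blast
        then have "K = L" using cross KL by blast
        then show False using noT KL xy T by blast
      qed
      have cK: "card K = card (K \<inter> A) + card (K \<inter> B)" if "K \<in> P" for K
      proof -
        have "K = (K \<inter> A) \<union> (K \<inter> B)" using that UP by blast
        moreover have "card ((K \<inter> A) \<union> (K \<inter> B)) = card (K \<inter> A) + card (K \<inter> B)"
          using finABD dAB by (intro card_Un_disjoint) auto
        ultimately show ?thesis by simp
      qed
      \<comment> \<open>A part with \<open>b\<close> and \<open>a\<close> vertices in the two
        classes has the parity of their difference, so being odd forces a surplus of at least 1 for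
        the larger class.\<close>
      have aux: "b + (b + a) mod 2 \<le> a" if "b \<le> a" for a b :: nat using that by presburger
      define I where "I = {K \<in> P. card (K \<inter> B) < card (K \<inter> A)}"
      define I' where "I' = {K \<in> P. card (K \<inter> A) < card (K \<inter> B)}"
      have IP: "I \<subseteq> P" "I' \<subseteq> P" unfolding I_def I'_def by auto
      have sP: "(\<Sum>K\<in>P. g K) = (\<Sum>K\<in>I'. g K) + (\<Sum>K\<in>P - I'. g K)" for g :: "'a set \<Rightarrow> nat"
        using sum.subset_diff[OF IP(2) finP(1)] by (simp add: add.commute)
      show False
      proof (cases "I' = {}")
        case True
        \<comment> \<open>No part has a \<open>B\<close>-majority. The \<open>A\<close>-sides of the
          parts with an \<open>A\<close>-majority extend \<open>C\<close>; only \<open>D\<close>,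
          \<open>Y\<close> and the \<open>B\<close>-sides of the same parts can be mixed afterwards,
          while \<open>A1\<close> exceeds \<open>B1\<close> by at least the number of odd
          parts.\<close>
        define A1 where "A1 = (\<Union>K\<in>I. K \<inter> A)"
        define B1 where "B1 = (\<Union>K\<in>I. K \<inter> B)"
        have A1: "A1 \<subseteq> A" "A1 \<subseteq> A - Y" unfolding A1_def using IP UP by blast+
        have "indep A1" using indA A1(2) unfolding indep_def by blast
        moreover have "mixed V (C \<union> A1) \<subseteq> D \<union> Y \<union> B1"
        proof
          fix v assume v: "v \<in> mixed V (C \<union> A1)"
          then have vV: "v \<in> V" "v \<notin> C" "v \<notin> A1" unfolding mixed_def by auto
          show "v \<in> D \<union> Y \<union> B1"
          proof (rule ccontr)
            assume n: "v \<notin> D \<union> Y \<union> B1"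
            have "v \<in> A \<or> v \<in> B" using n vV VC by blast
            then show False
            proof
              assume vA: "v \<in> A"
              have "\<not> T v c" if "c \<in> C \<union> A1" for c
                using that AC vA indA[of v c] n A1 by blast
              then show False using v unfolding mixed_def by blast
            next
              assume vB: "v \<in> B"
              obtain L where L: "L \<in> P" "v \<in> L" using UP vB n by blast
              have LI: "L \<notin> I" using n L vB unfolding B1_def by blast
              have "T v c" if c: "c \<in> C \<union> A1" for c
              proof (cases "c \<in> C")
                case False
                then obtain K where K: "K \<in> I" "c \<in> K" "c \<in> A" using c unfolding A1_def by blast
                then have "\<not> gadj V C c v" using cross[of K L c v] L LI IP by blast
                then show ?thesis using nG_AB K vB T_sym by blast
              qed (use BC vB in blast)
              then show False using v unfolding mixed_def by blast
            qed
          qed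
        qed
        moreover have "finite B1" unfolding B1_def using finABD finP IP by (meson finite_Int finite_UN finite_subset)
        ultimately have "card A1 + card D \<le> card (D \<union> Y \<union> B1)"
          using superclique[OF A1(1)] finABD unfolding D_def by simp
        also have "\<dots> \<le> card D + card Y + card B1"
          using card_Un_le[of "D \<union> Y" B1] card_Un_le[of D Y] by linarith
        finally have 1: "card A1 \<le> card Y + card B1" by simp
        have "odd_parts P = (\<Sum>K\<in>I. card K mod 2) + (\<Sum>K\<in>P - I. card K mod 2)"
          unfolding oddsum using sum.subset_diff[OF IP(1) finP(1)] by (simp add: add.commute)
        also have "(\<Sum>K\<in>P - I. card K mod 2) = 0"
        proof (intro sum.neutral ballI)
          fix K assume "K \<in> P - I"
          then have "card (K \<inter> A) = card (K \<inter> B)" "K \<in> P"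
            using True unfolding I_def I'_def by (auto simp: not_less)
          then show "card K mod 2 = 0" using cK by simp
        qed
        finally have o: "odd_parts P = (\<Sum>K\<in>I. card K mod 2)" by simp
        have "card B1 + odd_parts P = (\<Sum>K\<in>I. card (K \<inter> B) + card K mod 2)"
          unfolding o B1_def psum[OF IP(1)] by (simp add: sum.distrib)
        also have "\<dots> \<le> (\<Sum>K\<in>I. card (K \<inter> A))"
        proof (rule sum_mono)
          fix K assume "K \<in> I"
          then show "card (K \<inter> B) + card K mod 2 \<le> card (K \<inter> A)"
            using cK[of K] aux[of "card (K \<inter> B)" "card (K \<inter> A)"] unfolding I_def
            by (simp add: add.commute)
        qed
        also have "\<dots> = card A1" unfolding A1_def psum[OF IP(1)] ..
        finally show False using 1 odd d(1) by linarith
      next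
        case False
        define B1 where "B1 = (\<Union>K\<in>I'. K \<inter> B)"
        define A1 where "A1 = (\<Union>K\<in>P - I'. K \<inter> A)"
        have A1A: "A1 \<subseteq> A" "B1 \<subseteq> B" unfolding A1_def B1_def by auto
        \<comment> \<open>With a \<open>B\<close>-majority somewhere, the larger sides of all parts
          form, together with \<open>C\<close>, a joined pair. Connectivity bounds its size, and the
          parity surplus converts this into a bound on the number of odd parts.\<close>
        have "joined B1 (C \<union> A1)"
          unfolding joined_def
        proof (intro conjI ballI)
          obtain K where K: "K \<in> I'" using False by blast
          then have "K \<inter> B \<noteq> {}" unfolding I'_def by auto
          then show "B1 \<noteq> {}" using K unfolding B1_def by blast
          show "C \<union> A1 \<noteq> {}" using C by blast
          fix b c assume b: "b \<in> B1" and c: "c \<in> C \<union> A1"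
          show "T b c"
          proof (cases "c \<in> C")
            case True
            then show ?thesis using BC b A1A by blast
          next
            case False
            then obtain L where L: "L \<in> P" "L \<notin> I'" "c \<in> L" "c \<in> A" using c unfolding A1_def by blast
            obtain K where K: "K \<in> I'" "b \<in> K" "b \<in> B" using b unfolding B1_def by blast
            have "\<not> gadj V C c b" using cross[of L K c b] L K IP by blast
            then show ?thesis using nG_AB L K T_sym by blast
          qed
        qed
        then have "card B1 + card (C \<union> A1) + q \<le> card V"
          using highly_connectedD[OF conn] C(1) A1A ABV by (meson Diff_subset Un_least subset_trans)
        moreover have "card (C \<union> A1) = card C + card A1"
          using A1A ABV fin C(1) by (intro card_Un_disjoint) (auto intro: finite_subset)
        moreover have "weight V C + card C = card V + card D"
          using weight_card[OF fin C(1)] unfolding D_def .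
        ultimately have 1: "card B1 + card A1 + card D + q \<le> weight V C" by linarith
        have B1: "card B1 = (\<Sum>K\<in>I'. card (K \<inter> B))" unfolding B1_def by (rule psum[OF IP(2)])
        have A1: "card A1 = (\<Sum>K\<in>P - I'. card (K \<inter> A))" unfolding A1_def by (rule psum) auto
        have "(\<Sum>K\<in>I'. card (K \<inter> A)) + (\<Sum>K\<in>I'. card K mod 2) \<le> (\<Sum>K\<in>I'. card (K \<inter> B))"
          unfolding sum.distrib[symmetric]
        proof (rule sum_mono)
          fix K assume "K \<in> I'"
          then show "card (K \<inter> A) + card K mod 2 \<le> card (K \<inter> B)"
            using cK[of K] aux[of "card (K \<inter> A)" "card (K \<inter> B)"] unfolding I'_def
            by (simp add: add.commute)
        qed
        moreover have "(\<Sum>K\<in>P - I'. card (K \<inter> B)) + (\<Sum>K\<in>P - I'. card K mod 2)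
            \<le> (\<Sum>K\<in>P - I'. card (K \<inter> A))"
          unfolding sum.distrib[symmetric]
        proof (rule sum_mono)
          fix K assume "K \<in> P - I'"
          then show "card (K \<inter> B) + card K mod 2 \<le> card (K \<inter> A)"
            using cK[of K] aux[of "card (K \<inter> B)" "card (K \<inter> A)"] unfolding I'_def
            by (simp add: add.commute not_less)
        qed
        moreover have "(\<Sum>K\<in>P. card K) = (\<Sum>K\<in>I'. card (K \<inter> A)) + (\<Sum>K\<in>I'. card (K \<inter> B))
            + ((\<Sum>K\<in>P - I'. card (K \<inter> A)) + (\<Sum>K\<in>P - I'. card (K \<inter> B)))"
        proof -
          have "(\<Sum>K\<in>P. card K) = (\<Sum>K\<in>P. card (K \<inter> A) + card (K \<inter> B))"
            using cK by (intro sum.cong) auto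
          then show ?thesis using sP[of "\<lambda>K. card (K \<inter> A) + card (K \<inter> B)"] by (simp add: sum.distrib)
        qed
        ultimately show False
          using 1 A1 B1 odd d w cAB oddsum sP[of "\<lambda>K. card K mod 2"] by linarith
      qed
    qed
  qed
qed

end

section \<open>Packing seagulls\<close>

lemma matching_partner:
  assumes "matching R S N" "x \<in> \<Union>N" and sym: "\<And>x y. R x y \<Longrightarrow> R y x"
  shows "\<exists>y. y \<noteq> x \<and> R x y \<and> {x, y} \<in> N"
proof -
  obtain e where e: "e \<in> N" "x \<in> e" using assms(2) by blast
  obtain u v where uv: "u \<noteq> v" "R u v" "e = {u, v}" using assms(1) e(1) by (rule matching_edgeE)
  show ?thesis
  proof (cases "x = u")
    case True
    then show ?thesis using uv e by auto
  next
    case False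
    then have "x = v" using e uv by blast
    then show ?thesis using uv e sym by (metis insert_commute)
  qed
qed

context triangle_free
begin

lemma mixed_subclique:
  assumes C: "C0 \<subseteq> C" "indep C" and C0: "C0 \<noteq> {}"
  shows "mixed V C0 \<subseteq> mixed V C"
  unfolding mixed_def
proof
  fix v assume "v \<in> {v \<in> V - C0. (\<exists>c\<in>C0. T v c) \<and> (\<exists>c\<in>C0. \<not> T v c)}"
  then obtain c c' where v: "v \<in> V" "c \<in> C0" "T v c" "c' \<in> C0" "\<not> T v c'" by blast
  have "v \<notin> C" using indepD[OF C(2)] v C(1) by blast
  then show "v \<in> {v \<in> V - C. (\<exists>c\<in>C. T v c) \<and> (\<exists>c\<in>C. \<not> T v c)}" using v C(1) by blast
qed

text \<open>Shrinking \<open>C\<close> to \<open>C0\<close> moves \<open>card (C - C0)\<close>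
  vertices outside, while \<open>J1\<close> and \<open>J2\<close>, being uniform on
  \<open>C0\<close>, stop being mixed. If \<open>C0\<close> is not lighter than \<open>C\<close>,
  this is Hall's condition for \<open>packs_clique_assembly\<close>; \<open>H\<close> stands for
  mixed vertices kept out of the assembly.\<close>

lemma clique_hall_count:
  assumes fin: "finite V" and C: "C \<subseteq> V" "indep C" and C0: "C0 \<subseteq> C" "C0 \<noteq> {}"
    and J: "J1 \<subseteq> mixed V C" "J2 \<subseteq> mixed V C" "J1 \<inter> J2 = {}"
    and J1: "\<And>x c. x \<in> J1 \<Longrightarrow> c \<in> C0 \<Longrightarrow> T x c" and J2: "\<And>x c. x \<in> J2 \<Longrightarrow> c \<in> C0 \<Longrightarrow> \<not> T x c"
    and H: "H \<subseteq> mixed V C - (J1 \<union> J2)"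
  shows "weight V C0 + card J1 + card J2 + card H \<le> weight V C + card (C - C0) + card (H \<inter> mixed V C0)"
proof -
  define D where "D = mixed V C"
  define D0 where "D0 = mixed V C0"
  have finD: "finite D" "finite D0" unfolding D_def D0_def mixed_def using fin by auto
  have D0: "D0 \<subseteq> D" unfolding D_def D0_def by (rule mixed_subclique[OF C0(1) C(2) C0(2)])
  have dis: "D0 \<inter> J1 = {}" "D0 \<inter> J2 = {}" using J1 J2 unfolding D0_def mixed_def by blast+
  have finJ: "finite J1" "finite J2" "finite H"
    using J H finD(1) unfolding D_def by (meson Diff_subset finite_subset)+
  have "card (D0 \<union> (H - D0) \<union> (J1 \<union> J2)) \<le> card D"
    using D0 J H finD unfolding D_def by (intro card_mono) auto
  moreover have "card (D0 \<union> (H - D0) \<union> (J1 \<union> J2)) = card D0 + card (H - D0) + (card J1 + card J2)"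
  proof -
    have "card (D0 \<union> (H - D0) \<union> (J1 \<union> J2)) = card (D0 \<union> (H - D0)) + card (J1 \<union> J2)"
      using finD finJ dis H by (intro card_Un_disjoint) auto
    also have "card (D0 \<union> (H - D0)) = card D0 + card (H - D0)"
      using finD finJ by (intro card_Un_disjoint) auto
    also have "card (J1 \<union> J2) = card J1 + card J2"
      using finJ J(3) by (intro card_Un_disjoint) auto
    finally show ?thesis .
  qed
  moreover have "card H = card (H - D0) + card (H \<inter> D0)"
    using finJ by (metis Int_Diff_Un Int_Diff_disjoint add.commute card_Un_disjoint finite_Diff
        finite_Int)
  moreover have "weight V C0 + card C0 = card V + card D0"
    unfolding D0_def by (rule weight_card) (use fin C C0 in auto)
  moreover have "weight V C + card C = card V + card D"
    unfolding D_def by (rule weight_card) (use fin C in auto)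
  moreover have "card C = card (C - C0) + card C0"
    using C0(1) C(1) fin by (metis card_Diff_subset card_mono finite_subset le_add_diff_inverse2)
  ultimately show ?thesis unfolding D0_def by linarith
qed

lemma heavy_cliquesD:
  "heavy_cliques V m \<Longrightarrow> C \<subseteq> V \<Longrightarrow> C \<noteq> {} \<Longrightarrow> indep C \<Longrightarrow> m \<le> weight V C"
  unfolding heavy_cliques_def by blast

lemma gadj_matching:
  assumes fin: "finite V" and C: "C \<subseteq> V" "C \<noteq> {}" "indep C"
    and conn: "highly_connected V q" and M: "matching T V M"
    and minimal: "\<And>C'. C \<subseteq> C' \<Longrightarrow> C' \<subseteq> V \<Longrightarrow> indep C' \<Longrightarrow> weight V C \<le> weight V C'"
    and d: "2 \<le> d" "weight V C < 2 * card M + d" "weight V C < 2 * q + d"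
  shows "\<exists>N. matching (gadj V C) (nonadjacent V C \<union> alladjacent V C) N \<and>
     weight V C < 2 * card N + 2 * card (mixed V C) + d"
proof -
  define S where "S = nonadjacent V C \<union> alladjacent V C"
  have "finite S" unfolding S_def nonadjacent_def alladjacent_def using fin by auto
  then obtain N Y P where N: "matching (gadj V C) S N" "Y \<subseteq> S"
    "edgeless_partition (gadj V C) (S - Y) P" "card S + card Y \<le> 2 * card N + odd_parts P"
    using tutte_berge[of S "gadj V C"] gadj_sym by blast
  have "odd_parts P < card Y + d"
    by (rule no_barrier[OF fin C conn M minimal]) (use N d in \<open>auto simp: S_def\<close>)
  moreover have "weight V C = card S + 2 * card (mixed V C)"
    unfolding S_def by (rule weight_classes[OF fin C(2)])
  ultimately show ?thesis using N unfolding S_def by (intro exI[of _ N]) auto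
qed

text \<open>Every mixed vertex is used with a pair inside the clique.\<close>

lemma packs_light_clique:
  assumes fin: "finite V" and conn: "highly_connected V k" and size: "3 * k + 1 \<le> card V"
    and M: "matching T V M" "card M = k + 1"
    and C: "C \<subseteq> V" "C \<noteq> {}" "indep C" "2 * k \<le> weight V C" "weight V C \<le> 2 * k + 1"
    and minimal: "heavy_cliques V (weight V C)"
  shows "packs V k"
proof -
  define D where "D = mixed V C"
  \<comment> \<open>The slack \<open>weight V C - 2 * k + 2\<close> is 2 or 3, chosen so that the
    bound reads \<open>k \<le> card N + card D\<close> for both weights.\<close>
  have "\<exists>N. matching (gadj V C) (nonadjacent V C \<union> alladjacent V C) N \<and>
     weight V C < 2 * card N + 2 * card (mixed V C) + (weight V C - 2 * k + 2)"
    by (rule gadj_matching[OF fin C(1-3) conn M(1)])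
      (use C M(2) heavy_cliquesD[OF minimal] in auto)
  then obtain N where N: "matching (gadj V C) (nonadjacent V C \<union> alladjacent V C) N"
    "weight V C < 2 * card N + 2 * card D + (weight V C - 2 * k + 2)" unfolding D_def by blast
  then have "k - card D \<le> card N" using C(4) by linarith
  then obtain N0 where N0: "N0 \<subseteq> N" "card N0 = k - card D"
    using obtain_subset_with_card_n by metis
  have mN0: "matching (gadj V C) (nonadjacent V C \<union> alladjacent V C) N0"
    using N(1) N0(1) by (rule matching_sub) (use matching_subset[OF N(1)] N0(1) in blast)
  have wD: "2 * card D \<le> weight V C"
    using weight_classes[OF fin C(2)] unfolding D_def by simp
  have Dk: "card D \<le> k" using wD C(5) by linarith
  have wC: "weight V C + card C = card V + card D" unfolding D_def by (rule weight_card[OF fin C(1)])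
  have "packs (C \<union> D \<union> \<Union>N0) (card D + card N0)"
  proof (rule packs_clique_assembly[OF fin C(1,3) _ _ mN0])
    show "2 * card D + card N0 \<le> card C" using N0(2) Dk wC C(5) size by linarith
    fix J1 J2 assume J: "J1 \<subseteq> D" "J2 \<subseteq> D" "J1 \<inter> J2 = {}"
    define C0 where "C0 = {c \<in> C. (\<forall>x\<in>J1. T x c) \<and> (\<forall>x\<in>J2. \<not> T x c)}"
    assume "{c \<in> C. (\<forall>x\<in>J1. T x c) \<and> (\<forall>x\<in>J2. \<not> T x c)} \<noteq> {}"
    then have C0: "C0 \<noteq> {}" "C0 \<subseteq> C" unfolding C0_def by auto
    have "weight V C0 + card J1 + card J2 + card ({} :: 'a set) \<le> weight V C + card (C - C0) + card ({} \<inter> mixed V C0)"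
      by (rule clique_hall_count[OF fin C(1,3) C0(2,1)]) (use J in \<open>auto simp: D_def C0_def\<close>)
    moreover have "weight V C \<le> weight V C0"
      using C C0 indep_subset by (intro heavy_cliquesD[OF minimal]) auto
    ultimately show "card J1 + card J2 \<le> card (C - {c \<in> C. (\<forall>x\<in>J1. T x c) \<and> (\<forall>x\<in>J2. \<not> T x c)})"
      unfolding C0_def by simp
  qed (auto simp: D_def)
  moreover have "card D + card N0 = k" using N0 Dk by simp
  moreover have "C \<union> D \<union> \<Union>N0 \<subseteq> V"
    using C(1) matching_subset[OF mN0] unfolding D_def mixed_def nonadjacent_def alladjacent_def by blast
  ultimately show ?thesis using packs_mono by metis
qed

text \<open>Here \<open>card C\<close> may be as small as \<open>k + card D - 1\<close>, one short
  of serving all mixed vertices. The stronger connectivity supplies a \<open>gadj\<close> matching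
  with \<open>k + 1 - card D\<close> edges, so one mixed vertex can be left out.\<close>

lemma packs_clique_weight_2:
  assumes fin: "finite V" and conn: "highly_connected V (k + 1)" and size: "3 * k + 1 \<le> card V"
    and M: "matching T V M" "card M = k + 1"
    and C: "C \<subseteq> V" "C \<noteq> {}" "indep C" "weight V C = 2 * k + 2" "mixed V C \<noteq> {}"
    and minimal: "heavy_cliques V (2 * k + 2)"
  shows "packs V k"
proof -
  define D where "D = mixed V C"
  have finD: "finite D" unfolding D_def mixed_def using fin by auto
  have "\<exists>N. matching (gadj V C) (nonadjacent V C \<union> alladjacent V C) N \<and>
     weight V C < 2 * card N + 2 * card (mixed V C) + 2"
    by (rule gadj_matching[OF fin C(1-3) conn M(1)])
      (use C M(2) heavy_cliquesD[OF minimal] in auto)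
  then obtain N where N: "matching (gadj V C) (nonadjacent V C \<union> alladjacent V C) N"
    "weight V C < 2 * card N + 2 * card D + 2" unfolding D_def by blast
  then have "k + 1 - card D \<le> card N" using C(4) by linarith
  then obtain N0 where N0: "N0 \<subseteq> N" "card N0 = k + 1 - card D"
    using obtain_subset_with_card_n by metis
  have mN0: "matching (gadj V C) (nonadjacent V C \<union> alladjacent V C) N0"
    using N(1) N0(1) by (rule matching_sub) (use matching_subset[OF N(1)] N0(1) in blast)
  have wD: "2 * card D \<le> weight V C"
    using weight_classes[OF fin C(2)] unfolding D_def by simp
  have Dk: "card D \<le> k + 1" using wD C(4) by linarith
  have wC: "weight V C + card C = card V + card D" unfolding D_def by (rule weight_card[OF fin C(1)])
  obtain d0 where d0: "d0 \<in> D" using C(5) unfolding D_def by blast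
  have cD: "card (D - {d0}) + 1 = card D" using d0 finD by (metis Suc_eq_plus1 card.remove)
  have "packs (C \<union> (D - {d0}) \<union> \<Union>N0) (card (D - {d0}) + card N0)"
  proof (rule packs_clique_assembly[OF fin C(1,3) _ _ mN0])
    show "2 * card (D - {d0}) + card N0 \<le> card C" using N0(2) Dk wC C(4) size cD by linarith
    fix J1 J2 assume J: "J1 \<subseteq> D - {d0}" "J2 \<subseteq> D - {d0}" "J1 \<inter> J2 = {}"
    define C0 where "C0 = {c \<in> C. (\<forall>x\<in>J1. T x c) \<and> (\<forall>x\<in>J2. \<not> T x c)}"
    assume "{c \<in> C. (\<forall>x\<in>J1. T x c) \<and> (\<forall>x\<in>J2. \<not> T x c)} \<noteq> {}"
    then have C0: "C0 \<noteq> {}" "C0 \<subseteq> C" unfolding C0_def by auto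
    have "weight V C0 + card J1 + card J2 + card ({} :: 'a set) \<le> weight V C + card (C - C0) + card ({} \<inter> mixed V C0)"
      by (rule clique_hall_count[OF fin C(1,3) C0(2,1)]) (use J in \<open>auto simp: D_def C0_def\<close>)
    moreover have "2 * k + 2 \<le> weight V C0"
      using C C0 indep_subset by (intro heavy_cliquesD[OF minimal]) auto
    ultimately show "card J1 + card J2 \<le> card (C - {c \<in> C. (\<forall>x\<in>J1. T x c) \<and> (\<forall>x\<in>J2. \<not> T x c)})"
      unfolding C0_def using C(4) by simp
  qed (auto simp: D_def)
  moreover have "card (D - {d0}) + card N0 = k" using N0 Dk cD by linarith
  moreover have "C \<union> (D - {d0}) \<union> \<Union>N0 \<subseteq> V"
    using C(1) matching_subset[OF mN0] unfolding D_def mixed_def nonadjacent_def alladjacent_def by blast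
  ultimately show ?thesis using packs_mono by metis
qed

text \<open>The auxiliary vertex \<open>\<delta>\<close> is joined to the vertices \<open>x\<close> outside the
  clique that form a seagull with some mixed vertex and some vertex of the clique.\<close>

lemma packs_clique_weight_3:
  assumes fin: "finite V" and conn: "highly_connected V (k + 1)" and size: "3 * k + 1 \<le> card V"
    and M: "matching T V M" "card M = k + 1"
    and C: "C \<subseteq> V" "C \<noteq> {}" "indep C" "weight V C = 2 * k + 3" "2 \<le> card (mixed V C)"
    and heavy: "heavy_cliques V (2 * k + 2)"
    and heavy1: "\<And>C'. C' \<subseteq> V \<Longrightarrow> C' \<noteq> {} \<Longrightarrow> indep C' \<Longrightarrow> mixed V C' \<noteq> {} \<Longrightarrow> 2 * k + 3 \<le> weight V C'"
    and heavy2: "\<And>C'. C' \<subset> C \<Longrightarrow> C' \<noteq> {} \<Longrightarrow> 2 \<le> card (mixed V C') \<Longrightarrow> 2 * k + 4 \<le> weight V C'"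
  shows "packs V k"
proof -
  define A where "A = nonadjacent V C"
  define B where "B = alladjacent V C"
  define D where "D = mixed V C"
  have finABD: "finite A" "finite B" "finite D"
    using fin unfolding A_def B_def D_def nonadjacent_def alladjacent_def mixed_def by auto
  have VC: "V - C = A \<union> B \<union> D" using clique_classes(1)[OF C(2)] unfolding A_def B_def D_def by simp
  have dAB: "A \<inter> B = {}" "(A \<union> B) \<inter> D = {}"
    using clique_classes[OF C(2), of V] unfolding A_def B_def D_def by auto
  have w: "card (A \<union> B) + 2 * card D = 2 * k + 3"
    using weight_classes[OF fin C(2)] C(4) unfolding A_def B_def D_def by simp
  have wC: "2 * k + 3 + card C = card V + card D"
    using weight_card[OF fin C(1)] C(4) unfolding D_def by simp
  have D2: "2 \<le> card D" using C(5) unfolding D_def .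
  have D_ne: "D \<noteq> {}" using D2 by auto
  \<comment> \<open>A mixed vertex stays mixed when the clique grows: it cannot enter an independent
    set that contains a \<open>T\<close>-neighbour of it. So \<open>heavy1\<close> applies to every
    enlargement.\<close>
  have minimal: "weight V C \<le> weight V C'" if C': "C \<subseteq> C'" "C' \<subseteq> V" "indep C'" for C'
  proof -
    obtain v where v: "v \<in> D" using D_ne by blast
    then obtain c c' where c: "v \<in> V" "c \<in> C" "T v c" "c' \<in> C" "\<not> T v c'"
      unfolding D_def mixed_def by blast
    have "v \<notin> C'" using indepD[OF C'(3)] c C'(1) by blast
    then have "v \<in> mixed V C'" using c C'(1) unfolding mixed_def by blast
    then show ?thesis using heavy1[of C'] C' C(2,4) by auto
  qed
  have AC: "\<not> T a c" "\<not> T c a" if "a \<in> A" "c \<in> C" for a c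
    using that T_sym unfolding A_def nonadjacent_def by blast+
  have BC: "T b c" if "b \<in> B" "c \<in> C" for b c
    using that unfolding B_def alladjacent_def by blast
  have ABV: "A \<subseteq> V - C" "B \<subseteq> V - C" "D \<subseteq> V - C" using VC by auto
  \<comment> \<open>Any vertex of \<open>C\<close> can lend its name to the auxiliary vertex, since
    \<open>gadj\<close> has no edge at \<open>C\<close>.\<close>
  obtain \<delta> where \<delta>: "\<delta> \<in> C" using C(2) by blast
  define good where "good x \<longleftrightarrow> x \<in> A \<or> x \<in> B \<and> (\<exists>d\<in>D. \<not> T d x)" for x
  define R where "R u v \<longleftrightarrow> gadj V C u v \<or> u = \<delta> \<and> good v \<or> v = \<delta> \<and> good u" for u v
  define S where "S = insert \<delta> (A \<union> B)"
  have \<delta>AB: "\<delta> \<notin> A \<union> B" using \<delta> ABV by blast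
  have finS: "finite S" unfolding S_def using finABD by simp
  have cS: "card S = card (A \<union> B) + 1" unfolding S_def using finABD \<delta>AB by simp
  have R_sym: "R u v \<Longrightarrow> R v u" for u v unfolding R_def using gadj_sym by blast
  obtain N Y P where N: "matching R S N" "Y \<subseteq> S" "edgeless_partition R (S - Y) P"
    "card S + card Y \<le> 2 * card N + odd_parts P"
    using tutte_berge[of S R] finS R_sym by blast
  have finY: "finite Y" using N(2) finS by (meson finite_subset)
  have finP: "finite P" using edgeless_partition_finite[OF N(3)] finS by blast
  have UP: "\<Union>P = S - Y" and djP: "pairwise disjnt P"
    and cross: "\<And>K L x y. K \<in> P \<Longrightarrow> L \<in> P \<Longrightarrow> K \<noteq> L \<Longrightarrow> x \<in> K \<Longrightarrow> y \<in> L \<Longrightarrow> \<not> R x y"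
    using N(3) unfolding edgeless_partition_def by blast+
  \<comment> \<open>\<open>card S = 2 * k + 4 - 2 * card D\<close> is even, so a deficiency below 2
    already means a perfect matching. It uses an edge at \<open>\<delta>\<close>, whose other end
    \<open>x\<close> goes into a seagull with a mixed vertex.\<close>
  have small: "odd_parts P < card Y + 2"
  proof (cases "\<delta> \<in> Y")
    case True
    define Y' where "Y' = Y - {\<delta>}"
    have cY: "card Y = card Y' + 1" unfolding Y'_def using True finY by (metis Suc_eq_plus1 card.remove)
    have "S - Y = A \<union> B - Y'" unfolding S_def Y'_def using True \<delta>AB by blast
    then have "edgeless_partition (gadj V C) (nonadjacent V C \<union> alladjacent V C - Y') P"
      using N(3) unfolding edgeless_partition_def R_def A_def B_def by auto
    moreover have "Y' \<subseteq> nonadjacent V C \<union> alladjacent V C"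
      using N(2) unfolding Y'_def S_def A_def B_def by blast
    ultimately have "odd_parts P < card Y' + 3"
      by (intro no_barrier[OF fin C(1-3) conn M(1) minimal]) (use C(4) M(2) in auto)
    then show ?thesis using cY by simp
  next
    case False
    then obtain K0 where K0: "K0 \<in> P" "\<delta> \<in> K0" using UP unfolding S_def by blast
    \<comment> \<open>No vertex in a part other than that of \<open>\<delta>\<close> is good, so
      \<open>B1\<close> is joined to \<open>C\<close>, to \<open>D\<close> and to
      \<open>A - Y\<close>; a \<open>B1\<close> larger than \<open>Y\<close> is too much for the
      connectivity.\<close>
    define B1 where "B1 = \<Union>(P - {K0})"
    have B1nR: "\<not> R \<delta> b" if b: "b \<in> B1" for b
    proof -
      obtain K where "K \<in> P" "K \<noteq> K0" "b \<in> K" using b unfolding B1_def by blast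
      then show ?thesis using cross K0 by blast
    qed
    have B1S: "B1 \<subseteq> A \<union> B - Y"
    proof -
      have "\<delta> \<notin> B1" using djP K0 unfolding B1_def pairwise_def disjnt_def by blast
      moreover have "B1 \<subseteq> S - Y" using UP unfolding B1_def by blast
      ultimately show ?thesis unfolding S_def by blast
    qed
    have B1: "b \<in> B" "\<And>d. d \<in> D \<Longrightarrow> T d b" if "b \<in> B1" for b
      using B1nR[OF that] that B1S unfolding R_def good_def by blast+
    have TA: "T a b" if a: "a \<in> A - Y" and b: "b \<in> B1" for a b
    proof (rule ccontr)
      assume "\<not> T a b"
      then have g: "gadj V C a b" using a B1(1)[OF b] unfolding gadj_def A_def B_def by blast
      obtain K where K: "K \<in> P" "K \<noteq> K0" "b \<in> K" using b unfolding B1_def by blast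
      have "a \<in> S - Y" using a unfolding S_def by blast
      then obtain L where L: "L \<in> P" "a \<in> L" using UP by blast
      have "L = K" using cross L K g unfolding R_def by blast
      then have "a \<in> B1" using L K unfolding B1_def by blast
      then show False using B1(1) a dAB(1) by blast
    qed
    have "odd_parts P = (\<Sum>K\<in>P. card K mod 2)" by (rule odd_parts_sum[OF finP])
    also have "\<dots> = card K0 mod 2 + (\<Sum>K\<in>P - {K0}. card K mod 2)"
      using finP K0(1) by (simp add: sum.remove)
    also have "(\<Sum>K\<in>P - {K0}. card K mod 2) \<le> (\<Sum>K\<in>P - {K0}. card K)"
      by (rule sum_mono) simp
    also have "(\<Sum>K\<in>P - {K0}. card K) = card B1"
      using edgeless_partition_sum[OF N(3), of "P - {K0}" UNIV] finS unfolding B1_def by simp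
    finally have odd1: "odd_parts P \<le> card K0 mod 2 + card B1" by simp
    show ?thesis
    proof (rule ccontr)
      assume "\<not> odd_parts P < card Y + 2"
      moreover have "card K0 mod 2 \<le> 1" by linarith
      ultimately have cB1: "card Y + 1 \<le> card B1" using odd1 by linarith
      then have "B1 \<noteq> {}" by auto
      define E where "E = C \<union> D \<union> (A - Y)"
      have "joined B1 E"
        using \<open>B1 \<noteq> {}\<close> C(2) BC B1 TA T_sym unfolding joined_def E_def by blast
      then have "card B1 + card E + (k + 1) \<le> card V"
        using conn B1S ABV C(1) unfolding E_def by (intro highly_connectedD) auto
      moreover have "card E = card C + card D + card (A - Y)"
      proof -
        have "card E = card (C \<union> D) + card (A - Y)"
          unfolding E_def using finABD C(1) fin ABV dAB
          by (intro card_Un_disjoint) (auto intro: finite_subset)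
        also have "card (C \<union> D) = card C + card D"
          using finABD C(1) fin ABV by (intro card_Un_disjoint) (auto intro: finite_subset)
        finally show ?thesis .
      qed
      moreover have "card A \<le> card (A - Y) + card Y"
        using finABD diff_card_le_card_Diff[OF finY, of A] by linarith
      moreover have cV: "card V = card C + card D + card A + card B"
      proof -
        have "card (A \<union> B) = card A + card B" using finABD dAB by (intro card_Un_disjoint) auto
        then show ?thesis using w wC by linarith
      qed
      ultimately have "k + 2 \<le> card B" using cB1 by linarith
      then have "B \<noteq> {}" by auto
      then have "joined B C" using BC C(2) unfolding joined_def by blast
      then have "card B + card C + (k + 1) \<le> card V"
        using conn ABV C(1) by (intro highly_connectedD) auto
      then have "k + 1 \<le> card A + card D" using cV by linarith
      moreover have "card (A \<union> B) = card A + card B" using finABD dAB by (intro card_Un_disjoint) auto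
      ultimately show False using w \<open>k + 2 \<le> card B\<close> D2 by linarith
    qed
  qed
  have "card S \<le> 2 * card N + 1" using small N(4) by linarith
  moreover have "even (card S)" using cS w by presburger
  ultimately have "card S \<le> 2 * card N" by presburger
  then have "\<Union>N = S"
    using card_Union_matching[OF N(1)] matching_subset[OF N(1)] finS by (metis card_seteq)
  then have "\<delta> \<in> \<Union>N" unfolding S_def by blast
  then obtain x where x0: "{\<delta>, x} \<in> N" "R \<delta> x" "x \<noteq> \<delta>"
    using matching_partner[of R S N \<delta>] N(1) R_sym by blast
  define e where "e = {\<delta>, x}"
  have x: "e = {\<delta>, x}" "R \<delta> x" "x \<noteq> \<delta>" and e: "e \<in> N" "\<delta> \<in> e" using x0 unfolding e_def by auto
  have "\<not> gadj V C \<delta> x" using \<delta>AB unfolding gadj_def A_def B_def by blast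
  then have gx: "good x" using x unfolding R_def by auto
  define N0 where "N0 = N - {e}"
  have N0: "\<Union>N0 = A \<union> B - {x}"
  proof -
    have "\<Union>N0 = \<Union>N - e"
      unfolding N0_def using matching_same_edge[OF N(1)] e by blast
    also have "\<dots> = insert \<delta> (A \<union> B) - {\<delta>, x}" unfolding \<open>\<Union>N = S\<close> x(1) S_def ..
    also have "\<dots> = A \<union> B - {x}" using \<delta>AB by auto
    finally show ?thesis .
  qed
  have mN0: "matching (gadj V C) (nonadjacent V C \<union> alladjacent V C) N0"
    unfolding matching_def
  proof (intro conjI ballI)
    show "finite N0" using matching_finite[OF N(1)] unfolding N0_def by simp
    show "\<Union>N0 \<subseteq> nonadjacent V C \<union> alladjacent V C" using N0 unfolding A_def B_def by blast
    show "pairwise disjnt N0"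
      using N(1) unfolding N0_def matching_def by (meson Diff_subset pairwise_subset)
    fix e' assume e': "e' \<in> N0"
    then have e'N: "e' \<in> N" unfolding N0_def by simp
    obtain u v where uv: "u \<noteq> v" "R u v" "e' = {u, v}"
      using N(1) e'N by (rule matching_edgeE)
    have "u \<noteq> \<delta>" "v \<noteq> \<delta>" using N0 e' uv \<delta>AB by blast+
    then show "\<exists>u v. u \<noteq> v \<and> gadj V C u v \<and> e' = {u, v}" using uv unfolding R_def by blast
  qed
  have cN0: "card N0 + card D = k + 1"
  proof -
    have "x \<in> A \<union> B" using gx unfolding good_def by blast
    then have "card (\<Union>N0) + 1 = card (A \<union> B)"
      unfolding N0 using finABD by (metis Suc_eq_plus1 card.remove finite_UnI)
    then show ?thesis using card_Union_matching[OF mN0] w by linarith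
  qed
  obtain d where d: "d \<in> D" "x \<in> B \<Longrightarrow> \<not> T d x"
    using gx D_ne dAB unfolding good_def by (cases "x \<in> A") blast+
  have dm: "\<exists>c\<in>C. T d c" "\<exists>c\<in>C. \<not> T d c" using d(1) unfolding D_def mixed_def by auto
  have "\<exists>c\<in>C. seagull {c, d, x}"
  proof (cases "x \<in> A")
    case True
    show ?thesis
    proof (cases "T d x")
      case T: True
      obtain c where c: "c \<in> C" "\<not> T d c" using dm by blast
      have "seagull {d, x, c}" using T c AC[OF True] ABV d(1) True by (intro seagullI) auto
      then show ?thesis using c by (metis insert_commute)
    next
      case nT: False
      obtain c where c: "c \<in> C" "T d c" using dm by blast
      have "seagull {d, c, x}" using nT c AC[OF True] ABV d(1) True dAB by (intro seagullI) auto
      then show ?thesis using c by (metis insert_commute)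
    qed
  next
    case False
    then have xB: "x \<in> B" using gx unfolding good_def by blast
    obtain c where c: "c \<in> C" "\<not> T d c" using dm by blast
    have "seagull {x, c, d}"
      using c BC[OF xB] d(2)[OF xB] T_sym ABV d(1) xB dAB by (intro seagullI) auto
    then show ?thesis using c by (metis insert_commute)
  qed
  then obtain c where c: "c \<in> C" "seagull {c, d, x}" by blast
  have "card (D - {d}) \<ge> 1" using D2 card_Diff_singleton[OF d(1)] by simp
  then have "D - {d} \<noteq> {}" by (intro notI) simp
  then obtain d0 where d0: "d0 \<in> D" "d0 \<noteq> d" by blast
  \<comment> \<open>\<open>d\<close> is spent in \<open>{c, d, x}\<close> and \<open>d0\<close> is
    left out; as \<open>card N0 + card D = k + 1\<close>, the total is again
    \<open>k\<close>.\<close>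
  define D' where "D' = D - {d, d0}"
  have cD': "card D' + 2 = card D"
    unfolding D'_def using d d0 finABD(3) D2 by (subst card_Diff_subset) auto
  have cC: "card (C - {c}) + 1 = card C"
    using c C(1) fin by (metis Suc_eq_plus1 card.remove finite_subset)
  have "packs (C - {c} \<union> D' \<union> \<Union>N0) (card D' + card N0)"
  proof (rule packs_clique_assembly[OF fin C(1,3) _ _ mN0])
    show "2 * card D' + card N0 \<le> card (C - {c})" using cN0 wC cD' cC size by linarith
    show "D' \<subseteq> mixed V C" unfolding D'_def D_def by auto
    fix J1 J2 assume J: "J1 \<subseteq> D'" "J2 \<subseteq> D'" "J1 \<inter> J2 = {}"
    define C0 where "C0 = {c' \<in> C - {c}. (\<forall>x\<in>J1. T x c') \<and> (\<forall>x\<in>J2. \<not> T x c')}"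
    assume "{c' \<in> C - {c}. (\<forall>x\<in>J1. T x c') \<and> (\<forall>x\<in>J2. \<not> T x c')} \<noteq> {}"
    then have C0: "C0 \<noteq> {}" "C0 \<subseteq> C" "c \<notin> C0" unfolding C0_def by auto
    have "weight V C0 + card J1 + card J2 + card {d, d0} \<le> weight V C + card (C - C0) + card ({d, d0} \<inter> mixed V C0)"
      by (rule clique_hall_count[OF fin C(1,3) C0(2,1)])
        (use J d d0 in \<open>auto simp: D_def D'_def C0_def\<close>)
    moreover have "card {d, d0} = 2" using d0 by simp
    \<comment> \<open>Hall's condition is short by two: one for the reserved clique vertex
      \<open>c\<close>, one because \<open>C0\<close> may weigh only \<open>2 * k + 2\<close>. The
      two withheld mixed vertices pay for this, and each that is still mixed over \<open>C0\<close>
      raises the guaranteed weight by one instead.\<close>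
    moreover have "2 * k + 2 + card ({d, d0} \<inter> mixed V C0) \<le> weight V C0"
    proof -
      have C0V: "C0 \<subseteq> V" "indep C0" using C C0 indep_subset by auto
      have fm: "finite (mixed V C0)" unfolding mixed_def using fin by simp
      have le: "card ({d, d0} \<inter> mixed V C0) \<le> card (mixed V C0)"
        using fm by (intro card_mono) auto
      have le2: "card ({d, d0} \<inter> mixed V C0) \<le> 2"
        using card_mono[of "{d, d0}" "{d, d0} \<inter> mixed V C0"] d0 by auto
      have 0: "2 * k + 2 \<le> weight V C0" using heavy_cliquesD[OF heavy C0V(1) C0(1) C0V(2)] .
      consider "card ({d, d0} \<inter> mixed V C0) = 0" | "card ({d, d0} \<inter> mixed V C0) = 1"
        | "card ({d, d0} \<inter> mixed V C0) = 2" using le2 by linarith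
      then show ?thesis
      proof cases
        case 2
        then have "mixed V C0 \<noteq> {}" using le by auto
        then show ?thesis using heavy1[OF C0V(1) C0(1) C0V(2)] 2 by simp
      next
        case 3
        have "C0 \<subset> C" using C0(2,3) c(1) by blast
        then show ?thesis using heavy2[of C0] C0(1) le 3 by linarith
      qed (use 0 in simp)
    qed
    moreover have "card (C - C0) = card (C - {c} - C0) + 1"
    proof -
      have "C - {c} - C0 = C - C0 - {c}" by blast
      then show ?thesis using c(1) C0(3) C(1) fin
        by (metis DiffI Suc_eq_plus1 card.remove finite_Diff finite_subset)
    qed
    ultimately have "card J1 + card J2 \<le> card (C - {c} - C0)" using C(4) by linarith
    then show "card J1 + card J2 \<le> card (C - {c} - {c' \<in> C - {c}. (\<forall>x\<in>J1. T x c') \<and> (\<forall>x\<in>J2. \<not> T x c')})"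
      unfolding C0_def .
  qed auto
  moreover have "C - {c} \<union> D' \<union> \<Union>N0 \<subseteq> V - {c, d, x}"
  proof -
    have "x \<in> A \<union> B" using gx unfolding good_def by blast
    then have "x \<notin> C" "x \<notin> D" "d \<notin> C" "d \<notin> A \<union> B" "c \<notin> D" "c \<notin> A \<union> B"
      using ABV dAB(2) d(1) c(1) by blast+
    then show ?thesis unfolding N0 D'_def using C(1) ABV by blast
  qed
  ultimately have "packs (V - {c, d, x}) (card D' + card N0)" by (rule packs_mono)
  moreover have "x \<in> A \<union> B" using gx unfolding good_def by blast
  then have "{c, d, x} \<subseteq> V" using c(1) C(1) d(1) ABV by blast
  ultimately have "packs V (Suc (card D' + card N0))" using c(2) packs_add_seagull by blast
  moreover have "Suc (card D' + card N0) = k" using cN0 cD' by linarith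
  ultimately show ?thesis by simp
qed


text \<open>A graph without an induced three-vertex path is a disjoint union of cliques, and
  \<open>T_triangle\<close> allows at most two of them.\<close>

lemma seagull_free_cases:
  assumes free: "\<And>Q. Q \<subseteq> V \<Longrightarrow> \<not> seagull Q"
  shows "indep V \<or> (\<exists>A B. joined A B \<and> A \<union> B = V)"
proof (cases "indep V")
  case False
  then obtain a b where ab: "a \<in> V" "b \<in> V" "T a b" unfolding indep_def by blast
  define A where "A = {v \<in> V. T v b}"
  define B where "B = {v \<in> V. T v a}"
  have "A \<union> B = V"
  proof
    show "V \<subseteq> A \<union> B"
    proof
      fix v assume v: "v \<in> V"
      have "v = a \<or> v = b \<or> T a v \<or> T b v" using free[of "{a, b, v}"] seagullI[of a b v] ab v by blast
      then show "v \<in> A \<union> B" using ab v T_sym unfolding A_def B_def by blast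
    qed
  qed (auto simp: A_def B_def)
  moreover have "joined A B"
    unfolding joined_def
  proof (intro conjI ballI)
    show "A \<noteq> {}" "B \<noteq> {}" using ab T_sym unfolding A_def B_def by blast+
    fix x y assume "x \<in> A" "y \<in> B"
    then have xy: "x \<in> V" "T x b" "y \<in> V" "T y a" unfolding A_def B_def by auto
    have yb: "\<not> T y b" using T_triangle xy(4) ab(3) by blast
    show "T x y"
    proof (rule ccontr)
      assume n: "\<not> T x y"
      have "y \<noteq> x" using xy(2) yb by blast
      moreover have "y \<noteq> b" using n xy(2) by blast
      ultimately have "seagull {x, b, y}" using xy n yb T_sym by (intro seagullI) auto
      then show False using free[of "{x, b, y}"] xy ab by blast
    qed
  qed
  ultimately show ?thesis by blast
qed simp

lemma weight_remove:
  assumes "finite V" "V' \<subseteq> V" "C \<subseteq> V'"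
  shows "weight V C \<le> weight V' C + card (V - V') + card (mixed V C \<inter> (V - V'))"
proof -
  have "V - C = (V' - C) \<union> (V - V')" using assms by blast
  then have "card (V - C) \<le> card (V' - C) + card (V - V')" by (metis card_Un_le)
  moreover have "mixed V C = mixed V' C \<union> (mixed V C \<inter> (V - V'))"
    using assms unfolding mixed_def by blast
  then have "card (mixed V C) \<le> card (mixed V' C) + card (mixed V C \<inter> (V - V'))"
    by (metis card_Un_le)
  ultimately show ?thesis unfolding weight_def by linarith
qed

text \<open>Removing the seagull found here destroys only one matching edge, as the induction in the
  packing theorem requires. If there is none, an unmatched vertex is \<open>T\<close>-adjacent to an
  end of every edge of every matching of size \<open>m\<close>; exchanging edges spreads this until
  \<open>V\<close> contains a joined pair that leaves at most \<open>m\<close> vertices.\<close>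

lemma compatible_matching_edge:
  assumes fin: "finite V" and conn: "highly_connected V (m + 1)"
    and M: "matching T V M" "card M = m" and u0: "u \<in> V - \<Union>M" and M_ne: "M \<noteq> {}"
  shows "\<exists>M e u. matching T V M \<and> card M = m \<and> e \<in> M \<and> u \<in> V - \<Union>M \<and> seagull (insert u e)"
proof (rule ccontr)
  assume none: "\<not> ?thesis"
  have hit: "T u a \<or> T u b" if N: "matching T V N" "card N = m" "{a, b} \<in> N" "u \<in> V - \<Union>N" for N a b u
  proof (rule ccontr)
    assume n: "\<not> (T u a \<or> T u b)"
    obtain x y where xy: "x \<noteq> y" "T x y" "{a, b} = {x, y}" using N(1,3) by (rule matching_edgeE)
    then have "T a b" using T_sym by (metis doubleton_eq_iff)
    moreover have "u \<noteq> a" "u \<noteq> b" using N by blast+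
    ultimately have "seagull {a, b, u}" using n T_sym by (intro seagullI) auto
    then have "seagull (insert u {a, b})" by (simp add: insert_commute)
    then show False using none N by blast
  qed
  define U where "U = V - \<Union>M"
  have uU: "u \<in> U" using u0 U_def by simp
  have "\<forall>e\<in>M. \<exists>p. e = {fst p, snd p} \<and> T u (fst p) \<and> T (fst p) (snd p)"
  proof
    fix e assume e: "e \<in> M"
    obtain x y where xy: "x \<noteq> y" "T x y" "e = {x, y}" using M(1) e by (rule matching_edgeE)
    have "T u x \<or> T u y" using hit[OF M, of x y u] e xy u0 by blast
    then show "\<exists>p. e = {fst p, snd p} \<and> T u (fst p) \<and> T (fst p) (snd p)"
    proof
      assume "T u x"
      then show ?thesis using xy by (intro exI[of _ "(x, y)"]) auto
    next
      assume "T u y"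
      then show ?thesis using xy T_sym by (intro exI[of _ "(y, x)"]) auto
    qed
  qed
  then obtain p where p: "\<And>e. e \<in> M \<Longrightarrow> e = {fst (p e), snd (p e)} \<and> T u (fst (p e)) \<and> T (fst (p e)) (snd (p e))"
    by metis
  define a where "a e = fst (p e)" for e
  define b where "b e = snd (p e)" for e
  have ab: "e = {a e, b e}" "T u (a e)" "T (a e) (b e)" if "e \<in> M" for e
    using p[OF that] unfolding a_def b_def by auto
  have abV: "a e \<in> V" "b e \<in> V" "a e \<in> \<Union>M" "b e \<in> \<Union>M" if "e \<in> M" for e
    using ab(1)[OF that] that matching_subset[OF M(1)] by blast+
  have sep: "a e \<noteq> a e'" "a e \<noteq> b e'" "b e \<noteq> b e'" if "e \<in> M" "e' \<in> M" "e \<noteq> e'" for e e'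
    using matching_same_edge[OF M(1) that(1,2)] ab(1)[OF that(1)] ab(1)[OF that(2)] that(3) by blast+
  \<comment> \<open>The exchange replaces \<open>e\<close> by \<open>{v, a e}\<close> and frees
    \<open>b e\<close>, giving another matching to which \<open>hit\<close> applies.\<close>
  have swap: "matching T V (insert {v, a e} (M - {e}))" "card (insert {v, a e} (M - {e})) = m"
      "\<Union>(insert {v, a e} (M - {e})) = insert v (\<Union>M - {b e})"
    if e: "e \<in> M" and v: "v \<in> U" and Tv: "T v (a e)" for e v
  proof -
    have Un: "\<Union>(M - {e}) = \<Union>M - e"
      using matching_same_edge[OF M(1)] e by blast
    have m1: "matching T V (M - {e})"
      using M(1) by (rule matching_sub) (use matching_subset[OF M(1)] in auto)
    have "v \<notin> \<Union>(M - {e})" "a e \<notin> \<Union>(M - {e})" "v \<in> V"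
      using v ab(1)[OF e] unfolding Un U_def by auto
    note ins = matching_insert[OF m1 T_neq[OF Tv] Tv \<open>v \<in> V\<close> abV(1)[OF e] this(1,2)]
    show "matching T V (insert {v, a e} (M - {e}))" by (rule ins(1))
    have "card (M - {e}) + 1 = card M" using e matching_finite[OF M(1)] by (metis Suc_eq_plus1 card.remove)
    then show "card (insert {v, a e} (M - {e})) = m" using ins(2) M(2) by simp
    have "\<Union>M - {b e} = insert (a e) (\<Union>M - {a e, b e})"
      using abV(3)[OF e] ab(3)[OF e] T_irrefl by (auto)
    then show "\<Union>(insert {v, a e} (M - {e})) = insert v (\<Union>M - {b e})"
      using Un ab(1)[OF e] by auto
  qed
  have differ: "T v u'" if e: "e \<in> M" and v: "v \<in> U" "T v (a e)" and u': "u' \<in> U" "\<not> T u' (a e)" for e v u'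
  proof -
    have "u' \<noteq> v" using v u' by blast
    then have "T u' v \<or> T u' (a e)"
      using hit[OF swap(1,2)[OF e v], of v "a e" u'] swap(3)[OF e v] u'(1) unfolding U_def by blast
    then show ?thesis using u' T_sym by blast
  qed
  \<comment> \<open>Unmatched vertices are of two kinds: those \<open>T\<close>-adjacent to
    \<open>u\<close> attach to all ends \<open>b e\<close>, the others, \<open>u\<close> among them,
    to all ends \<open>a e\<close>.\<close>
  define U2 where "U2 = {v \<in> U. T u v}"
  define U1 where "U1 = U - U2"
  have TU1: "T v (a e)" if "v \<in> U1" "e \<in> M" for v e
    using differ[OF that(2) uU ab(2)[OF that(2)], of v] that unfolding U1_def U2_def by blast
  have nTU2: "\<not> T v (a e)" if "v \<in> U2" "e \<in> M" for v e
    using that ab(2)[OF that(2)] T_triangle T_sym unfolding U2_def by blast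
  have TU2: "T v (b e)" if "v \<in> U2" "e \<in> M" for v e
    using hit[OF M, of "a e" "b e" v] nTU2[OF that] that ab(1)[OF that(2)] unfolding U2_def U_def by auto
  define A' where "A' = a ` M"
  define B' where "B' = b ` M"
  have VU: "V = A' \<union> B' \<union> (U1 \<union> U2)"
  proof -
    have "\<Union>M = A' \<union> B'" unfolding A'_def B'_def using ab(1) by blast
    then show ?thesis using matching_subset[OF M(1)] unfolding U1_def U2_def U_def by blast
  qed
  show False
  proof (cases "U2 = {}")
    case True
    have "joined U A'" using uU M_ne TU1 True unfolding joined_def A'_def U1_def by blast
    then have "card U + card A' + (m + 1) \<le> card V"
      using conn VU unfolding U_def by (intro highly_connectedD) auto
    moreover have "card A' = m"
      unfolding A'_def using sep(1) M(2) by (subst card_image) (auto simp: inj_on_def)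
    moreover have "card U = card V - 2 * m"
      unfolding U_def using card_Union_matching[OF M(1)] M(2) matching_subset[OF M(1)] fin
      by (metis card_Diff_subset finite_subset)
    ultimately show False by linarith
  next
    case False
    then obtain u2 where u2: "u2 \<in> U2" by blast
    have AB: "T (a e') (b e)" if e: "e \<in> M" "e' \<in> M" for e e'
    proof (cases "e = e'")
      case True
      then show ?thesis using ab e by blast
    next
      case ne: False
      have "b e \<noteq> u" using abV(4)[OF e(1)] uU unfolding U_def by blast
      then have "T (b e) (a e') \<or> T (b e) (b e')"
        using hit[OF swap(1,2)[OF e(1) uU ab(2)[OF e(1)]], of "a e'" "b e'" "b e"]
          swap(3)[OF e(1) uU ab(2)[OF e(1)]] ab(1)[OF e(2)] e ne abV(2)[OF e(1)] by auto
      moreover have "\<not> T (b e) (b e')" using TU2[OF u2] e T_triangle T_sym by blast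
      ultimately show ?thesis using T_sym by blast
    qed
    have U12: "T v w" if "v \<in> U1" "w \<in> U2" for v w
    proof -
      obtain e where e: "e \<in> M" using M_ne by blast
      show ?thesis
        using differ[OF e _ TU1[OF that(1) e] _ nTU2[OF that(2) e]] that
        unfolding U1_def U2_def by blast
    qed
    have "joined (A' \<union> U2) (B' \<union> U1)"
      unfolding joined_def
    proof (intro conjI ballI)
      show "A' \<union> U2 \<noteq> {}" using u2 by blast
      show "B' \<union> U1 \<noteq> {}" using M_ne unfolding B'_def by blast
      fix x y assume x: "x \<in> A' \<union> U2" and y: "y \<in> B' \<union> U1"
      consider e e' where "e \<in> M" "e' \<in> M" "x = a e" "y = b e'" | e where "e \<in> M" "x = a e" "y \<in> U1"
        | e where "x \<in> U2" "e \<in> M" "y = b e" | "x \<in> U2" "y \<in> U1"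
        using x y unfolding A'_def B'_def by blast
      then show "T x y"
        by cases (use AB TU1 TU2 U12 T_sym in blast)+
    qed
    then have "card (A' \<union> U2) + card (B' \<union> U1) + (m + 1) \<le> card V"
      using conn VU by (intro highly_connectedD) auto
    moreover have "V = (A' \<union> U2) \<union> (B' \<union> U1)" using VU by blast
    then have "card V \<le> card (A' \<union> U2) + card (B' \<union> U1)" by (metis card_Un_le)
    ultimately show False by linarith
  qed
qed

lemma not_highly_connectedE:
  assumes "highly_connected V k" "\<not> highly_connected V (k + 1)"
  obtains A B where "A \<subseteq> V" "B \<subseteq> V" "joined A B" "card A + card B + k = card V" "card A \<le> card B"
proof -
  obtain A B where AB: "A \<subseteq> V" "B \<subseteq> V" "joined A B" "\<not> card A + card B + (k + 1) \<le> card V"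
    using assms(2) unfolding highly_connected_def by blast
  have eq: "card A + card B + k = card V" using highly_connectedD[OF assms(1) AB(1-3)] AB(4) by linarith
  show thesis
  proof (cases "card A \<le> card B")
    case True
    then show ?thesis using that AB eq by blast
  next
    case False
    have "card B + card A + k = card V" "card B \<le> card A" using eq False by auto
    then show ?thesis using that[OF AB(2,1) joined_sym[OF AB(3)]] by blast
  qed
qed

text \<open>A weak form of the Chudnovsky--Seymour theorem on packing seagulls. Asking for one vertex and
  one matching edge more than necessary removes the cases where the size condition is tight.\<close>

theorem seagull_packing:
  assumes "finite V" "3 * k + 1 \<le> card V" "highly_connected V k" "heavy_cliques V (2 * k)"
    and "matching T V M" "card M = k + 1"
  shows "packs V k"
  using assms
proof (induction k arbitrary: V M)
  case 0
  then show ?case using packs_0 by simp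
next
  case (Suc k0)
  define k where "k = Suc k0"
  note fin = Suc.prems(1)
  have size: "3 * k + 1 \<le> card V" and conn: "highly_connected V k" and heavy: "heavy_cliques V (2 * k)"
    and M: "matching T V M" "card M = k + 1"
    using Suc.prems unfolding k_def by auto
  have "packs V k"
  proof (rule ccontr)
    assume no: "\<not> packs V k"
    \<comment> \<open>A counterexample has slack in connectivity and in the weights, because each
      way of being tight has a direct packing. The slack gained here and below is what the removal
      of one seagull consumes.\<close>
    have conn1: "highly_connected V (k + 1)"
    proof (rule ccontr)
      assume "\<not> highly_connected V (k + 1)"
      with conn obtain A B where "A \<subseteq> V" "B \<subseteq> V" "joined A B" "card A + card B + k = card V"
        "card A \<le> card B" by (rule not_highly_connectedE)
      then have "packs V k" using size by (intro packs_cutset[OF fin conn heavy]) auto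
      then show False using no by simp
    qed
    have heavy2: "heavy_cliques V (2 * k + 2)"
    proof (rule ccontr)
      assume "\<not> heavy_cliques V (2 * k + 2)"
      then obtain C1 where "C1 \<subseteq> V" "C1 \<noteq> {}" "indep C1" "\<not> 2 * k + 2 \<le> weight V C1"
        unfolding heavy_cliques_def by blast
      then have C1: "C1 \<subseteq> V \<and> C1 \<noteq> {} \<and> indep C1" "weight V C1 \<le> 2 * k + 1" by auto
      define ok where "ok C \<longleftrightarrow> C \<subseteq> V \<and> C \<noteq> {} \<and> indep C" for C
      have "ok C1" using C1(1) unfolding ok_def .
      then obtain C where okC: "ok C" and okmin: "\<forall>C'. ok C' \<longrightarrow> weight V C \<le> weight V C'"
        using ex_has_least_nat[of ok C1 "weight V"] by blast
      have C: "C \<subseteq> V \<and> C \<noteq> {} \<and> indep C" using okC unfolding ok_def .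
      have min: "weight V C \<le> weight V C'" if "C' \<subseteq> V \<and> C' \<noteq> {} \<and> indep C'" for C'
        using okmin that unfolding ok_def by blast
      have "weight V C \<le> 2 * k + 1" using min[OF C1(1)] C1(2) by linarith
      moreover have "heavy_cliques V (weight V C)" unfolding heavy_cliques_def using min by blast
      ultimately have "packs V k"
        using C heavy_cliquesD[OF heavy, of C] packs_light_clique[OF fin conn size M, of C] by blast
      then show False using no by simp
    qed
    have heavy3: "2 * k + 3 \<le> weight V C"
      if C: "C \<subseteq> V" "C \<noteq> {}" "indep C" "mixed V C \<noteq> {}" for C
    proof (rule ccontr)
      assume "\<not> 2 * k + 3 \<le> weight V C"
      then have "weight V C = 2 * k + 2" using heavy_cliquesD[OF heavy2 C(1-3)] by linarith
      then have "packs V k" using packs_clique_weight_2[OF fin conn1 size M C(1-3) _ C(4) heavy2] by blast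
      then show False using no by simp
    qed
    have heavy4: "2 * k + 4 \<le> weight V C"
      if C: "C \<subseteq> V" "C \<noteq> {}" "indep C" "2 \<le> card (mixed V C)" for C
    proof (rule ccontr)
      assume "\<not> 2 * k + 4 \<le> weight V C"
      moreover have "mixed V C \<noteq> {}" using C(4) by auto
      ultimately have "weight V C = 2 * k + 3" using heavy3[OF C(1-3)] by linarith
      moreover define ok where "ok C \<longleftrightarrow> C \<subseteq> V \<and> C \<noteq> {} \<and> indep C \<and> 2 \<le> card (mixed V C) \<and>
        weight V C = 2 * k + 3" for C
      ultimately have "ok C" using C by simp
      \<comment> \<open>Fewest vertices among the cliques of this weight with two mixed vertices, so
        that every proper subclique with two mixed vertices is strictly heavier, as
        \<open>packs_clique_weight_3\<close> asks.\<close>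
      then obtain C1 where okC: "ok C1" and okmin: "\<forall>C'. ok C' \<longrightarrow> card C1 \<le> card C'"
        using ex_has_least_nat[of ok C card] by blast
      have C1: "C1 \<subseteq> V \<and> C1 \<noteq> {} \<and> indep C1 \<and> 2 \<le> card (mixed V C1) \<and> weight V C1 = 2 * k + 3"
        using okC unfolding ok_def .
      have "packs V k"
      proof (rule packs_clique_weight_3[OF fin conn1 size M, of C1])
        fix C' assume C': "C' \<subset> C1" "C' \<noteq> {}" "2 \<le> card (mixed V C')"
        have C'V: "C' \<subseteq> V" "indep C'" using C' C1 indep_subset by blast+
        have "mixed V C' \<noteq> {}" using C'(3) by auto
        then have "2 * k + 3 \<le> weight V C'" using heavy3 C'V C'(2) by blast
        moreover have "weight V C' \<noteq> 2 * k + 3"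
        proof
          assume "weight V C' = 2 * k + 3"
          then have "ok C'" using C'V C' unfolding ok_def by blast
          then have "card C1 \<le> card C'" using okmin by blast
          moreover have "finite C1" using C1 fin finite_subset by blast
          ultimately show False using psubset_card_mono[OF _ C'(1)] by simp
        qed
        ultimately show "2 * k + 4 \<le> weight V C'" by linarith
      qed (use C1 heavy2 heavy3 in auto)
      then show False using no by simp
    qed
    have conn2: "highly_connected V (k + 2)"
    proof (rule ccontr)
      assume "\<not> highly_connected V (k + 2)"
      then have "\<not> highly_connected V ((k + 1) + 1)" by simp
      with conn1 obtain A B where AB: "A \<subseteq> V" "B \<subseteq> V" "joined A B" "card A + card B + (k + 1) = card V"
        "card A \<le> card B" by (rule not_highly_connectedE)
      have "card (A \<union> B) < card V" using card_Un_le[of A B] AB(4) by linarith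
      \<comment> \<open>Deleting one vertex of this cut of \<open>k + 1\<close> vertices leaves a
        cut of \<open>k\<close>, and the reserves in connectivity, weight and size pay for the
        deletion.\<close>
      then have "V - (A \<union> B) \<noteq> {}" using AB(1,2) by (metis Diff_eq_empty_iff Un_least less_irrefl subset_antisym)
      then obtain x where x: "x \<in> V" "x \<notin> A" "x \<notin> B" by blast
      have cV: "card (V - {x}) + 1 = card V" using x fin by (metis Suc_eq_plus1 card.remove)
      have "packs (V - {x}) k"
      proof (rule packs_cutset)
        show "highly_connected (V - {x}) k"
          by (rule highly_connected_remove[OF conn1, of _ 1]) (use cV in auto)
        show "heavy_cliques (V - {x}) (2 * k)"
          unfolding heavy_cliques_def
        proof (intro allI impI)
          fix C assume C: "C \<subseteq> V - {x}" "C \<noteq> {}" "indep C"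
          have "weight V C \<le> weight (V - {x}) C + card (V - (V - {x})) + card (mixed V C \<inter> (V - (V - {x})))"
            by (rule weight_remove) (use fin C in auto)
          moreover have "V - (V - {x}) = {x}" using x by blast
          moreover have "card (mixed V C \<inter> {x}) \<le> 1"
            using card_mono[of "{x}" "mixed V C \<inter> {x}"] by simp
          moreover have "2 * k + 2 \<le> weight V C" using C heavy_cliquesD[OF heavy2] by blast
          ultimately show "2 * k \<le> weight (V - {x}) C" by simp
        qed
        show "3 * k \<le> card (V - {x})" "card A + card B + k = card (V - {x})" using size cV AB(4) by auto
      qed (use AB x fin in auto)
      then show False using no packs_mono by (metis Diff_subset)
    qed
    show False
    \<comment> \<open>A vertex outside a matching with \<open>k + 1\<close> edges is guaranteed by
      \<open>3 * k + 1 > 2 * (k + 1)\<close> only for \<open>k \<ge> 2\<close>; for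
      \<open>k = 1\<close> any seagull is enough.\<close>
    proof (cases "k = 1")
      case True
      have "\<exists>Q\<subseteq>V. seagull Q"
      proof (rule ccontr)
        assume "\<not> (\<exists>Q\<subseteq>V. seagull Q)"
        then consider "indep V" | A B where "joined A B" "A \<union> B = V" using seagull_free_cases by blast
        then show False
        proof cases
          case 1
          obtain e where e: "e \<in> M" using M(2) by fastforce
          obtain x y where "x \<noteq> y" "T x y" "e = {x, y}" using M(1) e by (rule matching_edgeE)
          then show False using 1 e matching_subset[OF M(1)] unfolding indep_def by blast
        next
          case 2
          then have "card A + card B + k \<le> card V" by (intro highly_connectedD[OF conn]) auto
          moreover have "card V \<le> card A + card B" using 2(2) card_Un_le by metis
          ultimately show False using True by linarith
        qed
      qed
      then obtain Q where "Q \<subseteq> V" "seagull Q" by blast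
      then have "packs V (Suc 0)" by (intro packs_add_seagull packs_0)
      then show False using no True by simp
    next
      case False
      then have k2: "k \<ge> 2" using k_def by simp
      have "card (\<Union>M) < card V" using card_Union_matching[OF M(1)] M(2) size k2 by linarith
      then have "V - \<Union>M \<noteq> {}" using matching_subset[OF M(1)] by (metis Diff_eq_empty_iff less_irrefl subset_antisym)
      then obtain u0 where u0: "u0 \<in> V - \<Union>M" by blast
      have "M \<noteq> {}" using M(2) by auto
      have conn2': "highly_connected V ((k + 1) + 1)" using conn2 by simp
      obtain N e u where N: "matching T V N" "card N = k + 1" "e \<in> N" "u \<in> V - \<Union>N" "seagull (insert u e)"
        using compatible_matching_edge[OF fin conn2' M u0 \<open>M \<noteq> {}\<close>] by blast
      define Q where "Q = insert u e"
      have QV: "Q \<subseteq> V" using N matching_subset[OF N(1)] unfolding Q_def by blast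
      have sQ: "seagull Q" using N(5) unfolding Q_def .
      have cQ: "card Q = 3" "finite Q" using seagull_card[OF sQ] by auto
      have cV: "card (V - Q) + 3 = card V"
        using cQ QV fin card_mono[OF fin QV] by (simp add: card_Diff_subset)
      have "packs (V - Q) k0"
      proof (rule Suc.IH)
        show "finite (V - Q)" using fin by simp
        show "3 * k0 + 1 \<le> card (V - Q)" using cV size k_def by linarith
        show "highly_connected (V - Q) k0"
          by (rule highly_connected_remove[OF conn2, of _ 3]) (use cV k_def in auto)
        show "heavy_cliques (V - Q) (2 * k0)"
          unfolding heavy_cliques_def
        proof (intro allI impI)
          fix C assume C: "C \<subseteq> V - Q" "C \<noteq> {}" "indep C"
          have "weight V C \<le> weight (V - Q) C + card (V - (V - Q)) + card (mixed V C \<inter> (V - (V - Q)))"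
            by (rule weight_remove) (use fin C in auto)
          moreover have "V - (V - Q) = Q" using QV by blast
          ultimately have 1: "weight V C \<le> weight (V - Q) C + 3 + card (mixed V C \<inter> Q)" using cQ by simp
          have le3: "card (mixed V C \<inter> Q) \<le> 3" using cQ card_mono[of Q "mixed V C \<inter> Q"] by simp
          have CV: "C \<subseteq> V" using C by blast
          have fm: "finite (mixed V C)" unfolding mixed_def using fin by simp
          have lem: "card (mixed V C \<inter> Q) \<le> card (mixed V C)" using fm by (intro card_mono) auto
          \<comment> \<open>Removing \<open>Q\<close> costs 3 plus the number of mixed vertices in
            it. The reserves 2, 3 and 4 cover the costs 3, 4 and at most 6, because the requirement
            itself drops by 2.\<close>
          consider "card (mixed V C \<inter> Q) = 0" | "card (mixed V C \<inter> Q) = 1" | "card (mixed V C \<inter> Q) \<ge> 2"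
            by linarith
          then show "2 * k0 \<le> weight (V - Q) C"
          proof cases
            case 1
            then show ?thesis
              using heavy_cliquesD[OF heavy2 CV C(2,3)] \<open>weight V C \<le> weight (V - Q) C + 3 + card (mixed V C \<inter> Q)\<close> k_def by linarith
          next
            case 2
            then have "mixed V C \<noteq> {}" by auto
            then show ?thesis
              using heavy3[OF CV C(2,3)] \<open>weight V C \<le> weight (V - Q) C + 3 + card (mixed V C \<inter> Q)\<close> 2 k_def by linarith
          next
            case 3
            then have "2 \<le> card (mixed V C)" using lem by linarith
            then show ?thesis
              using heavy4[OF CV C(2,3)] \<open>weight V C \<le> weight (V - Q) C + 3 + card (mixed V C \<inter> Q)\<close> le3 k_def by linarith
          qed
        qed
        show "matching T (V - Q) (N - {e})"
        proof (rule matching_sub[OF N(1)])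
          show "\<Union>(N - {e}) \<subseteq> V - Q"
            using matching_subset[OF N(1)] matching_same_edge[OF N(1)] N(3,4) unfolding Q_def by blast
        qed auto
        show "card (N - {e}) = k0 + 1"
          using N(2,3) matching_finite[OF N(1)] k_def by simp
      qed
      then have "packs V (Suc k0)" using packs_add_seagull N(5) QV unfolding Q_def by blast
      then show False using no k_def by simp
    qed
  qed
  then show ?case unfolding k_def .
qed


section \<open>Packing outside a maximum clique\<close>

definition indep_bound :: "'a set \<Rightarrow> nat \<Rightarrow> bool" where
  "indep_bound S m \<longleftrightarrow> (\<forall>I. I \<subseteq> S \<longrightarrow> indep I \<longrightarrow> card I \<le> m)"

lemma indep_boundD: "indep_bound S m \<Longrightarrow> I \<subseteq> S \<Longrightarrow> indep I \<Longrightarrow> card I \<le> m"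
  unfolding indep_bound_def by blast

lemma indep_bound_subset: "indep_bound S m \<Longrightarrow> S' \<subseteq> S \<Longrightarrow> indep_bound S' m"
  unfolding indep_bound_def by blast

lemma indep_insert:
  assumes "indep I" "\<And>x. x \<in> I \<Longrightarrow> \<not> T v x"
  shows "indep (insert v I)"
  using assms T_sym T_irrefl unfolding indep_def by blast

lemma indep_neighbourhood: "indep {x \<in> S. T v x}"
  unfolding indep_def using T_triangle T_sym by blast

text \<open>This is \<open>R(3, m + 1) \<le> (m + 2 choose 2)\<close>: the
  \<open>T\<close>-neighbourhood of a vertex is independent, and deleting it together with the
  vertex lowers the independence bound by one.\<close>

lemma ramsey_bound:
  assumes "finite S" "indep_bound S m"
  shows "2 * card S < (m + 1) * (m + 2)"
  using assms
proof (induction m arbitrary: S)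
  case 0
  have "S = {}"
  proof (rule ccontr)
    assume "S \<noteq> {}"
    then obtain v where "v \<in> S" by blast
    then have "card {v} \<le> 0" using T_irrefl by (intro indep_boundD[OF 0(2)]) (auto simp: indep_def)
    then show False by simp
  qed
  then show ?case by simp
next
  case (Suc m)
  show ?case
  proof (cases "S = {}")
    case False
    then obtain v where v: "v \<in> S" by blast
    define N where "N = {x \<in> S. T v x}"
    define S' where "S' = S - N - {v}"
    have finN: "finite N" "finite S'" unfolding N_def S'_def using Suc.prems by auto
    have cN: "card N \<le> Suc m"
      using indep_neighbourhood unfolding N_def by (intro indep_boundD[OF Suc.prems(2)]) auto
    have "indep_bound S' m"
      unfolding indep_bound_def
    proof (intro allI impI)
      fix I assume I: "I \<subseteq> S'" "indep I"
      have finI: "finite I" using I finN by (meson finite_subset)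
      have "indep (insert v I)" by (rule indep_insert) (use I in \<open>auto simp: S'_def N_def\<close>)
      then have "card (insert v I) \<le> Suc m"
        using I v unfolding S'_def by (intro indep_boundD[OF Suc.prems(2)]) auto
      moreover have "v \<notin> I" using I unfolding S'_def by auto
      ultimately show "card I \<le> m" using finI by simp
    qed
    then have "2 * card S' < (m + 1) * (m + 2)" using Suc.IH finN by blast
    moreover have "card S \<le> card S' + card (N \<union> {v})"
    proof -
      have "S = S' \<union> (N \<union> {v})" unfolding S'_def N_def using v by auto
      then show ?thesis by (metis card_Un_le)
    qed
    moreover have "card (N \<union> {v}) \<le> card N + 1" using card_Un_le[of N "{v}"] by simp
    ultimately show ?thesis using cN by (simp add: algebra_simps)
  qed simp
qed

text \<open>\<open>\<alpha> K\<close> is the independence number of the part: largest independent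
  sets of different parts unite to an independent set, so these numbers sum to at most
  \<open>z\<close>. An odd part is nonempty and thus has \<open>\<alpha> K \<ge> 1\<close>.\<close>

lemma edgeless_partition_indep:
  assumes P: "edgeless_partition T S P" and fin: "finite S" and bound: "indep_bound S z"
  shows "\<exists>\<alpha>. (\<Sum>K\<in>P. \<alpha> K) \<le> z \<and> (\<forall>K\<in>P. indep_bound K (\<alpha> K) \<and> card K mod 2 \<le> \<alpha> K)"
proof -
  have finP: "finite P" "\<And>K. K \<in> P \<Longrightarrow> finite K" using edgeless_partition_finite[OF P fin] by auto
  have UP: "\<Union>P = S" and djP: "pairwise disjnt P"
    and cross: "\<And>K L x y. K \<in> P \<Longrightarrow> L \<in> P \<Longrightarrow> K \<noteq> L \<Longrightarrow> x \<in> K \<Longrightarrow> y \<in> L \<Longrightarrow> \<not> T x y"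
    using P unfolding edgeless_partition_def by blast+
  have "\<exists>I. I \<subseteq> K \<and> indep I \<and> (\<forall>J. J \<subseteq> K \<and> indep J \<longrightarrow> card J \<le> card I)" if K: "K \<in> P" for K
  proof -
    have "\<exists>I. (I \<subseteq> K \<and> indep I) \<and> (\<forall>J. J \<subseteq> K \<and> indep J \<longrightarrow> card J \<le> card I)"
    proof (rule ex_has_greatest_nat[of "\<lambda>I. I \<subseteq> K \<and> indep I" "{}" card "card K + 1"])
      show "{} \<subseteq> K \<and> indep {}" unfolding indep_def by simp
      show "\<forall>I. I \<subseteq> K \<and> indep I \<longrightarrow> card I < card K + 1"
        using card_mono[OF finP(2)[OF K]] by (simp add: le_imp_less_Suc)
    qed
    then show ?thesis by blast
  qed
  then obtain I where I: "\<And>K. K \<in> P \<Longrightarrow> I K \<subseteq> K \<and> indep (I K) \<and> (\<forall>J. J \<subseteq> K \<and> indep J \<longrightarrow> card J \<le> card (I K))"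
    by metis
  have "card (\<Union>K\<in>P. I K) = (\<Sum>K\<in>P. card (I K))"
  proof (rule card_UN_disjoint[OF finP(1)])
    show "\<forall>K\<in>P. finite (I K)" using I finP by (meson finite_subset)
    show "\<forall>K\<in>P. \<forall>L\<in>P. K \<noteq> L \<longrightarrow> I K \<inter> I L = {}"
    proof (intro ballI impI)
      fix K L assume KL: "K \<in> P" "L \<in> P" "K \<noteq> L"
      have "K \<inter> L = {}" using djP KL unfolding pairwise_def disjnt_def by blast
      moreover have "I K \<subseteq> K" "I L \<subseteq> L" using I KL by auto
      ultimately show "I K \<inter> I L = {}" by blast
    qed
  qed
  moreover have "card (\<Union>K\<in>P. I K) \<le> z"
  proof (rule indep_boundD[OF bound])
    show "(\<Union>K\<in>P. I K) \<subseteq> S" using I UP by blast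
    show "indep (\<Union>K\<in>P. I K)"
      unfolding indep_def
    proof (intro ballI)
      fix x y assume "x \<in> (\<Union>K\<in>P. I K)" "y \<in> (\<Union>K\<in>P. I K)"
      then obtain K L where KL: "K \<in> P" "x \<in> I K" "L \<in> P" "y \<in> I L" by blast
      show "\<not> T x y"
      proof (cases "K = L")
        case True
        then show ?thesis using KL I[OF KL(1)] indepD[of "I K" x y] by simp
      next
        case False
        then show ?thesis using KL I[OF KL(1)] I[OF KL(3)] cross[of K L x y] by auto
      qed
    qed
  qed
  moreover have "indep_bound K (card (I K)) \<and> card K mod 2 \<le> card (I K)" if K: "K \<in> P" for K
  proof
    show "indep_bound K (card (I K))" using I[OF K] unfolding indep_bound_def by blast
    show "card K mod 2 \<le> card (I K)"
    proof (cases "K = {}")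
      case False
      then obtain v where "v \<in> K" by blast
      moreover have "indep {v}" using T_irrefl unfolding indep_def by simp
      ultimately have "card {v} \<le> card (I K)" using I[OF K] by (meson empty_subsetI insert_subset)
      then have "1 \<le> card (I K)" by simp
      moreover have "card K mod 2 \<le> 1" by linarith
      ultimately show ?thesis by linarith
    qed simp
  qed
  ultimately show ?thesis by (intro exI[of _ "\<lambda>K. card (I K)"]) auto
qed

text \<open>Ramsey's bound allows an odd part at most 1, 5 or 9 vertices for \<open>\<alpha>\<close>
  equal to 1, 2 or 3, and there equality holds; nonempty even parts have room to spare.\<close>

lemma small_part_bound:
  assumes "finite K" "indep_bound K \<alpha>" "card K mod 2 \<le> \<alpha>" "\<alpha> \<le> card K mod 2 + 2"
  shows "card K + 3 * (card K mod 2) \<le> 4 * \<alpha>"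
proof -
  have r: "2 * card K < (\<alpha> + 1) * (\<alpha> + 2)" by (rule ramsey_bound[OF assms(1,2)])
  have "card K mod 2 = 0 \<or> card K mod 2 = 1" by presburger
  then have "\<alpha> = 0 \<or> \<alpha> = 1 \<or> \<alpha> = 2 \<or> \<alpha> = 3" using assms(4) by linarith
  then show ?thesis using r assms(3,4) by (elim disjE) (simp_all, presburger+)
qed

text \<open>With too few matching edges, Tutte--Berge yields at least \<open>z + card Y - c\<close>
  odd parts, so the independence numbers of the parts exceed their parities by at most
  \<open>c \<le> 2\<close> in total. All parts are then small, \<open>small_part_bound\<close> gives
  \<open>card S \<le> z + 3 * c\<close>, and \<open>2 * c < k\<close> contradicts the size.\<close>

lemma large_matching:
  assumes fin: "finite S" and bound: "indep_bound S z"
    and size: "2 * k + z \<le> card S + c" and c: "c \<le> 2" "2 * c + 1 \<le> k"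
  shows "\<exists>M. matching T S M \<and> card M = k + 1"
proof -
  obtain M Y P where M: "matching T S M" "Y \<subseteq> S" "edgeless_partition T (S - Y) P"
    "card S + card Y \<le> 2 * card M + odd_parts P"
    using tutte_berge[of S T] fin T_sym by blast
  have fP: "finite P" "\<And>K. K \<in> P \<Longrightarrow> finite K" using edgeless_partition_finite[OF M(3)] fin by auto
  have "k + 1 \<le> card M"
  proof (rule ccontr)
    assume "\<not> k + 1 \<le> card M"
    then have odd: "z + card Y \<le> odd_parts P + c" using M(4) size by linarith
    obtain \<alpha> where \<alpha>: "(\<Sum>K\<in>P. \<alpha> K) \<le> z" "\<And>K. K \<in> P \<Longrightarrow> indep_bound K (\<alpha> K) \<and> card K mod 2 \<le> \<alpha> K"
      using edgeless_partition_indep[OF M(3) _ indep_bound_subset[OF bound]] fin by auto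
    have os: "odd_parts P = (\<Sum>K\<in>P. card K mod 2)" by (rule odd_parts_sum[OF fP(1)])
    have ex: "(\<Sum>K\<in>P. \<alpha> K - card K mod 2) + (\<Sum>K\<in>P. card K mod 2) = (\<Sum>K\<in>P. \<alpha> K)"
      unfolding sum.distrib[symmetric] using \<alpha>(2) by (intro sum.cong) auto
    have exc: "(\<Sum>K\<in>P. \<alpha> K - card K mod 2) \<le> c" using ex \<alpha>(1) odd os by linarith
    have "card K + 3 * (card K mod 2) \<le> 4 * \<alpha> K" if K: "K \<in> P" for K
    proof (rule small_part_bound)
      have "\<alpha> K - card K mod 2 \<le> (\<Sum>K\<in>P. \<alpha> K - card K mod 2)"
        by (rule member_le_sum[OF K]) (use fP in auto)
      then show "\<alpha> K \<le> card K mod 2 + 2" using exc c by linarith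
    qed (use \<alpha>(2)[OF K] fP(2)[OF K] in auto)
    then have "(\<Sum>K\<in>P. card K + 3 * (card K mod 2)) \<le> (\<Sum>K\<in>P. 4 * \<alpha> K)" by (rule sum_mono)
    then have "(\<Sum>K\<in>P. card K) + 3 * odd_parts P \<le> 4 * (\<Sum>K\<in>P. \<alpha> K)"
      unfolding os by (simp add: sum.distrib sum_distrib_left)
    moreover have "(\<Sum>K\<in>P. card K) = card (S - Y)"
      using edgeless_partition_sum[OF M(3), of P UNIV] fin M(3)
      unfolding edgeless_partition_def by simp
    moreover have "card S = card (S - Y) + card Y"
      using M(2) fin by (metis card_Diff_subset card_mono finite_subset le_add_diff_inverse2)
    ultimately show False using odd \<alpha>(1) size c by linarith
  qed
  then obtain M0 where "M0 \<subseteq> M" "card M0 = k + 1" using obtain_subset_with_card_n by metis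
  moreover from this have "matching T S M0"
    using M(1) matching_subset[OF M(1)] by (intro matching_sub[OF M(1)]) auto
  ultimately show ?thesis by blast
qed

text \<open>The exceptional graph with matching number two is a five-cycle with isolated vertices.\<close>

lemma two_seagulls_or_matching:
  assumes fin: "finite S" and bound: "indep_bound S z" and size: "z + 3 \<le> card S" "7 \<le> card S"
  shows "packs S 2 \<or> (\<exists>M. matching T S M \<and> card M = 3)"
proof -
  obtain M Y P where M: "matching T S M" "Y \<subseteq> S" "edgeless_partition T (S - Y) P"
    "card S + card Y \<le> 2 * card M + odd_parts P"
    using tutte_berge[of S T] fin T_sym by blast
  have fP: "finite P" "\<And>K. K \<in> P \<Longrightarrow> finite K" using edgeless_partition_finite[OF M(3)] fin by auto
  show ?thesis
  proof (cases "3 \<le> card M")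
    case True
    then obtain M0 where "M0 \<subseteq> M" "card M0 = 3" using obtain_subset_with_card_n by metis
    moreover from this have "matching T S M0"
      using M(1) matching_subset[OF M(1)] by (intro matching_sub[OF M(1)]) auto
    ultimately show ?thesis by blast
  next
    case False
    then have odd: "z + card Y \<le> odd_parts P + 1" using M(4) size by linarith
    obtain \<alpha> where \<alpha>: "(\<Sum>K\<in>P. \<alpha> K) \<le> z" "\<And>K. K \<in> P \<Longrightarrow> indep_bound K (\<alpha> K) \<and> card K mod 2 \<le> \<alpha> K"
      using edgeless_partition_indep[OF M(3) _ indep_bound_subset[OF bound]] fin by auto
    have os: "odd_parts P = (\<Sum>K\<in>P. card K mod 2)" by (rule odd_parts_sum[OF fP(1)])
    have ex: "(\<Sum>K\<in>P. \<alpha> K - card K mod 2) + (\<Sum>K\<in>P. card K mod 2) = (\<Sum>K\<in>P. \<alpha> K)"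
      unfolding sum.distrib[symmetric] using \<alpha>(2) by (intro sum.cong) auto
    have exc: "(\<Sum>K\<in>P. \<alpha> K - card K mod 2) + card Y \<le> 1" using ex \<alpha>(1) odd os by linarith
    have le1: "\<alpha> K - card K mod 2 \<le> (\<Sum>K\<in>P. \<alpha> K - card K mod 2)" if K: "K \<in> P" for K
      by (rule member_le_sum[OF K]) (use fP in auto)
    have small: "card K + 3 * (card K mod 2) \<le> 4 * \<alpha> K" if K: "K \<in> P" for K
      by (rule small_part_bound) (use \<alpha>(2)[OF K] fP(2)[OF K] le1[OF K] exc in auto)
    then have "(\<Sum>K\<in>P. card K + 3 * (card K mod 2)) \<le> (\<Sum>K\<in>P. 4 * \<alpha> K)" by (rule sum_mono)
    then have "(\<Sum>K\<in>P. card K) + 3 * odd_parts P \<le> 4 * (\<Sum>K\<in>P. \<alpha> K)"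
      unfolding os by (simp add: sum.distrib sum_distrib_left)
    moreover have "(\<Sum>K\<in>P. card K) = card (S - Y)"
      using edgeless_partition_sum[OF M(3), of P UNIV] fin M(3)
      unfolding edgeless_partition_def by simp
    moreover have "card S = card (S - Y) + card Y"
      using M(2) fin by (metis card_Diff_subset card_mono finite_subset le_add_diff_inverse2)
    ultimately have Y0: "card Y = 0" and ex1: "(\<Sum>K\<in>P. \<alpha> K - card K mod 2) = 1"
      using odd \<alpha>(1) size exc ex os by linarith+
    have YE: "Y = {}" using Y0 M(2) fin by (metis card_0_eq finite_subset)
    obtain K0 where K0: "K0 \<in> P" "\<alpha> K0 - card K0 mod 2 \<noteq> 0"
      using ex1 sum.neutral[of P "\<lambda>K. \<alpha> K - card K mod 2"] by fastforce
    have K0_1: "\<alpha> K0 = card K0 mod 2 + 1" using le1[OF K0(1)] ex1 K0(2) by linarith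
    \<comment> \<open>The whole surplus 1 sits in the part \<open>K0\<close>, which has at most five
      vertices; the other parts are singletons or empty. Hence every matching edge lies in
      \<open>K0\<close> and forms a seagull with any vertex outside it.\<close>
    have rest: "card K \<le> 1" if K: "K \<in> P" "K \<noteq> K0" for K
    proof -
      have "(\<Sum>K\<in>P. \<alpha> K - card K mod 2)
          = (\<alpha> K0 - card K0 mod 2) + (\<Sum>K\<in>P - {K0}. \<alpha> K - card K mod 2)"
        using fP K0 by (simp add: sum.remove)
      then have "(\<Sum>K\<in>P - {K0}. \<alpha> K - card K mod 2) = 0" using ex1 K0_1 by linarith
      moreover have "\<alpha> K - card K mod 2 \<le> (\<Sum>K\<in>P - {K0}. \<alpha> K - card K mod 2)"
        by (rule member_le_sum) (use fP K in auto)
      ultimately have "\<alpha> K \<le> card K mod 2" by linarith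
      then show ?thesis using small[OF K(1)] by presburger
    qed
    have cK0: "card K0 \<le> 5"
      using small[OF K0(1)] K0_1 ramsey_bound[of K0 "\<alpha> K0"] fP(2)[OF K0(1)] \<alpha>(2)[OF K0(1)]
      by (cases "card K0 mod 2 = 0") auto
    have UP: "\<Union>P = S" using M(3) YE unfolding edgeless_partition_def by simp
    have cross: "\<And>K L x y. K \<in> P \<Longrightarrow> L \<in> P \<Longrightarrow> K \<noteq> L \<Longrightarrow> x \<in> K \<Longrightarrow> y \<in> L \<Longrightarrow> \<not> T x y"
      using M(3) unfolding edgeless_partition_def by blast
    have K0S: "K0 \<subseteq> S" using UP K0 by blast
    have "2 \<le> card (S - K0)"
      using cK0 size K0S fP(2)[OF K0(1)] by (simp add: card_Diff_subset)
    then obtain U where U: "U \<subseteq> S - K0" "card U = 2" using obtain_subset_with_card_n by metis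
    then obtain u1 u2 where u: "u1 \<in> S - K0" "u2 \<in> S - K0" "u1 \<noteq> u2" by (auto simp: card_2_iff)
    have "odd_parts P + 1 \<le> z" using ex \<alpha>(1) os ex1 by linarith
    then have "2 \<le> card M" using M(4) size by linarith
    then obtain M1 where M1: "M1 \<subseteq> M" "card M1 = 2" using obtain_subset_with_card_n by metis
    then obtain e1 e2 where e: "e1 \<in> M" "e2 \<in> M" "e1 \<noteq> e2" by (auto simp: card_2_iff)
    have inK0: "e \<subseteq> K0" if e: "e \<in> M" for e
    proof -
      obtain x y where xy: "x \<noteq> y" "T x y" "e = {x, y}" using M(1) e by (rule matching_edgeE)
      have "x \<in> S" "y \<in> S" using matching_subset[OF M(1)] e xy by blast+
      then obtain K L where KL: "K \<in> P" "x \<in> K" "L \<in> P" "y \<in> L" using UP by blast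
      then have "K = L" using cross xy by blast
      then have "card {x, y} \<le> card K" using KL fP by (intro card_mono) auto
      then have "K = K0" using rest[OF KL(1)] xy by fastforce
      then show ?thesis using KL xy \<open>K = L\<close> by blast
    qed
    have sg: "seagull (insert u e)" if e: "e \<in> M" and u: "u \<in> S - K0" for e u
    proof -
      obtain x y where xy: "x \<noteq> y" "T x y" "e = {x, y}" using M(1) e by (rule matching_edgeE)
      have xyK: "x \<in> K0" "y \<in> K0" using inK0[OF e] xy by auto
      obtain L where L: "L \<in> P" "u \<in> L" using UP u by blast
      then have "L \<noteq> K0" using u by blast
      then have "\<not> T x u" "\<not> T y u" using cross[OF K0(1) L(1)] L(2) xyK by blast+
      moreover have "u \<noteq> x" "u \<noteq> y" using u xyK by blast+
      ultimately have "seagull {x, y, u}" using xy by (intro seagullI) auto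
      then show ?thesis using xy by (simp add: insert_commute)
    qed
    have dis: "insert u1 e1 \<inter> insert u2 e2 = {}"
      using matching_same_edge[OF M(1) e(1,2)] e(3) u inK0[OF e(1)] inK0[OF e(2)] by blast
    have "packs (insert u1 e1 \<union> insert u2 e2) (1 + 1)"
      by (intro packs_Un packs_seagull sg dis) (use e u in auto)
    then have "packs S (1 + 1)"
      by (rule packs_mono) (use u e inK0 K0S in blast)
    then show ?thesis by (simp add: numeral_2_eq_2)
  qed
qed

section \<open>Vertices outside a maximum clique\<close>

definition max_indep :: "'a set \<Rightarrow> 'a set \<Rightarrow> bool" where
  "max_indep V Z \<longleftrightarrow> Z \<subseteq> V \<and> indep Z \<and> indep_bound V (card Z)"

text \<open>Exchange argument: otherwise replacing the \<open>T\<close>-neighbours of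
  \<open>A\<close> in \<open>Z\<close> by \<open>A\<close> would give a larger independent
  set.\<close>

lemma max_indep_neighbours:
  assumes fin: "finite V" and Z: "max_indep V Z" and A: "A \<subseteq> V - Z" "indep A"
  shows "card A \<le> card {x \<in> Z. \<exists>a\<in>A. T a x}"
proof -
  define N where "N = {x \<in> Z. \<exists>a\<in>A. T a x}"
  have ZV: "Z \<subseteq> V" "indep Z" "indep_bound V (card Z)" using Z unfolding max_indep_def by auto
  have finZ: "finite Z" "finite A" using ZV A fin by (meson Diff_subset finite_subset)+
  have "indep (Z - N \<union> A)"
    using A ZV T_sym unfolding indep_def N_def by blast
  then have "card (Z - N \<union> A) \<le> card Z" using A ZV(1) by (intro indep_boundD[OF ZV(3)]) auto
  moreover have "card (Z - N \<union> A) = card (Z - N) + card A"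
    using A finZ by (intro card_Un_disjoint) auto
  moreover have "card Z = card (Z - N) + card N"
    using finZ unfolding N_def by (metis (no_types, lifting) card_Diff_subset card_mono finite_subset
        le_add_diff_inverse2 mem_Collect_eq subsetI)
  ultimately show ?thesis unfolding N_def by linarith
qed

text \<open>By triangle-freeness no vertex of \<open>Z\<close> has \<open>T\<close>-neighbours in
  both \<open>A\<close> and \<open>B\<close>, so the two neighbourhoods in \<open>Z\<close> are
  disjoint, and each is at least as large as its set.\<close>

lemma joined_outside_bound:
  assumes fin: "finite V" and Z: "max_indep V Z" and AB: "A \<subseteq> V - Z" "B \<subseteq> V - Z" "joined A B"
  shows "card A + card B \<le> card Z"
proof -
  define NA where "NA = {x \<in> Z. \<exists>a\<in>A. T a x}"
  define NB where "NB = {x \<in> Z. \<exists>a\<in>B. T a x}"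
  have finZ: "finite Z" using Z fin unfolding max_indep_def by (meson finite_subset)
  have "card A \<le> card NA" unfolding NA_def
    by (rule max_indep_neighbours[OF fin Z AB(1) joined_indep[OF AB(3)]])
  moreover have "card B \<le> card NB" unfolding NB_def
    by (rule max_indep_neighbours[OF fin Z AB(2) joined_indep[OF joined_sym[OF AB(3)]]])
  moreover have "NA \<inter> NB = {}"
    using AB(3) T_triangle T_sym unfolding NA_def NB_def joined_def by blast
  then have "card (NA \<union> NB) = card NA + card NB"
    using finZ unfolding NA_def NB_def by (intro card_Un_disjoint) auto
  moreover have "card (NA \<union> NB) \<le> card Z"
    using finZ unfolding NA_def NB_def by (intro card_mono) auto
  ultimately show ?thesis by linarith
qed

lemma seagull_outside:
  assumes fin: "finite V" and Z: "max_indep V Z" and W: "W \<subseteq> V - Z" and size: "card Z < card W"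
  shows "\<exists>Q\<subseteq>W. seagull Q"
proof (rule ccontr)
  assume "\<not> ?thesis"
  then consider "indep W" | A B where "joined A B" "A \<union> B = W" using seagull_free_cases by blast
  then show False
  proof cases
    case 1
    then have "card W \<le> card Z" using Z W unfolding max_indep_def by (meson Diff_subset indep_boundD subset_trans)
    then show False using size by simp
  next
    case 2
    then have "card A + card B \<le> card Z" using joined_outside_bound[OF fin Z] W by blast
    moreover have "card W \<le> card A + card B" using 2(2) card_Un_le by metis
    ultimately show False using size by linarith
  qed
qed

lemma outside_highly_connected:
  assumes fin: "finite V" and Z: "max_indep V Z" and W: "W \<subseteq> V - Z" and size: "card Z + k \<le> card W"
  shows "highly_connected W k"
  unfolding highly_connected_def
proof (intro allI impI)
  fix A B assume "A \<subseteq> W" "B \<subseteq> W" "joined A B"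
  then have "card A + card B \<le> card Z" using W by (intro joined_outside_bound[OF fin Z]) auto
  then show "card A + card B + k \<le> card W" using size by linarith
qed

text \<open>A light clique satisfies \<open>card Z - card C + card (mixed W C) < c\<close>, so its
  size is within one of that of \<open>Z\<close>. Extending it by \<open>nonadjacent W C\<close>, or
  pairing it with \<open>alladjacent W C\<close>, then shows both sets to be tiny, which leaves less
  weight than \<open>weight_card\<close> and the size assumption demand.\<close>

lemma outside_heavy_cliques:
  assumes fin: "finite V" and Z: "max_indep V Z" and W: "W \<subseteq> V - Z"
    and size: "2 * k + card Z \<le> card W + c" and c: "c \<le> 2" "2 * c \<le> k + 1"
  shows "heavy_cliques W (2 * k)"
  unfolding heavy_cliques_def
proof (intro allI impI, rule ccontr)
  fix C assume C: "C \<subseteq> W" "C \<noteq> {}" "indep C" and light: "\<not> 2 * k \<le> weight W C"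
  have ZV: "indep_bound V (card Z)" using Z unfolding max_indep_def by auto
  have finW: "finite W" using W fin by (meson Diff_subset finite_subset)
  have finC: "finite C" using C(1) finW by (meson finite_subset)
  have WV: "W \<subseteq> V" using W by blast
  define A where "A = nonadjacent W C"
  define B where "B = alladjacent W C"
  define D where "D = mixed W C"
  have fAB: "finite A" "finite B" unfolding A_def B_def nonadjacent_def alladjacent_def using finW by auto
  have wC: "weight W C + card C = card W + card D" unfolding D_def by (rule weight_card[OF finW C(1)])
  have w: "weight W C = card A + card B + 2 * card D"
    using weight_classes[OF finW C(2)] clique_classes(2)[OF C(2), of W] fAB
    unfolding A_def B_def D_def by (simp add: card_Un_disjoint)
  have Cz: "card C \<le> card Z" using C(1,3) WV by (intro indep_boundD[OF ZV]) auto
  define i where "i = card Z - card C"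
  have iD: "i + card D < c" using light wC size Cz unfolding i_def by linarith
  have B: "card B \<le> i"
  proof (cases "B = {}")
    case False
    have "joined B C" using False C(2) unfolding joined_def B_def alladjacent_def by blast
    then have "card B + card C \<le> card Z"
      using W C(1) by (intro joined_outside_bound[OF fin Z]) (auto simp: B_def alladjacent_def)
    then show ?thesis unfolding i_def by linarith
  qed simp
  have "indep_bound A i"
    unfolding indep_bound_def
  proof (intro allI impI)
    fix I assume I: "I \<subseteq> A" "indep I"
    have "indep (C \<union> I)"
      using C(3) I T_sym unfolding indep_def A_def nonadjacent_def by blast
    moreover have "C \<union> I \<subseteq> V" using C(1) I WV unfolding A_def nonadjacent_def by blast
    ultimately have "card (C \<union> I) \<le> card Z" by (intro indep_boundD[OF ZV])
    moreover have "card (C \<union> I) = card C + card I"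
      using finC finite_subset[OF I(1) fAB(1)] I(1) unfolding A_def nonadjacent_def
      by (intro card_Un_disjoint) auto
    ultimately show "card I \<le> i" unfolding i_def by linarith
  qed
  then have A: "2 * card A < (i + 1) * (i + 2)" by (rule ramsey_bound[OF fAB(1)])
  have "i = 0 \<or> i = 1" using iD c by linarith
  then show False
  proof
    assume "i = 0"
    then show False using A B iD w wC size Cz c unfolding i_def by simp
  next
    assume "i = 1"
    then show False using A B iD w wC size Cz c unfolding i_def by simp
  qed
qed

text \<open>\<open>c\<close> is the shortfall of \<open>W\<close> against
  \<open>2 * k + card Z\<close>. In the applications it is 1, and 2 only after five vertices have
  been set aside for an absorber.\<close>

lemma packs_outside:
  assumes fin: "finite V" and Z: "max_indep V Z" and W: "W \<subseteq> V - Z"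
    and size: "3 * k + 1 \<le> card W" "2 * k + card Z \<le> card W + c" and c: "c \<le> 2" "2 * c + 1 \<le> k"
  shows "packs W k"
proof -
  have finW: "finite W" using W fin by (meson Diff_subset finite_subset)
  have "indep_bound W (card Z)"
    using Z W unfolding max_indep_def by (meson Diff_subset indep_bound_subset subset_trans)
  then obtain M where M: "matching T W M" "card M = k + 1"
    using large_matching[OF finW _ size(2) c] by blast
  show ?thesis
  proof (rule seagull_packing[OF finW size(1) _ _ M])
    show "highly_connected W k" by (rule outside_highly_connected[OF fin Z W]) (use size c in linarith)
    show "heavy_cliques W (2 * k)" by (rule outside_heavy_cliques[OF fin Z W size(2)]) (use c in linarith)+
  qed
qed

text \<open>For two seagulls a shortfall \<open>c = 1\<close> is too much for
  \<open>packs_outside\<close>: the matching with three edges may fail to exist, and then the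
  packing is explicit.\<close>

lemma packs_outside_two:
  assumes fin: "finite V" and Z: "max_indep V Z" and W: "W \<subseteq> V - Z"
    and size: "7 \<le> card W" "card Z + 3 \<le> card W"
  shows "packs W 2"
proof -
  have finW: "finite W" using W fin by (meson Diff_subset finite_subset)
  have "indep_bound W (card Z)"
    using Z W unfolding max_indep_def by (meson Diff_subset indep_bound_subset subset_trans)
  then consider "packs W 2" | M where "matching T W M" "card M = 2 + 1"
    using two_seagulls_or_matching[OF finW _ size(2,1)] by auto
  then show ?thesis
  proof cases
    case 2
    show ?thesis
    proof (rule seagull_packing[OF finW _ _ _ 2])
      show "highly_connected W 2" by (rule outside_highly_connected[OF fin Z W]) (use size in linarith)
      show "heavy_cliques W (2 * 2)" by (rule outside_heavy_cliques[OF fin Z W, of _ 1]) (use size in linarith)+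
    qed (use size in simp)
  qed
qed


section \<open>Absorbers and good pairs\<close>

lemma packs_two:
  assumes "seagull Q" "seagull R" "Q \<inter> R = {}" "Q \<union> R \<subseteq> V"
  shows "packs V 2"
proof -
  have "packs (Q \<union> R) (1 + 1)" by (intro packs_Un packs_seagull assms)
  then have "packs V (1 + 1)" by (rule packs_mono[OF _ assms(4)])
  then show ?thesis by (simp add: numeral_2_eq_2)
qed

text \<open>Five vertices inducing \<open>2K\<^sub>2 + K\<^sub>1\<close> or a path form an absorber: together with any
  further vertex they split into two seagulls.\<close>

lemma absorber_2K2_K1:
  assumes d: "distinct [a, b, c, d, e, r]" and ab: "T a b" and cd: "T c d"
    and n: "\<not> T a c" "\<not> T a d" "\<not> T b c" "\<not> T b d" "\<not> T e a" "\<not> T e b" "\<not> T e c" "\<not> T e d"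
  shows "packs {a, b, c, d, e, r} 2"
proof -
  have nr: "\<not> (T r a \<and> T r b)" "\<not> (T r c \<and> T r d)" using ab cd T_triangle T_sym by blast+
  consider "\<not> T r a" "\<not> T r b" | "\<not> T r c" "\<not> T r d" | "T r a" "\<not> T r b" | "T r b" "\<not> T r a"
    using nr by blast
  then show ?thesis
  proof cases
    case 1
    show ?thesis
      by (rule packs_two[of "{a, b, r}" "{c, d, e}"])
        (use 1 d ab cd n T_sym in \<open>auto intro!: seagullI\<close>)
  next
    case 2
    show ?thesis
      by (rule packs_two[of "{c, d, r}" "{a, b, e}"])
        (use 2 d ab cd n T_sym in \<open>auto intro!: seagullI\<close>)
  next
    case 3
    show ?thesis
    proof (cases "T r e")
      case True
      show ?thesis
        by (rule packs_two[of "{r, e, b}" "{c, d, a}"])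
          (use 3 True d ab cd n T_sym in \<open>auto intro!: seagullI\<close>)
    next
      case False
      show ?thesis
        by (rule packs_two[of "{r, a, e}" "{c, d, b}"])
          (use 3 False d ab cd n T_sym in \<open>auto intro!: seagullI\<close>)
    qed
  next
    case 4
    show ?thesis
    proof (cases "T r e")
      case True
      show ?thesis
        by (rule packs_two[of "{r, e, a}" "{c, d, b}"])
          (use 4 True d ab cd n T_sym in \<open>auto intro!: seagullI\<close>)
    next
      case False
      show ?thesis
        by (rule packs_two[of "{r, b, e}" "{c, d, a}"])
          (use 4 False d ab cd n T_sym in \<open>auto intro!: seagullI\<close>)
    qed
  qed
qed

lemma absorber_P5:
  assumes d: "distinct [a, b, c, d, e, r]" and p: "T a b" "T b c" "T c d" "T d e"
    and n: "\<not> T a c" "\<not> T a d" "\<not> T a e" "\<not> T b d" "\<not> T b e" "\<not> T c e"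
  shows "packs {a, b, c, d, e, r} 2"
proof -
  have nr: "\<not> (T r a \<and> T r b)" "\<not> (T r b \<and> T r c)" "\<not> (T r c \<and> T r d)" "\<not> (T r d \<and> T r e)"
    using p T_triangle T_sym by blast+
  consider "T r b" "\<not> T r e" | "\<not> T r b" "T r e" | "T r d" "\<not> T r a" | "\<not> T r d" "T r a"
    | "T r b" "T r e" "\<not> T r c" | "\<not> T r b" "\<not> T r e" "T r c" | "\<not> T r b" "\<not> T r e" "\<not> T r c"
    using nr by blast
  then show ?thesis
  proof cases
    case 1
    show ?thesis
      by (rule packs_two[of "{r, b, e}" "{c, d, a}"]) (use 1 d p n T_sym in \<open>auto intro!: seagullI\<close>)
  next
    case 2
    show ?thesis
      by (rule packs_two[of "{r, e, b}" "{c, d, a}"]) (use 2 d p n T_sym in \<open>auto intro!: seagullI\<close>)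
  next
    case 3
    show ?thesis
      by (rule packs_two[of "{r, d, a}" "{b, c, e}"]) (use 3 d p n T_sym in \<open>auto intro!: seagullI\<close>)
  next
    case 4
    show ?thesis
      by (rule packs_two[of "{r, a, d}" "{b, c, e}"]) (use 4 d p n T_sym in \<open>auto intro!: seagullI\<close>)
  next
    case 5
    show ?thesis
      by (rule packs_two[of "{r, e, c}" "{a, b, d}"]) (use 5 d p n T_sym in \<open>auto intro!: seagullI\<close>)
  next
    case 6
    show ?thesis
      by (rule packs_two[of "{r, c, e}" "{a, b, d}"]) (use 6 d p n T_sym in \<open>auto intro!: seagullI\<close>)
  next
    case 7
    show ?thesis
      by (rule packs_two[of "{b, c, r}" "{d, e, a}"]) (use 7 d p n T_sym in \<open>auto intro!: seagullI\<close>)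
  qed
qed

definition absorber :: "'a set \<Rightarrow> 'a set \<Rightarrow> bool" where
  "absorber W Y \<longleftrightarrow> Y \<subseteq> W \<and> card Y = 5 \<and> (\<forall>r\<in>W - Y. packs (insert r Y) 2)"

text \<open>Without an absorber, \<open>T\<close> on \<open>W\<close> has no induced
  \<open>2K_2 + K_1\<close> and no induced path on five vertices. If it has an induced
  \<open>2K_2\<close>, the neighbourhoods of its four vertices cover \<open>W\<close> in two joined
  pairs of total size at most \<open>s + 1\<close> each, fewer than \<open>3 * s\<close> vertices.
  If it is \<open>2K_2\<close>-free, every edge splits \<open>W\<close> into three classes of
  exactly \<open>s\<close> vertices, and this rigidity collapses to
  \<open>s \<le> 2\<close>.\<close>

lemma absorber_exists:
  assumes fin: "finite V" and Z: "max_indep V Z" and W: "W = V - Z"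
    and s: "3 \<le> s" "card Z = s + 1" "card W = 3 * s"
  shows "\<exists>Y. absorber W Y"
proof (rule ccontr)
  assume no: "\<nexists>Y. absorber W Y"
  have finW: "finite W" using W fin by simp
  have jb: "card A + card B \<le> s + 1" if "A \<subseteq> W" "B \<subseteq> W" "joined A B" for A B
    using joined_outside_bound[OF fin Z] that s(2) unfolding W by metis
  have ib: "card I \<le> s + 1" if "I \<subseteq> W" "indep I" for I
    using that Z s(2) unfolding W max_indep_def by (metis Diff_subset indep_boundD subset_trans)
  define N where "N x = {y \<in> W. T x y}" for x
  have NW: "N x \<subseteq> W" "finite (N x)" "indep (N x)" for x
    unfolding N_def using finW indep_neighbourhood by auto
  define two where "two a b c d \<longleftrightarrow> a \<in> W \<and> b \<in> W \<and> c \<in> W \<and> d \<in> W \<and> T a b \<and> T c d \<and>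
      \<not> T a c \<and> \<not> T a d \<and> \<not> T b c \<and> \<not> T b d" for a b c d
  have hit: "T x a \<or> T x b \<or> T x c \<or> T x d" if t: "two a b c d" and x: "x \<in> W" "x \<notin> {a, b, c, d}" for a b c d x
  proof (rule ccontr)
    assume n: "\<not> (T x a \<or> T x b \<or> T x c \<or> T x d)"
    have T: "a \<in> W" "b \<in> W" "c \<in> W" "d \<in> W" "T a b" "T c d" "\<not> T a c" "\<not> T a d" "\<not> T b c" "\<not> T b d"
      using t unfolding two_def by auto
    have dis: "distinct [a, b, c, d, x]" using T T_irrefl T_sym x by auto
    have "absorber W {a, b, c, d, x}"
      unfolding absorber_def
    proof (intro conjI ballI)
      show "{a, b, c, d, x} \<subseteq> W" using T x by auto
      show "card {a, b, c, d, x} = 5" using dis distinct_card[OF dis] by simp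
      fix r assume "r \<in> W - {a, b, c, d, x}"
      then have "packs {a, b, c, d, x, r} 2"
        using dis T n by (intro absorber_2K2_K1) auto
      then show "packs (insert r {a, b, c, d, x}) 2" by (simp add: insert_commute)
    qed
    then show False using no by blast
  qed
  have path: "\<not> (T x a \<and> T x c)" if t: "two a b c d" and x: "x \<in> W" for a b c d x
  proof
    assume xa: "T x a \<and> T x c"
    have T: "a \<in> W" "b \<in> W" "c \<in> W" "d \<in> W" "T a b" "T c d" "\<not> T a c" "\<not> T a d" "\<not> T b c" "\<not> T b d"
      using t unfolding two_def by auto
    have x2: "\<not> T x b" "\<not> T x d" using xa T T_triangle T_sym by blast+
    have dis: "distinct [b, a, x, c, d]" using T T_irrefl T_sym xa x2 by auto
    have "absorber W {b, a, x, c, d}"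
      unfolding absorber_def
    proof (intro conjI ballI)
      show "{b, a, x, c, d} \<subseteq> W" using T x by auto
      show "card {b, a, x, c, d} = 5" using dis distinct_card[OF dis] by simp
      fix r assume "r \<in> W - {b, a, x, c, d}"
      then have "packs {b, a, x, c, d, r} 2"
        using dis T xa x2 T_sym by (intro absorber_P5) auto
      then show "packs (insert r {b, a, x, c, d}) 2" by (simp add: insert_commute)
    qed
    then show False using no by blast
  qed
  have two_sym: "two b a c d" "two a b d c" "two c d a b" if "two a b c d" for a b c d
    using that T_sym unfolding two_def by blast+
  show False
  proof (cases "\<exists>a b c d. two a b c d")
    case True
    \<comment> \<open>For \<open>x\<close> in \<open>N a\<close> and \<open>y\<close> in
      \<open>N b\<close>, the edges \<open>xa\<close> and \<open>cd\<close> again form an induced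
      \<open>2K_2\<close>, which \<open>y\<close> has to hit unless \<open>y = a\<close>;
      \<open>x\<close> is the only vertex of it that \<open>y\<close> can be
      \<open>T\<close>-adjacent to.\<close>
    have join: "joined (N a) (N b)" if t: "two a b c d" for a b c d
      unfolding joined_def
    proof (intro conjI ballI)
      have T: "a \<in> W" "b \<in> W" "T a b" using t unfolding two_def by auto
      show "N a \<noteq> {}" "N b \<noteq> {}" using T T_sym unfolding N_def by blast+
      fix x y assume "x \<in> N a" "y \<in> N b"
      then have x: "x \<in> W" "T x a" and y: "y \<in> W" "T y b" using T_sym unfolding N_def by auto
      have nx: "\<not> T x c" "\<not> T x d" using path[OF t x(1)] path[OF two_sym(2)[OF t] x(1)] x(2) by blast+
      have ny: "\<not> T y c" "\<not> T y d"
        using path[OF two_sym(1)[OF t] y(1)] path[OF two_sym(2)[OF two_sym(1)[OF t]] y(1)] y(2) by blast+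
      have ya: "\<not> T y a" using y T T_triangle T_sym by blast
      show "T x y"
      proof (cases "y = a")
        case True
        then show ?thesis using x by simp
      next
        case False
        have t2: "two x a c d" using t x nx unfolding two_def by auto
        have "y \<noteq> x" "y \<noteq> c" "y \<noteq> d" using ya x y t T_sym unfolding two_def by blast+
        then have "T y x \<or> T y a \<or> T y c \<or> T y d" using hit[OF t2 y(1)] False by blast
        then show ?thesis using ya ny T_sym by blast
      qed
    qed
    obtain a b c d where t: "two a b c d" using True by blast
    have "W \<subseteq> (N a \<union> N b) \<union> (N c \<union> N d)"
    proof
      fix x assume x: "x \<in> W"
      show "x \<in> (N a \<union> N b) \<union> (N c \<union> N d)"
      proof (cases "x \<in> {a, b, c, d}")
        case True
        then show ?thesis using t T_sym unfolding two_def N_def by blast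
      next
        case False
        then show ?thesis using hit[OF t x] x T_sym unfolding N_def by blast
      qed
    qed
    then have "card W \<le> card ((N a \<union> N b) \<union> (N c \<union> N d))" using NW by (intro card_mono) auto
    also have "\<dots> \<le> card (N a) + card (N b) + (card (N c) + card (N d))"
      using card_Un_le[of "N a \<union> N b" "N c \<union> N d"] card_Un_le[of "N a" "N b"] card_Un_le[of "N c" "N d"]
      by linarith
    also have "card (N a) + card (N b) \<le> s + 1" by (rule jb[OF NW(1) NW(1) join[OF t]])
    also have "card (N c) + card (N d) \<le> s + 1" by (rule jb[OF NW(1) NW(1) join[OF two_sym(3)[OF t]]])
    finally show False using s by simp
  next
    case no2: False
    have free: "T x u \<or> T x v \<or> T y u \<or> T y v"
      if "x \<in> W" "y \<in> W" "u \<in> W" "v \<in> W" "T x y" "T u v" for x y u v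
      using no2 that unfolding two_def by blast
    define R where "R a b = {x \<in> W. \<not> T a x \<and> \<not> T b x}" for a b
    have R: "R a b \<subseteq> W" "finite (R a b)" for a b unfolding R_def using finW by auto
    have Rind: "indep (R a b)" if ab: "a \<in> W" "b \<in> W" "T a b" for a b
      unfolding indep_def
    proof (intro ballI notI)
      fix x y assume "x \<in> R a b" "y \<in> R a b" "T x y"
      then show False using free[of a b x y] ab unfolding R_def by blast
    qed
    have deg_le: "card (N a) \<le> s" if ab: "a \<in> W" "b \<in> W" "T a b" for a b
    proof -
      have "joined {a} (N a)" using ab unfolding joined_def N_def by blast
      then have "card {a} + card (N a) \<le> s + 1" using ab NW by (intro jb) auto
      then show ?thesis by simp
    qed
    have R_le: "card (R a b) \<le> s" if ab: "a \<in> W" "b \<in> W" "T a b" for a b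
    proof -
      have "indep (insert a (R a b))"
        by (rule indep_insert[OF Rind[OF ab]]) (auto simp: R_def)
      then have "card (insert a (R a b)) \<le> s + 1" using ab R by (intro ib) auto
      moreover have "a \<notin> R a b" using ab T_sym unfolding R_def by blast
      ultimately show ?thesis using R by simp
    qed
    \<comment> \<open>Each of the three sets has at most \<open>s\<close> elements: a vertex and its
      neighbourhood are joined, and \<open>R a b\<close> stays independent after adding
      \<open>a\<close>. As \<open>W\<close> has \<open>3 * s\<close> vertices, all bounds are
      attained.\<close>
    have split: "W = N a \<union> N b \<union> R a b" if "T a b" for a b unfolding N_def R_def by blast
    have deg: "card (N a) = s" if ab: "a \<in> W" "b \<in> W" "T a b" for a b
    proof -
      have "card W \<le> card (N a) + card (N b) + card (R a b)"
        using arg_cong[OF split[OF ab(3)], of card] card_Un_le[of "N a \<union> N b" "R a b"] card_Un_le[of "N a" "N b"] by linarith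
      then show ?thesis
        using deg_le[OF ab] deg_le[OF ab(2,1) T_sym[OF ab(3)]] R_le[OF ab] s by linarith
    qed
    have "\<not> indep W" using ib[of W] s by auto
    then obtain a b where ab: "a \<in> W" "b \<in> W" "T a b" unfolding indep_def by blast
    have dis: "N x \<inter> N y = {}" if "T x y" for x y
      using that T_triangle T_sym unfolding N_def by blast
    have degv: "card (N y) = s" if "y \<in> N x" "x \<in> W" for x y
      using deg[of y x] that T_sym unfolding N_def by blast
    \<comment> \<open>The edges \<open>ry\<close> and \<open>bx\<close> must be linked, and the only
      possible link is \<open>yx\<close>.\<close>
    have cover: "N b - N r \<subseteq> N y"
      if ab: "a \<in> W" "b \<in> W" "T a b" and r: "r \<in> R a b" and y: "y \<in> N a" "T y r" for a b r y
    proof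
      fix x assume x: "x \<in> N b - N r"
      have "\<not> T y b" using y ab T_triangle T_sym unfolding N_def by blast
      moreover have "\<not> T r b" "\<not> T r x" "r \<in> W" "y \<in> W" "x \<in> W" "T b x" using r x y T_sym unfolding R_def N_def by blast+
      ultimately have "T y x" using free[of r y b x] y(2) ab(2) T_sym by blast
      then show "x \<in> N y" using \<open>x \<in> W\<close> unfolding N_def by blast
    qed
    \<comment> \<open>By \<open>cover\<close>, \<open>N r \<inter> N a\<close> is joined to
      \<open>r\<close> together with \<open>N b - N r\<close>; since \<open>N b\<close> has
      \<open>s\<close> elements, the bound \<open>s + 1\<close> compares the traces of
      \<open>N r\<close> on the two neighbourhoods.\<close>
    have ineq: "card (N r \<inter> N a) \<le> card (N r \<inter> N b)"
      if ab: "a \<in> W" "b \<in> W" "T a b" and r: "r \<in> R a b" and ne: "N r \<inter> N a \<noteq> {}" for a b r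
    proof -
      have "joined (N r \<inter> N a) (insert r (N b - N r))"
        unfolding joined_def
      proof (intro conjI ballI ne)
        fix y x assume y: "y \<in> N r \<inter> N a" and x: "x \<in> insert r (N b - N r)"
        have yr: "T y r" "y \<in> N a" using y T_sym unfolding N_def by auto
        show "T y x" using x cover[OF ab r yr(2,1)] yr unfolding N_def by blast
      qed simp
      moreover have "r \<in> W" using r unfolding R_def by blast
      ultimately have "card (N r \<inter> N a) + card (insert r (N b - N r)) \<le> s + 1"
        using NW by (intro jb) auto
      moreover have "r \<notin> N b - N r" using r unfolding R_def N_def by blast
      moreover have "card (N b) = card (N b - N r) + card (N r \<inter> N b)"
        using NW(2) by (metis Int_commute card_Diff_subset_Int card_mono finite_Int inf_le1 le_add_diff_inverse2)
      moreover have "card (N b) = s" using deg[OF ab(2,1) T_sym[OF ab(3)]] .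
      ultimately show ?thesis using NW(2)[of b] by simp
    qed
    have "card (N a) = s" using deg[OF ab] .
    then have "card (N a - {b}) \<noteq> 0" using s NW(2)[of a] by (simp add: card_Diff_singleton_if)
    then have "N a - {b} \<noteq> {}" by (metis card.empty)
    then obtain y where y: "y \<in> N a" "y \<noteq> b" by blast
    have yW: "y \<in> W" "T a y" using y unfolding N_def by auto
    have Nyb: "N y \<subseteq> N b \<union> R a b" using split[OF ab(3)] NW(1)[of y] dis[OF yW(2)] by blast
    have "N y \<inter> R a b \<noteq> {}"
    proof
      assume "N y \<inter> R a b = {}"
      then have "N y \<subseteq> N b" using Nyb by blast
      moreover have "card (N y) = card (N b)" using degv[OF y(1) ab(1)] deg[OF ab(2,1) T_sym[OF ab(3)]] by simp
      ultimately have eq: "N y = N b" using NW(2) by (metis card_subset_eq)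
      have "a \<in> N b" using ab T_sym unfolding N_def by blast
      then have "joined {b, y} (N b)" using eq unfolding joined_def N_def by blast
      then have "card {b, y} + card (N b) \<le> s + 1" using ab yW NW by (intro jb) auto
      then show False using y deg[OF ab(2,1) T_sym[OF ab(3)]] by simp
    qed
    then obtain r where r: "r \<in> R a b" "T y r" unfolding N_def by blast
    have rW: "r \<in> W" using r R by blast
    have Rba: "R b a = R a b" unfolding R_def by blast
    have NrS: "N r \<subseteq> N a \<union> N b"
      using split[OF ab(3)] NW(1)[of r] Rind[OF ab] r(1) unfolding indep_def N_def by blast
    have degr: "card (N r) = s" using deg[OF rW yW(1) T_sym[OF r(2)]] .
    define P1 where "P1 = N r \<inter> N a"
    define X2 where "X2 = N r \<inter> N b"
    have cPX: "card P1 + card X2 = s"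
    proof -
      have "N r = P1 \<union> X2" using NrS unfolding P1_def X2_def by blast
      moreover have "card (P1 \<union> X2) = card P1 + card X2"
        unfolding P1_def X2_def using NW dis[OF ab(3)] by (intro card_Un_disjoint) auto
      ultimately show ?thesis using degr by simp
    qed
    have yP1: "y \<in> P1" using y r yW T_sym unfolding P1_def N_def by blast
    have X2_ne: "X2 \<noteq> {}"
    proof
      assume "X2 = {}"
      then have "N r \<subseteq> N a" using NrS unfolding X2_def by blast
      then have eq: "N r = N a" using degr deg[OF ab] NW(2) by (metis card_subset_eq)
      have "joined {a, r} (N a)" using eq ab unfolding joined_def N_def by blast
      then have "card {a, r} + card (N a) \<le> s + 1" using ab rW NW by (intro jb) auto
      moreover have "a \<noteq> r" using r ab T_sym unfolding R_def by blast
      ultimately show False using deg[OF ab] by simp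
    qed
    \<comment> \<open>Applying \<open>ineq\<close> to \<open>ab\<close> and to \<open>ba\<close>
      halves \<open>N r\<close>, so \<open>s = 2 * card X2\<close>; the rest of the proof shows
      \<open>card X2 \<le> 1\<close>.\<close>
    have pq: "card P1 = card X2"
    proof (rule antisym)
      show "card P1 \<le> card X2" unfolding P1_def X2_def
        by (rule ineq[OF ab r(1)]) (use yP1 P1_def in blast)
      show "card X2 \<le> card P1" unfolding P1_def X2_def
        by (rule ineq[OF ab(2,1) T_sym[OF ab(3)]]) (use X2_ne X2_def r(1) Rba in auto)
    qed
    have inR: "X2 \<subseteq> N r'" if r': "r' \<in> R a b" "T y r'" for r'
    proof -
      have 1: "N b - N r' \<subseteq> N y" by (rule cover[OF ab r'(1) y(1) r'(2)])
      have "N y \<inter> N r = {}" using dis[OF r(2)] .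
      then show ?thesis using 1 unfolding X2_def by blast
    qed
    obtain x where x: "x \<in> X2" using X2_ne by blast
    have xb: "x \<in> N b" "T x r" using x T_sym unfolding X2_def N_def by blast+
    have inR2: "P1 \<subseteq> N r'" if r': "r' \<in> R a b" "T y r'" for r'
    proof -
      have xr': "T x r'" using inR[OF r'] x T_sym unfolding N_def by blast
      have 1: "N a - N r' \<subseteq> N x"
        by (rule cover[OF ab(2,1) T_sym[OF ab(3)] _ xb(1) xr']) (use r' Rba in simp)
      have "N x \<inter> N r = {}" using dis[OF xb(2)] .
      then show ?thesis using 1 unfolding P1_def by blast
    qed
    \<comment> \<open>Every vertex of \<open>R a b\<close> adjacent to \<open>y\<close> has all of
      \<open>N r\<close> as neighbours, so there is at most one; the other neighbours of
      \<open>y\<close> lie in \<open>N b - N r\<close>, which must then have at least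
      \<open>s - 1\<close> vertices.\<close>
    define R1 where "R1 = N y \<inter> R a b"
    have "joined R1 (N r)"
      unfolding joined_def
    proof (intro conjI ballI)
      show "R1 \<noteq> {}" using r rW unfolding R1_def N_def by blast
      show "N r \<noteq> {}" using x unfolding X2_def by blast
      fix r' v assume r': "r' \<in> R1" and v: "v \<in> N r"
      have rr: "r' \<in> R a b" "T y r'" using r' unfolding R1_def N_def by auto
      have "v \<in> P1 \<union> X2" using v NrS unfolding P1_def X2_def by blast
      then have "v \<in> N r'" using inR[OF rr] inR2[OF rr] by blast
      then show "T r' v" unfolding N_def by blast
    qed
    then have "card R1 + card (N r) \<le> s + 1" using NW R unfolding R1_def by (intro jb) auto
    then have R1_le: "card R1 \<le> 1" using degr by simp
    have "card (N y) \<le> card R1 + card (N b - N r)"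
    proof -
      have "N y \<subseteq> R1 \<union> (N b - N r)"
        using Nyb dis[OF r(2)] NW(1)[of y] unfolding R1_def by blast
      then have "card (N y) \<le> card (R1 \<union> (N b - N r))"
        using NW R unfolding R1_def by (intro card_mono) auto
      then show ?thesis using card_Un_le[of R1 "N b - N r"] by linarith
    qed
    moreover have "card (N b) = card (N b - N r) + card X2"
      unfolding X2_def
      using NW(2) by (metis Int_commute card_Diff_subset_Int card_mono finite_Int inf_le1 le_add_diff_inverse2)
    ultimately have "card X2 \<le> 1"
      using R1_le degv[OF y(1) ab(1)] deg[OF ab(2,1) T_sym[OF ab(3)]] by linarith
    then show False using cPX pq s by linarith
  qed
qed

text \<open>If no such pair exists, any two vertices outside \<open>Z\<close> without a
  \<open>T\<close>-edge have a common \<open>T\<close>-neighbour in \<open>Z\<close>, and this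
  forces three \<open>T\<close>-neighbours in \<open>Z\<close> for every outside vertex. Counting
  the \<open>T\<close>-edges at \<open>Z\<close>, whose vertices have degree at most
  \<open>z\<close>, gives \<open>3 * (3 * z - 3) \<le> z * z\<close>. This is false for
  \<open>z\<close> from 3 to 7 and true for 8, whence the upper limit.\<close>

lemma good_pair_exists:
  assumes fin: "finite V" and z: "3 \<le> z" "z \<le> 7" and size: "card V + 3 = 4 * z"
    and Z0: "max_indep V Z0" "card Z0 = z"
  shows "\<exists>Z r r'. max_indep V Z \<and> card Z = z \<and> r \<in> V - Z \<and> r' \<in> V - Z \<and> r \<noteq> r' \<and> \<not> T r r' \<and>
     (\<forall>x\<in>Z. \<not> (T r x \<and> T r' x))"
proof (rule ccontr)
  assume none: "\<not> ?thesis"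
  have common: "\<exists>x\<in>Z. T r x \<and> T r' x"
    if "max_indep V Z" "card Z = z" "r \<in> V - Z" "r' \<in> V - Z" "r \<noteq> r'" "\<not> T r r'" for Z r r'
    using none that by blast
  have bnd: "indep_bound V z" using Z0 unfolding max_indep_def by auto
  have nb: "card {y \<in> V. T x y} \<le> z" for x
    by (rule indep_boundD[OF bnd _ indep_neighbourhood]) auto
  define \<rho> where "\<rho> Z w = {x \<in> Z. T w x}" for Z w
  \<comment> \<open>Each outside vertex other than \<open>w\<close> is a \<open>T\<close>-neighbour
    of \<open>w\<close> or of some vertex of \<open>\<rho> Z w\<close>; the neighbourhood of
    \<open>w\<close>, which includes \<open>\<rho> Z w\<close>, has at most \<open>z\<close>
    vertices.\<close>
  have cover: "3 * z + card (\<rho> Z w) \<le> z + 4 + card ((\<Union>x\<in>\<rho> Z w. {y \<in> V - Z. T x y}) - {w})"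
    if Z: "max_indep V Z" "card Z = z" and w: "w \<in> V - Z" for Z w
  proof -
    define U where "U = (\<Union>x\<in>\<rho> Z w. {y \<in> V - Z. T x y}) - {w}"
    define L where "L = {y \<in> V - Z. T w y}"
    have ZV: "Z \<subseteq> V" using Z unfolding max_indep_def by auto
    have finZ: "finite Z" using ZV fin by (meson finite_subset)
    have finUL: "finite U" "finite L" "finite (\<rho> Z w)"
      unfolding U_def L_def \<rho>_def using fin finZ by auto
    have "V - Z - {w} \<subseteq> L \<union> U"
    proof
      fix y assume y: "y \<in> V - Z - {w}"
      show "y \<in> L \<union> U"
      proof (cases "T w y")
        case False
        then obtain x where "x \<in> Z" "T w x" "T y x" using common[OF Z w, of y] y by blast
        then have "x \<in> \<rho> Z w" "T x y" using T_sym unfolding \<rho>_def by auto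
        then show ?thesis using y unfolding U_def by blast
      qed (use y L_def in blast)
    qed
    then have "card (V - Z - {w}) \<le> card L + card U"
      using finUL card_mono[of "L \<union> U"] card_Un_le[of L U] by (meson finite_UnI order_trans)
    moreover have "card (V - Z - {w}) + 4 = 3 * z"
    proof -
      have "card (V - Z) + card Z = card V"
        using ZV finZ fin by (metis card_Diff_subset card_mono le_add_diff_inverse2)
      moreover have "card (V - Z - {w}) + 1 = card (V - Z)"
        using w fin by (metis Suc_eq_plus1 card.remove finite_Diff)
      ultimately show ?thesis using Z(2) size by linarith
    qed
    moreover have "card L + card (\<rho> Z w) \<le> z"
    proof -
      have "card (L \<union> \<rho> Z w) = card L + card (\<rho> Z w)"
        using finUL unfolding L_def \<rho>_def by (intro card_Un_disjoint) auto
      moreover have "L \<union> \<rho> Z w \<subseteq> {y \<in> V. T w y}" using ZV unfolding L_def \<rho>_def by blast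
      then have "card (L \<union> \<rho> Z w) \<le> card {y \<in> V. T w y}" using fin by (intro card_mono) auto
      ultimately show ?thesis using nb[of w] by linarith
    qed
    ultimately show ?thesis unfolding U_def by linarith
  qed
  have two: "2 \<le> card (\<rho> Z w)" if Z: "max_indep V Z" "card Z = z" and w: "w \<in> V - Z" for Z w
  proof (rule ccontr)
    assume "\<not> 2 \<le> card (\<rho> Z w)"
    then have c: "card (\<rho> Z w) = 0 \<or> card (\<rho> Z w) = 1" by linarith
    have finZ: "finite Z" using Z(1) fin unfolding max_indep_def by (meson finite_subset)
    then have fr: "finite (\<rho> Z w)" unfolding \<rho>_def by simp
    have "card ((\<Union>x\<in>\<rho> Z w. {y \<in> V - Z. T x y}) - {w}) + 2 \<le> z + card (\<rho> Z w)"
    proof (cases "card (\<rho> Z w) = 0")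
      case True
      then have "\<rho> Z w = {}" using fr by simp
      then show ?thesis using z by simp
    next
      case False
      then obtain x where x: "\<rho> Z w = {x}" using c card_1_singletonE by metis
      then have "T x w" using T_sym unfolding \<rho>_def by blast
      then have w': "w \<in> {y \<in> V - Z. T x y}" using w by blast
      have "(\<Union>x\<in>\<rho> Z w. {y \<in> V - Z. T x y}) - {w} = {y \<in> V - Z. T x y} - {w}" using x by simp
      moreover have "card ({y \<in> V - Z. T x y} - {w}) + 1 = card {y \<in> V - Z. T x y}"
        using w' fin by (metis (no_types, lifting) Suc_eq_plus1 card.remove finite_Diff finite_subset mem_Collect_eq subsetI)
      moreover have "card {y \<in> V - Z. T x y} \<le> card {y \<in> V. T x y}" using fin by (intro card_mono) auto
      ultimately show ?thesis using nb[of x] x by simp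
    qed
    then show False using cover[OF Z w] c z by linarith
  qed
  have three: "3 \<le> card (\<rho> Z w)" if Z: "max_indep V Z" "card Z = z" and w: "w \<in> V - Z" for Z w
  proof (rule ccontr)
    assume "\<not> 3 \<le> card (\<rho> Z w)"
    then have c2: "card (\<rho> Z w) = 2" using two[OF that] by linarith
    then obtain x1 x2 where x: "\<rho> Z w = {x1, x2}" "x1 \<noteq> x2" by (auto simp: card_2_iff)
    have ZV: "Z \<subseteq> V" "indep Z" using Z unfolding max_indep_def by auto
    have xZ: "x1 \<in> Z" "x2 \<in> Z" "T w x1" "T w x2" using x unfolding \<rho>_def by auto
    define C1 where "C1 = {y \<in> V. T x1 y}"
    define C2 where "C2 = {y \<in> V. T x2 y}"
    have CZ: "C1 \<subseteq> V - Z" "C2 \<subseteq> V - Z" using xZ ZV unfolding C1_def C2_def indep_def by blast+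
    have fC: "finite C1" "finite C2" unfolding C1_def C2_def using fin by auto
    have wC: "w \<in> C1" "w \<in> C2" using xZ w T_sym unfolding C1_def C2_def by auto
    have "(\<Union>x\<in>\<rho> Z w. {y \<in> V - Z. T x y}) - {w} = C1 \<union> C2 - {w}"
      using CZ unfolding x(1) C1_def C2_def by blast
    then have "2 * z \<le> 2 + card (C1 \<union> C2 - {w})" using cover[OF Z w] c2 by simp
    moreover have "card (C1 \<union> C2 - {w}) + 1 = card (C1 \<union> C2)"
      using wC fC by (metis Suc_eq_plus1 UnI1 card.remove finite_UnI)
    moreover have "card C1 + card C2 = card (C1 \<union> C2) + card (C1 \<inter> C2)"
      using fC by (rule card_Un_Int)
    moreover have "card C1 \<le> z" "card C2 \<le> z" using nb unfolding C1_def C2_def by auto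
    moreover have "1 \<le> card (C1 \<inter> C2)"
      using wC fC card_mono[of "C1 \<inter> C2" "{w}"] by simp
    ultimately have c1: "card C1 = z" "card (C1 \<inter> C2) = 1" by linarith+
    \<comment> \<open>Equality makes the neighbourhood \<open>C1\<close> of \<open>x1\<close>
      another maximum independent set, in which \<open>x2\<close> has only the neighbour
      \<open>w\<close>, against \<open>two\<close>. This is why \<open>two\<close> is proved for all
      such sets and not just for \<open>Z0\<close>.\<close>
    have mC1: "max_indep V C1"
      using bnd c1(1) indep_neighbourhood unfolding max_indep_def C1_def by auto
    have "x2 \<in> V - C1" using xZ ZV CZ by blast
    then have "2 \<le> card (\<rho> C1 x2)" by (rule two[OF mC1 c1(1)])
    moreover have "\<rho> C1 x2 = C1 \<inter> C2" unfolding \<rho>_def C1_def C2_def by blast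
    ultimately show False using c1 by simp
  qed
  have ZV: "Z0 \<subseteq> V" using Z0 unfolding max_indep_def by auto
  have finZ: "finite Z0" using ZV fin by (meson finite_subset)
  have cW: "card (V - Z0) + 3 = 3 * z"
    using ZV finZ fin Z0(2) size card_mono[OF fin ZV] by (simp add: card_Diff_subset)
  have "3 * card (V - Z0) = (\<Sum>w\<in>V - Z0. 3)" by simp
  also have "\<dots> \<le> (\<Sum>w\<in>V - Z0. card (\<rho> Z0 w))" by (rule sum_mono) (use three[OF Z0] in simp)
  also have "\<dots> = (\<Sum>w\<in>V - Z0. \<Sum>x\<in>Z0. if T w x then 1 else 0)"
    unfolding \<rho>_def using finZ by (intro sum.cong) (simp_all add: sum.inter_filter[symmetric])
  also have "\<dots> = (\<Sum>x\<in>Z0. \<Sum>w\<in>V - Z0. if T w x then 1 else 0)" by (rule sum.swap)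
  also have "\<dots> \<le> (\<Sum>x\<in>Z0. z)"
  proof (rule sum_mono)
    fix x
    have "(\<Sum>w\<in>V - Z0. if T w x then 1 else 0) = card {w \<in> V - Z0. T w x}"
      using fin by (simp add: sum.inter_filter[symmetric])
    also have "\<dots> \<le> card {y \<in> V. T x y}" using fin T_sym by (intro card_mono) auto
    finally show "(\<Sum>w\<in>V - Z0. if T w x then 1 else 0) \<le> z" using nb[of x] by simp
  qed
  finally have "3 * card (V - Z0) \<le> z * z" using Z0(2) by simp
  then have "9 * z \<le> z * z + 9" using cW by linarith
  moreover have "z = 3 \<or> z = 4 \<or> z = 5 \<or> z = 6 \<or> z = 7" using z by linarith
  ultimately show False by auto
qed


section \<open>Complete minors from seagulls\<close>

text \<open>Each shape is connected in \<open>G\<close> through one vertex adjacent to all others.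
  The two-vertex shape serves for the dominating pair.\<close>

definition branch_set :: "'a set \<Rightarrow> bool" where
  "branch_set X \<longleftrightarrow> (\<exists>x. X = {x}) \<or> (\<exists>x y. x \<noteq> y \<and> \<not> T x y \<and> X = {x, y}) \<or> seagull X"

definition clique_model :: "'a set \<Rightarrow> nat \<Rightarrow> bool" where
  "clique_model V m \<longleftrightarrow> (\<exists>F. finite F \<and> card F = m \<and> pairwise disjnt F \<and>
     (\<forall>X\<in>F. X \<subseteq> V \<and> branch_set X) \<and> (\<forall>X\<in>F. \<forall>Y\<in>F. X \<noteq> Y \<longrightarrow> (\<exists>x\<in>X. \<exists>y\<in>Y. \<not> T x y)))"

lemma branch_set_nonempty: "branch_set X \<Longrightarrow> X \<noteq> {}"
  unfolding branch_set_def using seagull_nonempty by blast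

lemma clique_model_mono: "clique_model V m \<Longrightarrow> V \<subseteq> V' \<Longrightarrow> clique_model V' m"
  unfolding clique_model_def by (elim exE) (metis subset_trans)

lemma clique_model_Un:
  assumes F: "finite F" "pairwise disjnt F" "\<forall>X\<in>F. X \<subseteq> V \<and> branch_set X"
      "\<forall>X\<in>F. \<forall>Y\<in>F. X \<noteq> Y \<longrightarrow> (\<exists>x\<in>X. \<exists>y\<in>Y. \<not> T x y)"
    and F': "finite F'" "pairwise disjnt F'" "\<forall>X\<in>F'. X \<subseteq> V' \<and> branch_set X"
      "\<forall>X\<in>F'. \<forall>Y\<in>F'. X \<noteq> Y \<longrightarrow> (\<exists>x\<in>X. \<exists>y\<in>Y. \<not> T x y)"
    and dis: "V \<inter> V' = {}"
    and cross: "\<And>X Y. X \<in> F \<Longrightarrow> Y \<in> F' \<Longrightarrow> \<exists>x\<in>X. \<exists>y\<in>Y. \<not> T x y"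
  shows "clique_model (V \<union> V') (card F + card F')"
proof -
  have dj: "X \<inter> Y = {}" if "X \<in> F" "Y \<in> F'" for X Y
    using that F(3) F'(3) dis by blast
  have "F \<inter> F' = {}"
  proof (rule ccontr)
    assume "F \<inter> F' \<noteq> {}"
    then obtain Q where Q: "Q \<in> F" "Q \<in> F'" by blast
    then show False using dj[of Q Q] F(3) branch_set_nonempty by auto
  qed
  then have c: "card (F \<union> F') = card F + card F'" using F(1) F'(1) by (simp add: card_Un_disjoint)
  have four: "(K \<in> F \<and> L \<in> F) \<or> (K \<in> F' \<and> L \<in> F') \<or> (K \<in> F \<and> L \<in> F') \<or> (L \<in> F \<and> K \<in> F')"
    if "K \<in> F \<union> F'" "L \<in> F \<union> F'" for K L using that by blast
  have "pairwise disjnt (F \<union> F')"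
    unfolding pairwise_def disjnt_def
  proof (intro ballI impI)
    fix K L assume KL: "K \<in> F \<union> F'" "L \<in> F \<union> F'" "K \<noteq> L"
    from four[OF KL(1,2)] show "K \<inter> L = {}"
    proof (elim disjE conjE)
      assume "L \<in> F" "K \<in> F'"
      then show ?thesis using dj by (metis Int_commute)
    qed (use F(2) F'(2) dj KL(3) in \<open>simp_all add: pairwise_def disjnt_def\<close>)
  qed
  moreover have "\<forall>X\<in>F \<union> F'. \<forall>Y\<in>F \<union> F'. X \<noteq> Y \<longrightarrow> (\<exists>x\<in>X. \<exists>y\<in>Y. \<not> T x y)"
  proof (intro ballI impI)
    fix K L assume KL: "K \<in> F \<union> F'" "L \<in> F \<union> F'" "K \<noteq> L"
    from four[OF KL(1,2)] show "\<exists>x\<in>K. \<exists>y\<in>L. \<not> T x y"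
    proof (elim disjE conjE)
      assume "L \<in> F" "K \<in> F'"
      then show ?thesis using cross[of L K] T_sym by blast
    qed (use F(4) F'(4) cross KL(3) in blast)+
  qed
  moreover have "\<forall>X\<in>F \<union> F'. X \<subseteq> V \<union> V' \<and> branch_set X" using F(3) F'(3) by blast
  ultimately show ?thesis unfolding clique_model_def using F(1) F'(1) c
    by (intro exI[of _ "F \<union> F'"]) auto
qed

lemma clique_model_join:
  assumes "clique_model V m" "clique_model V' m'" "V \<inter> V' = {}"
    and "\<And>x y. x \<in> V \<Longrightarrow> y \<in> V' \<Longrightarrow> \<not> T x y"
  shows "clique_model (V \<union> V') (m + m')"
proof -
  obtain F where F: "finite F" "pairwise disjnt F" "\<forall>X\<in>F. X \<subseteq> V \<and> branch_set X"
      "\<forall>X\<in>F. \<forall>Y\<in>F. X \<noteq> Y \<longrightarrow> (\<exists>x\<in>X. \<exists>y\<in>Y. \<not> T x y)" and m: "card F = m"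
    using assms(1) unfolding clique_model_def by blast
  obtain F' where F': "finite F'" "pairwise disjnt F'" "\<forall>X\<in>F'. X \<subseteq> V' \<and> branch_set X"
      "\<forall>X\<in>F'. \<forall>Y\<in>F'. X \<noteq> Y \<longrightarrow> (\<exists>x\<in>X. \<exists>y\<in>Y. \<not> T x y)" and m': "card F' = m'"
    using assms(2) unfolding clique_model_def by blast
  have "clique_model (V \<union> V') (card F + card F')"
  proof (rule clique_model_Un[OF F F' assms(3)])
    fix X Y assume XY: "X \<in> F" "Y \<in> F'"
    have "X \<noteq> {}" "Y \<noteq> {}" "X \<subseteq> V" "Y \<subseteq> V'" using F(3) F'(3) XY branch_set_nonempty by auto
    then show "\<exists>x\<in>X. \<exists>y\<in>Y. \<not> T x y" using assms(4) by blast
  qed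
  then show ?thesis using m m' by simp
qed

lemma seagull_dominates: "seagull Q \<Longrightarrow> \<exists>q\<in>Q. \<not> T v q"
  unfolding seagull_def using T_triangle T_sym by blast

lemma clique_model_packs:
  assumes "clique_model V m" "packs W k" "V \<inter> W = {}"
  shows "clique_model (V \<union> W) (m + k)"
proof -
  obtain F where F: "finite F" "pairwise disjnt F" "\<forall>X\<in>F. X \<subseteq> V \<and> branch_set X"
      "\<forall>X\<in>F. \<forall>Y\<in>F. X \<noteq> Y \<longrightarrow> (\<exists>x\<in>X. \<exists>y\<in>Y. \<not> T x y)" and m: "card F = m"
    using assms(1) unfolding clique_model_def by blast
  obtain F' where F': "finite F'" "card F' = k" "pairwise disjnt F'" "\<forall>Q\<in>F'. seagull Q \<and> Q \<subseteq> W"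
    using assms(2) unfolding packs_def by blast
  have "clique_model (V \<union> W) (card F + card F')"
  proof (rule clique_model_Un[OF F F'(1,3) _ _ assms(3)])
    show "\<forall>X\<in>F'. X \<subseteq> W \<and> branch_set X" using F'(4) unfolding branch_set_def by blast
    show "\<forall>X\<in>F'. \<forall>Y\<in>F'. X \<noteq> Y \<longrightarrow> (\<exists>x\<in>X. \<exists>y\<in>Y. \<not> T x y)"
    proof (intro ballI impI)
      fix X Y assume "X \<in> F'" "Y \<in> F'"
      then have "seagull X" "seagull Y" using F'(4) by auto
      then show "\<exists>x\<in>X. \<exists>y\<in>Y. \<not> T x y" using seagull_dominates seagull_nonempty by blast
    qed
    fix X Y assume "X \<in> F" "Y \<in> F'"
    then have "X \<noteq> {}" "seagull Y" using F(3) F'(4) branch_set_nonempty by auto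
    then show "\<exists>x\<in>X. \<exists>y\<in>Y. \<not> T x y" using seagull_dominates by blast
  qed
  then show ?thesis using m F'(2) by simp
qed

lemma clique_model_indep:
  assumes "finite Z" "indep Z"
  shows "clique_model Z (card Z)"
proof -
  have "card ((\<lambda>x. {x}) ` Z) = card Z" by (intro card_image) (auto simp: inj_on_def)
  moreover have "pairwise disjnt ((\<lambda>x. {x}) ` Z)" by (auto simp: pairwise_def disjnt_def)
  ultimately show ?thesis unfolding clique_model_def
    using assms unfolding indep_def branch_set_def by (intro exI[of _ "(\<lambda>x. {x}) ` Z"]) auto
qed

lemma clique_model_indep_pair:
  assumes Z: "finite Z" "indep Z" and r: "r \<notin> Z" "r' \<notin> Z" "r \<noteq> r'" "\<not> T r r'"
    and good: "\<forall>x\<in>Z. \<not> (T r x \<and> T r' x)"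
  shows "clique_model (Z \<union> {r, r'}) (card Z + 1)"
proof -
  have c: "card ((\<lambda>x. {x}) ` Z) = card Z" by (intro card_image) (auto simp: inj_on_def)
  have "clique_model (Z \<union> {r, r'}) (card ((\<lambda>x. {x}) ` Z) + card {{r, r'}})"
  proof (rule clique_model_Un)
    show "pairwise disjnt ((\<lambda>x. {x}) ` Z)" by (auto simp: pairwise_def disjnt_def)
    show "\<forall>X\<in>(\<lambda>x. {x}) ` Z. \<forall>Y\<in>(\<lambda>x. {x}) ` Z. X \<noteq> Y \<longrightarrow> (\<exists>x\<in>X. \<exists>y\<in>Y. \<not> T x y)"
      using Z(2) unfolding indep_def by auto
    show "\<forall>X\<in>{{r, r'}}. X \<subseteq> {r, r'} \<and> branch_set X" using r unfolding branch_set_def by auto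
    fix X Y assume "X \<in> (\<lambda>x. {x}) ` Z" "Y \<in> {{r, r'}}"
    then show "\<exists>x\<in>X. \<exists>y\<in>Y. \<not> T x y" using good T_sym by blast
  qed (use Z r in \<open>auto simp: branch_set_def\<close>)
  then show ?thesis using c by simp
qed

lemma max_indep_exists:
  assumes "finite V"
  shows "\<exists>Z. max_indep V Z"
proof -
  have "\<exists>Z. (Z \<subseteq> V \<and> indep Z) \<and> (\<forall>I. I \<subseteq> V \<and> indep I \<longrightarrow> card I \<le> card Z)"
  proof (rule ex_has_greatest_nat[of "\<lambda>I. I \<subseteq> V \<and> indep I" "{}" card "card V + 1"])
    show "{} \<subseteq> V \<and> indep {}" unfolding indep_def by simp
    show "\<forall>I. I \<subseteq> V \<and> indep I \<longrightarrow> card I < card V + 1"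
      using card_mono[OF assms] by (simp add: le_imp_less_Suc)
  qed
  then show ?thesis unfolding max_indep_def indep_bound_def by blast
qed

lemma clique_model_odd:
  assumes fin: "finite V" and size: "card V + 1 = 2 * h" and Z: "max_indep V Z"
    and large: "h + 1 \<le> 2 * card Z"
  shows "clique_model V h"
proof (cases "h \<le> card Z")
  case True
  then obtain Z' where Z': "Z' \<subseteq> Z" "card Z' = h" using obtain_subset_with_card_n by metis
  have ZV: "Z \<subseteq> V" "indep Z" using Z unfolding max_indep_def by auto
  have "clique_model Z' (card Z')"
    using Z' ZV fin indep_subset by (intro clique_model_indep) (auto intro: finite_subset)
  then show ?thesis using Z' ZV clique_model_mono by blast
next
  case False
  define z where "z = card Z"
  define s where "s = h - z"
  have s: "1 \<le> s" "h = z + s" "s + 1 \<le> z" using False large unfolding s_def z_def by auto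
  have ZV: "Z \<subseteq> V" "indep Z" using Z unfolding max_indep_def by auto
  have finZ: "finite Z" using ZV fin by (meson finite_subset)
  have cW: "card (V - Z) + 1 = 2 * s + z"
    using ZV finZ size s(2) card_mono[OF fin ZV(1)] unfolding z_def by (simp add: card_Diff_subset)
  have finish: "clique_model V h" if "packs (V - Z) s"
  proof -
    have "clique_model (Z \<union> (V - Z)) (card Z + s)"
      by (rule clique_model_packs[OF clique_model_indep[OF finZ ZV(2)] that]) auto
    moreover have "Z \<union> (V - Z) = V" using ZV by blast
    ultimately show ?thesis using s(2) z_def by simp
  qed
  \<comment> \<open>\<open>V - Z\<close> has \<open>3 * s + 1\<close> vertices iff
    \<open>s + 2 \<le> z\<close>. For \<open>z = s + 1\<close> the two repairs meet exactly:
    \<open>good_pair_exists\<close> needs \<open>z \<le> 7\<close>, and packing \<open>s - 2\<close>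
    seagulls next to an absorber, with shortfall \<open>c = 2\<close>, needs
    \<open>s - 2 \<ge> 5\<close>.\<close>
  consider "s = 1" | "s = 2" "s + 2 \<le> z" | "3 \<le> s" "s + 2 \<le> z" | "2 \<le> s" "s \<le> 6" "z = s + 1"
    | "7 \<le> s" "z = s + 1" using s by linarith
  then show ?thesis
  proof cases
    case 1
    then obtain Q where Q: "Q \<subseteq> V - Z" "seagull Q"
      using seagull_outside[OF fin Z subset_refl] cW z_def by auto
    have "packs (V - Z) (Suc 0)" using packs_add_seagull[OF Q(2,1) packs_0] .
    then show ?thesis using finish 1 by simp
  next
    case 2
    have "packs (V - Z) 2"
      by (rule packs_outside_two[OF fin Z subset_refl]) (use 2 cW z_def in linarith)+
    then show ?thesis using finish 2 by simp
  next
    case 3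
    have "packs (V - Z) s"
      by (rule packs_outside[OF fin Z subset_refl, of s 1]) (use 3 cW z_def in linarith)+
    then show ?thesis by (rule finish)
  next
    case 4
    have "\<exists>Z r r'. max_indep V Z \<and> card Z = z \<and> r \<in> V - Z \<and> r' \<in> V - Z \<and> r \<noteq> r' \<and> \<not> T r r' \<and>
        (\<forall>x\<in>Z. \<not> (T r x \<and> T r' x))"
      by (rule good_pair_exists[OF fin _ _ _ Z]) (use 4 s size z_def in linarith)+
    then obtain Z' r r' where Z': "max_indep V Z'" "card Z' = z" and r: "r \<in> V - Z'" "r' \<in> V - Z'"
        "r \<noteq> r'" "\<not> T r r'" "\<forall>x\<in>Z'. \<not> (T r x \<and> T r' x)" by blast
    have ZV': "Z' \<subseteq> V" "indep Z'" using Z' unfolding max_indep_def by auto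
    have finZ': "finite Z'" using ZV' fin by (meson finite_subset)
    \<comment> \<open>The pair counts as a branch set, so only \<open>s - 1\<close> seagulls are
      needed, and \<open>3 * s - 2 = 3 * (s - 1) + 1\<close> vertices are left for them.\<close>
    define W where "W = V - Z' - {r, r'}"
    have W: "W \<subseteq> V - Z'" unfolding W_def by blast
    have cV: "card (V - Z') + 1 = 2 * s + z"
      using ZV' finZ' size s(2) Z'(2) card_mono[OF fin ZV'(1)] by (simp add: card_Diff_subset)
    have cW': "card W + 2 = 3 * s"
    proof -
      have "card W = card (V - Z') - card {r, r'}"
        unfolding W_def using r by (intro card_Diff_subset) auto
      then show ?thesis using cV r(3) 4 by simp
    qed
    have "packs W (s - 1)"
    proof -
      consider "s = 2" | "s = 3" | "4 \<le> s" using 4 by linarith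
      then show ?thesis
      proof cases
        case 1
        then obtain Q where Q: "Q \<subseteq> W" "seagull Q"
          using seagull_outside[OF fin Z'(1) W] cW' Z'(2) 4 by auto
        have "packs W (Suc 0)" using packs_add_seagull[OF Q(2,1) packs_0] .
        then show ?thesis using 1 by simp
      next
        case 2
        have "packs W 2"
          by (rule packs_outside_two[OF fin Z'(1) W]) (use 2 cW' Z'(2) 4 in linarith)+
        then show ?thesis using 2 by simp
      next
        case 3
        show ?thesis
          by (rule packs_outside[OF fin Z'(1) W, of _ 1]) (use 3 cW' Z'(2) 4 in linarith)+
      qed
    qed
    moreover have "clique_model (Z' \<union> {r, r'}) (card Z' + 1)"
      by (rule clique_model_indep_pair[OF finZ' ZV'(2)]) (use r in auto)
    moreover have "(Z' \<union> {r, r'}) \<inter> W = {}" unfolding W_def by blast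
    ultimately have "clique_model (Z' \<union> {r, r'} \<union> W) (card Z' + 1 + (s - 1))"
      using clique_model_packs by blast
    moreover have "Z' \<union> {r, r'} \<union> W \<subseteq> V" using ZV' r unfolding W_def by blast
    moreover have "card Z' + 1 + (s - 1) = h" using Z'(2) s by simp
    ultimately show ?thesis using clique_model_mono by metis
  next
    case 5
    define W where "W = V - Z"
    have cW3: "card W = 3 * s" using cW 5 unfolding W_def by linarith
    have "\<exists>Y. absorber W Y"
      by (rule absorber_exists[OF fin Z W_def _ _ cW3]) (use 5 z_def in auto)
    then obtain Y where Y: "Y \<subseteq> W" "card Y = 5" "\<And>r. r \<in> W - Y \<Longrightarrow> packs (insert r Y) 2"
      unfolding absorber_def by blast
    have finW: "finite W" unfolding W_def using fin by simp
    have cWY: "card (W - Y) + 5 = 3 * s"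
      using Y cW3 card_mono[OF finW Y(1)] finite_subset[OF Y(1) finW] by (simp add: card_Diff_subset)
    have "packs (W - Y) (s - 2)"
      by (rule packs_outside[OF fin Z, of _ _ 2]) (use 5 cWY z_def W_def in auto)
    then obtain F where F: "finite F" "card F = s - 2" "pairwise disjnt F" "\<forall>Q\<in>F. seagull Q \<and> Q \<subseteq> W - Y"
      unfolding packs_def by blast
    have "card (\<Union>F) = (\<Sum>Q\<in>F. card Q)"
      using F seagull_card by (intro card_Union_disjoint) auto
    also have "\<dots> = (\<Sum>Q\<in>F. 3)" using F(4) seagull_card by (intro sum.cong) auto
    finally have cF: "card (\<Union>F) = 3 * (s - 2)" using F(2) by simp
    have FW: "\<Union>F \<subseteq> W - Y" using F(4) by blast
    \<comment> \<open>\<open>W - Y\<close> has \<open>3 * (s - 2) + 1\<close> vertices, so one is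
      left over; together with \<open>Y\<close> it supplies the last two seagulls.\<close>
    have "\<Union>F \<noteq> W - Y" using cF cWY 5 by auto
    then obtain r where r: "r \<in> W - Y" "r \<notin> \<Union>F" using FW by blast
    have "packs (\<Union>F) (s - 2)" unfolding packs_def using F by (intro exI[of _ F]) auto
    then have "packs (\<Union>F \<union> insert r Y) (s - 2 + 2)"
      by (rule packs_Un[OF _ Y(3)[OF r(1)]]) (use FW r in auto)
    then have "packs W (s - 2 + 2)" by (rule packs_mono) (use FW r Y in auto)
    moreover have "s - 2 + 2 = s" using 5 by simp
    ultimately have "packs (V - Z) s" unfolding W_def by simp
    then show ?thesis by (rule finish)
  qed
qed

text \<open>\<open>33/124 = 1/4 + 1/62\<close>; the cases left open by the density bound have at most \<open>15\<close> vertices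
  and follow from Ramsey's bound.\<close>

lemma clique_model_half:
  assumes fin: "finite V" and dense: "\<And>S. S \<subseteq> V \<Longrightarrow> \<exists>I\<subseteq>S. indep I \<and> 33 * card S \<le> 124 * card I"
    and S: "S \<subseteq> V"
  shows "clique_model S ((card S + 1) div 2)"
proof -
  have odd_case: "clique_model S h" if S: "S \<subseteq> V" and h: "card S + 1 = 2 * h" for S h
  proof -
    have finS: "finite S" using S fin by (meson finite_subset)
    obtain Z where Z: "max_indep S Z" using max_indep_exists[OF finS] by blast
    have ib: "indep_bound S (card Z)" using Z unfolding max_indep_def by auto
    obtain I where I: "I \<subseteq> S" "indep I" "33 * card S \<le> 124 * card I" using dense[OF S] by blast
    have "card I \<le> card Z" by (rule indep_boundD[OF ib I(1,2)])
    then have d: "33 * card S \<le> 124 * card Z" using I(3) by linarith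
    have r: "2 * card S < (card Z + 1) * (card Z + 2)" by (rule ramsey_bound[OF finS ib])
    have "h + 1 \<le> 2 * card Z"
    proof (rule ccontr)
      assume n: "\<not> h + 1 \<le> 2 * card Z"
      \<comment> \<open>Failure means \<open>card S \<ge> 4 * card Z - 1\<close>, and the density
        bound turns this into \<open>8 * card Z \<le> 33\<close>. For \<open>card Z\<close> from 1
        to 4, Ramsey's bound excludes that many vertices.\<close>
      then have "card Z \<le> 4" using d h by linarith
      then have "card Z = 0 \<or> card Z = 1 \<or> card Z = 2 \<or> card Z = 3 \<or> card Z = 4" by linarith
      then show False using r d h n by (elim disjE) simp_all
    qed
    then show ?thesis using clique_model_odd[OF finS h Z] by blast
  qed
  show ?thesis
  proof (cases "even (card S)")
    case False
    then have "card S + 1 = 2 * ((card S + 1) div 2)" by simp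
    then show ?thesis by (rule odd_case[OF S])
  next
    case True
    show ?thesis
    proof (cases "S = {}")
      case True
      have "clique_model {} (card ({} :: 'a set))" by (rule clique_model_indep) (auto simp: indep_def)
      then show ?thesis using True by simp
    next
      case False
      then obtain v where v: "v \<in> S" by blast
      have finS: "finite S" using S fin by (meson finite_subset)
      have c: "card (S - {v}) + 1 = card S" using v finS by (metis Suc_eq_plus1 card.remove)
      \<comment> \<open>Giving away a vertex of an even set does not change half its size, rounded
        up.\<close>
      have "clique_model (S - {v}) (card S div 2)"
        by (rule odd_case) (use S c \<open>even (card S)\<close> in auto)
      then show ?thesis using \<open>even (card S)\<close> clique_model_mono[of "S - {v}" _ S] by auto
    qed
  qed
qed

lemma clique_model_partition:
  assumes "finite P" "pairwise disjnt P"
    and "\<And>K L x y. K \<in> P \<Longrightarrow> L \<in> P \<Longrightarrow> K \<noteq> L \<Longrightarrow> x \<in> K \<Longrightarrow> y \<in> L \<Longrightarrow> \<not> T x y"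
    and "\<And>K. K \<in> P \<Longrightarrow> clique_model K (m K)"
  shows "clique_model (\<Union>P) (\<Sum>K\<in>P. m K)"
  using assms
proof (induction P rule: finite_induct)
  case empty
  have "clique_model {} (card ({} :: 'a set))" by (rule clique_model_indep) (auto simp: indep_def)
  then show ?case by simp
next
  case (insert K P)
  have "clique_model (K \<union> \<Union>P) (m K + (\<Sum>K\<in>P. m K))"
  proof (rule clique_model_join)
    show "clique_model (\<Union>P) (\<Sum>K\<in>P. m K)"
      by (rule insert.IH) (use insert.prems in \<open>auto simp: pairwise_insert\<close>)
    show "K \<inter> \<Union>P = {}"
      using insert.prems(1) insert.hyps(2) by (auto simp: pairwise_insert disjnt_def)
    show "\<not> T x y" if "x \<in> K" "y \<in> \<Union>P" for x y
      using that insert.prems(2)[of K _ x y] insert.hyps(2) by blast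
  qed (use insert.prems in simp)
  then show ?case using insert.hyps by simp
qed

text \<open>The parts are complete to each other in \<open>G\<close>, so models of half their sizes,
  rounded up, add up. The sum is \<open>(card (V - Y) + odd_parts P) / 2\<close>, which Tutte--Berge
  makes at least \<open>card V - card M\<close>, the number of colours obtained from
  \<open>M\<close>.\<close>

lemma clique_model_matching:
  assumes fin: "finite V" and dense: "\<And>S. S \<subseteq> V \<Longrightarrow> \<exists>I\<subseteq>S. indep I \<and> 33 * card S \<le> 124 * card I"
  shows "\<exists>M m. matching T V M \<and> clique_model V m \<and> card V \<le> m + card M"
proof -
  obtain M Y P where M: "matching T V M" "Y \<subseteq> V" "edgeless_partition T (V - Y) P"
    "card V + card Y \<le> 2 * card M + odd_parts P"
    using tutte_berge[of V T] fin T_sym by blast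
  have fP: "finite P" using edgeless_partition_finite[OF M(3)] fin by blast
  have UP: "\<Union>P = V - Y" and djP: "pairwise disjnt P"
    and cross: "\<And>K L x y. K \<in> P \<Longrightarrow> L \<in> P \<Longrightarrow> K \<noteq> L \<Longrightarrow> x \<in> K \<Longrightarrow> y \<in> L \<Longrightarrow> \<not> T x y"
    using M(3) unfolding edgeless_partition_def by blast+
  have "clique_model (\<Union>P) (\<Sum>K\<in>P. (card K + 1) div 2)"
  proof (rule clique_model_partition[OF fP djP])
    show "\<not> T x y" if "K \<in> P" "L \<in> P" "K \<noteq> L" "x \<in> K" "y \<in> L" for K L x y
      using cross that by blast
    show "clique_model K ((card K + 1) div 2)" if "K \<in> P" for K
      by (rule clique_model_half[of V K]) (use fin dense UP that in auto)
  qed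
  then have "clique_model V (\<Sum>K\<in>P. (card K + 1) div 2)"
    by (rule clique_model_mono) (use UP in blast)
  moreover have "2 * (\<Sum>K\<in>P. (card K + 1) div 2) = (\<Sum>K\<in>P. card K + card K mod 2)"
    unfolding sum_distrib_left by (intro sum.cong) presburger+
  moreover have "(\<Sum>K\<in>P. card K + card K mod 2) = card (V - Y) + odd_parts P"
    using edgeless_partition_sum[OF M(3), of P UNIV] fin UP odd_parts_sum[OF fP]
    by (simp add: sum.distrib)
  moreover have "card V = card (V - Y) + card Y"
    using M(2) fin by (metis card_Diff_subset card_mono finite_subset le_add_diff_inverse2)
  ultimately show ?thesis using M(1,4) by (intro exI[of _ M] exI[of _ "\<Sum>K\<in>P. (card K + 1) div 2"]) auto
qed

end

section \<open>Inflations of intersection graphs\<close>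

text \<open>Restricted to distinct vertices of \<open>G\<close>, so that the assumptions of
  \<open>triangle_free\<close> hold on the whole type.\<close>

definition coadjacent :: "'a pair_pre_digraph \<Rightarrow> 'a \<Rightarrow> 'a \<Rightarrow> bool" where
  "coadjacent G x y \<longleftrightarrow> x \<in> pverts G \<and> y \<in> pverts G \<and> x \<noteq> y \<and> (x, y) \<notin> parcs G"

lemma pair_graph_symD:
  assumes "pair_graph G" "(x, y) \<in> parcs G"
  shows "(y, x) \<in> parcs G"
proof -
  interpret pair_graph G by fact
  show ?thesis
    using pair_sym_arcs assms(2) unfolding symmetric_def with_proj_simps by (rule symD)
qed

lemma pair_graph_arcD:
  assumes "pair_graph G" "(x, y) \<in> parcs G"
  shows "x \<in> pverts G" "y \<in> pverts G" "x \<noteq> y"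
proof -
  interpret pair_graph G by fact
  show "x \<in> pverts G" "y \<in> pverts G" "x \<noteq> y"
    using assms(2) in_arcsD1 in_arcsD2 pair_no_loops[OF assms(2)] by auto
qed

lemma pair_graph_finite_verts:
  assumes "pair_graph G"
  shows "finite (pverts G)"
proof -
  interpret pair_graph G by fact
  show ?thesis by (rule pair_finite_verts)
qed

lemma triangle_free_coadjacent:
  assumes G: "pair_graph G" and alpha: "independence_number G \<le> 2"
  shows "triangle_free (coadjacent G)"
proof
  show "coadjacent G x y \<Longrightarrow> coadjacent G y x" for x y
    using pair_graph_symD[OF G] unfolding coadjacent_def by blast
  show "\<not> coadjacent G x x" for x by (simp add: coadjacent_def)
  show "\<not> coadjacent G x z" if xy: "coadjacent G x y" and yz: "coadjacent G y z" for x y z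
  proof
    assume xz: "coadjacent G x z"
    have ind: "independent_set G {x, y, z}"
      using xy yz xz pair_graph_symD[OF G] pair_graph_arcD(3)[OF G]
      unfolding independent_set_def coadjacent_def by blast
    have "{card S | S. independent_set G S} \<subseteq> card ` Pow (pverts G)"
      unfolding independent_set_def by blast
    then have "finite {card S | S. independent_set G S}"
      using pair_graph_finite_verts[OF G] by (meson finite_Pow_iff finite_imageI finite_subset)
    then have "card {x, y, z} \<le> independence_number G"
      unfolding independence_number_def by (rule Max_ge) (use ind in blast)
    moreover have "card {x, y, z} = 3"
      using xy yz xz by (simp add: coadjacent_def)
    ultimately show False using alpha by simp
  qed
qed

lemma chromatic_number_le_matching:
  assumes G: "pair_graph G" and M: "matching (coadjacent G) (pverts G) M"
  shows "chromatic_number G + card M \<le> card (pverts G)"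
proof -
  define V where "V = pverts G"
  \<comment> \<open>The colour class of \<open>v\<close>: its matching edge, whose ends are not
    adjacent in \<open>G\<close>, or \<open>v\<close> alone. The bijection \<open>h\<close> turns
    classes into numbers.\<close>
  define cls where "cls v = (if v \<in> \<Union>M then THE e. e \<in> M \<and> v \<in> e else {v})" for v
  have fV: "finite V" using pair_graph_finite_verts[OF G] by (simp add: V_def)
  have fM: "finite M" and UM: "\<Union>M \<subseteq> V"
    using matching_finite[OF M] matching_subset[OF M] by (auto simp: V_def)
  have cls_M: "cls v \<in> M \<and> v \<in> cls v" if v: "v \<in> \<Union>M" for v
  proof -
    have "\<exists>!e. e \<in> M \<and> v \<in> e" using v matching_same_edge[OF M] by blast
    from theI'[OF this] show ?thesis using v by (simp add: cls_def)
  qed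
  have mem: "v \<in> cls v" for v
    by (cases "v \<in> \<Union>M") (use cls_M in \<open>auto simp: cls_def\<close>)
  have img: "cls ` V \<subseteq> M \<union> (\<lambda>v. {v}) ` (V - \<Union>M)"
  proof
    fix e assume "e \<in> cls ` V"
    then obtain v where v: "v \<in> V" "e = cls v" by blast
    show "e \<in> M \<union> (\<lambda>v. {v}) ` (V - \<Union>M)"
      by (cases "v \<in> \<Union>M") (use cls_M v in \<open>auto simp: cls_def\<close>)
  qed
  have "card (cls ` V) \<le> card (M \<union> (\<lambda>v. {v}) ` (V - \<Union>M))"
    using img fM fV by (intro card_mono) auto
  also have "\<dots> \<le> card M + card ((\<lambda>v. {v}) ` (V - \<Union>M))" by (rule card_Un_le)
  also have "card ((\<lambda>v. {v}) ` (V - \<Union>M)) = card (V - \<Union>M)"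
    by (intro card_image) (simp add: inj_on_def)
  also have "\<dots> = card V - 2 * card M"
    using UM fV card_Union_matching[OF M] by (metis card_Diff_subset finite_subset)
  finally have le: "card (cls ` V) \<le> card M + (card V - 2 * card M)" .
  have "2 * card M \<le> card V"
    using UM fV card_Union_matching[OF M] by (metis card_mono)
  then have cardc: "card (cls ` V) + card M \<le> card V" using le by simp
  obtain h where h: "bij_betw h (cls ` V) {..<card (cls ` V)}"
    using fV ex_bij_betw_finite_nat[of "cls ` V"] by (auto simp: lessThan_atLeast0)
  have "proper_coloring G (card (cls ` V)) (h \<circ> cls)"
    unfolding proper_coloring_def
  proof (intro conjI ballI)
    show "(h \<circ> cls) v < card (cls ` V)" if "v \<in> pverts G" for v
      using bij_betwE[OF h] that by (auto simp: V_def)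
    show "case e of (u, v) \<Rightarrow> (h \<circ> cls) u \<noteq> (h \<circ> cls) v" if e: "e \<in> parcs G" for e
    proof (cases e)
      case (Pair u v)
      have uv: "u \<in> V" "v \<in> V" "u \<noteq> v" and a: "(u, v) \<in> parcs G"
        using pair_graph_arcD[OF G, of u v] e Pair by (auto simp: V_def)
      have "cls u \<noteq> cls v"
      proof
        assume "cls u = cls v"
        then have "v \<in> cls u" using mem by metis
        then have "cls u \<noteq> {u}" using uv by auto
        then have "cls u \<in> M" using cls_M[of u] by (auto simp: cls_def split: if_splits)
        then obtain x y where xy: "coadjacent G x y" "cls u = {x, y}"
          using matching_edgeE[OF M] by metis
        then have "u = x \<and> v = y \<or> u = y \<and> v = x"
          using mem[of u] \<open>v \<in> cls u\<close> uv(3) by auto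
        then show False
          using xy(1) a pair_graph_symD[OF G a] by (auto simp: coadjacent_def)
      qed
      then have "h (cls u) \<noteq> h (cls v)"
        using bij_betw_imp_inj_on[OF h] uv by (auto dest: inj_onD)
      then show ?thesis using Pair by simp
    qed
  qed
  then have "chromatic_number G \<le> card (cls ` V)"
    unfolding chromatic_number_def by (intro Least_le exI)
  then show ?thesis using cardc by (simp add: V_def)
qed

text \<open>All branch sets in use contain a spanning star of \<open>G\<close>; in a seagull its
  centre is the middle vertex.\<close>

lemma connected_induce_hub:
  assumes G: "pair_graph G" and X: "X \<subseteq> pverts G" and c: "c \<in> X"
    and star: "\<And>x. x \<in> X \<Longrightarrow> x \<noteq> c \<Longrightarrow> (c, x) \<in> parcs G"
  shows "Digraph_Component.connected (with_proj G \<restriction> X)"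
proof -
  let ?R = "(arcs_ends (with_proj G \<restriction> X))\<^sup>s"
  have verts: "verts (with_proj G \<restriction> X) = X" by simp
  have arc: "(c, x) \<in> ?R \<and> (x, c) \<in> ?R" if "x \<in> X" "x \<noteq> c" for x
    using star[OF that] c that
    by (force simp: symcl_def arcs_ends_conv induce_subgraph_def)
  have refl: "(x, x) \<in> rtrancl_on X ?R" if "x \<in> X" for x
    using that by (rule rtrancl_on_refl)
  have hub: "(c, x) \<in> rtrancl_on X ?R" "(x, c) \<in> rtrancl_on X ?R" if "x \<in> X" for x
  proof -
    show "(c, x) \<in> rtrancl_on X ?R"
      by (cases "x = c") (use refl[OF c] arc that c rtrancl_on_into_rtrancl_on in \<open>metis (no_types)\<close>)+
    show "(x, c) \<in> rtrancl_on X ?R"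
      by (cases "x = c") (use refl arc that c rtrancl_on_into_rtrancl_on in \<open>metis (no_types)\<close>)+
  qed
  show ?thesis
    unfolding connected_conv verts
    using c hub rtrancl_on_trans by (metis (no_types, lifting) empty_iff)
qed

lemma hadwiger_number_ge:
  assumes G: "pair_graph G" and fam: "\<And>x. x < m \<Longrightarrow> B x \<subseteq> pverts G"
    "\<And>x. x < m \<Longrightarrow> Digraph_Component.connected (with_proj G \<restriction> B x)"
    and disj: "disjoint_family_on B {..<m}"
    and adj: "\<And>x y. x < m \<Longrightarrow> y < m \<Longrightarrow> x \<noteq> y \<Longrightarrow> \<exists>u\<in>B x. \<exists>v\<in>B y. (u, v) \<in> parcs G"
  shows "m \<le> hadwiger_number G"
proof -
  define K where "K = {m. \<exists>H :: nat pair_pre_digraph. complete_digraph m (with_proj H) \<and> is_minor H G}"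
  \<comment> \<open>\<open>Max\<close> needs a finite set: disjoint nonempty branch sets have
    distinct representatives, so no complete minor has larger order than \<open>G\<close>.\<close>
  have "K \<subseteq> {..card (pverts G)}"
  proof
    fix j assume "j \<in> K"
    then obtain H :: "nat pair_pre_digraph" and D
      where H: "card (pverts H) = j"
        and D: "\<forall>x\<in>pverts H. D x \<subseteq> pverts G \<and> Digraph_Component.connected (with_proj G \<restriction> D x)"
          "disjoint_family_on D (pverts H)"
      unfolding K_def is_minor_def complete_digraph_pair_def by blast
    have ne: "D x \<noteq> {}" if "x \<in> pverts H" for x
      using D(1) that unfolding connected_conv by auto
    define v where "v x = (SOME u. u \<in> D x)" for x
    have v: "v x \<in> D x" if "x \<in> pverts H" for x
      using ne[OF that] unfolding v_def by (simp add: some_in_eq)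
    have "inj_on v (pverts H)"
    proof (rule inj_onI, rule ccontr)
      fix x y assume xy: "x \<in> pverts H" "y \<in> pverts H" "v x = v y" "x \<noteq> y"
      then have "D x \<inter> D y = {}" using D(2) unfolding disjoint_family_on_def by blast
      then show False using v[OF xy(1)] v[OF xy(2)] xy(3) by auto
    qed
    moreover have "v ` pverts H \<subseteq> pverts G" using v D(1) by blast
    ultimately have "card (pverts H) \<le> card (pverts G)"
      using pair_graph_finite_verts[OF G] by (metis card_inj_on_le)
    then show "j \<in> {..card (pverts G)}" using H by simp
  qed
  then have fin: "finite K" by (meson finite_atMost finite_subset)
  define H :: "nat pair_pre_digraph"
    where "H = \<lparr> pverts = {..<m}, parcs = {(x, y). x < m \<and> y < m \<and> x \<noteq> y} \<rparr>"
  have "complete_digraph m (with_proj H)"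
    unfolding complete_digraph_pair_def by (auto simp: H_def)
  moreover have "is_minor H G"
    unfolding is_minor_def
    by (rule exI[of _ B]) (use fam disj adj in \<open>auto simp: H_def\<close>)
  ultimately have "m \<in> K" unfolding K_def by blast
  then show ?thesis using fin unfolding hadwiger_number_def K_def[symmetric] by (rule Max_ge[rotated])
qed

lemma hadwiger_number_ge_clique_model:
  assumes G: "pair_graph G" and tf: "triangle_free (coadjacent G)"
    and model: "triangle_free.clique_model (coadjacent G) (pverts G) m"
  shows "m \<le> hadwiger_number G"
proof -
  interpret triangle_free "coadjacent G" by fact
  obtain F where F: "finite F" "card F = m" "pairwise disjnt F"
    and br': "\<forall>X\<in>F. X \<subseteq> pverts G \<and> branch_set X"
    and adj: "\<forall>X\<in>F. \<forall>Y\<in>F. X \<noteq> Y \<longrightarrow> (\<exists>x\<in>X. \<exists>y\<in>Y. \<not> coadjacent G x y)"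
    using model unfolding clique_model_def by (elim exE conjE)
  have br: "X \<subseteq> pverts G" "branch_set X" if "X \<in> F" for X using br' that by auto
  obtain B where B: "bij_betw B {..<m} F"
    using ex_bij_betw_nat_finite[OF F(1)] F(2) by (auto simp: lessThan_atLeast0)
  have BF: "B x \<in> F" if "x < m" for x using B that by (auto simp: bij_betw_def)
  have Bne: "B x \<noteq> B y" if "x < m" "y < m" "x \<noteq> y" for x y
    using bij_betw_imp_inj_on[OF B] that by (auto dest: inj_onD)
  have Bdis: "B x \<inter> B y = {}" if "x < m" "y < m" "x \<noteq> y" for x y
    using F(3) BF[OF that(1)] BF[OF that(2)] Bne[OF that] unfolding pairwise_def disjnt_def by blast
  have arc: "(x, y) \<in> parcs G" if "\<not> coadjacent G x y" "x \<in> pverts G" "y \<in> pverts G" "x \<noteq> y" for x y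
    using that unfolding coadjacent_def by blast
  show ?thesis
  proof (rule hadwiger_number_ge[OF G])
    fix x assume x: "x < m"
    let ?X = "B x"
    show XV: "?X \<subseteq> pverts G" using br(1) BF[OF x] by blast
    have "\<exists>c\<in>?X. \<forall>y\<in>?X. y \<noteq> c \<longrightarrow> \<not> coadjacent G c y"
      using br(2)[OF BF[OF x]] unfolding branch_set_def seagull_def
    proof (elim disjE exE conjE)
      fix a b c
      assume "?X = {a, b, c}" "\<not> coadjacent G a c" "\<not> coadjacent G b c"
      then show ?thesis using T_sym by (intro bexI[of _ c]) auto
    qed auto
    then obtain c where "c \<in> ?X" "\<And>y. y \<in> ?X \<Longrightarrow> y \<noteq> c \<Longrightarrow> \<not> coadjacent G c y" by blast
    then show "Digraph_Component.connected (with_proj G \<restriction> ?X)"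
      using XV arc by (intro connected_induce_hub[OF G, of _ c]) blast+
  next
    show "disjoint_family_on B {..<m}" using Bdis by (simp add: disjoint_family_on_def)
    fix x y assume xy: "x < m" "y < m" "x \<noteq> y"
    then obtain u v where uv: "u \<in> B x" "v \<in> B y" "\<not> coadjacent G u v"
      using adj BF Bne by metis
    then have "u \<noteq> v" using Bdis[OF xy] by blast
    then show "\<exists>u\<in>B x. \<exists>v\<in>B y. (u, v) \<in> parcs G"
      using uv arc br(1) BF xy by blast
  qed
qed

section \<open>Averaging over permutations of the ground set\<close>

lemma ex_permutes_image_eq:
  assumes "finite S" "A \<subseteq> S" "B \<subseteq> S" "card A = card B"
  shows "\<exists>q. q permutes S \<and> q ` A = B"
proof -
  have fin: "finite A" "finite B" using assms by (meson finite_subset)+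
  obtain f where f: "bij_betw f A B"
    using finite_same_card_bij[OF fin assms(4)] by blast
  have "card (S - A) = card (S - B)" using assms fin by (simp add: card_Diff_subset)
  then obtain g where g: "bij_betw g (S - A) (S - B)"
    using finite_same_card_bij[of "S - A" "S - B"] assms(1) by blast
  define q where "q x = (if x \<in> A then f x else if x \<in> S then g x else x)" for x
  have "bij_betw q A B" using f by (rule bij_betw_cong[THEN iffD2, rotated]) (simp add: q_def)
  moreover have "bij_betw q (S - A) (S - B)"
    using g by (rule bij_betw_cong[THEN iffD2, rotated]) (simp add: q_def)
  ultimately have "bij_betw q (A \<union> (S - A)) (B \<union> (S - B))" by (rule bij_betw_combine) blast
  then have "bij_betw q S S" using assms(2,3) by (simp add: Un_absorb1)
  then have "q permutes S" by (rule bij_imp_permutes) (use assms(2) in \<open>auto simp: q_def\<close>)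
  moreover have "q ` A = B" using \<open>bij_betw q A B\<close> by (simp add: bij_betw_def)
  ultimately show ?thesis by blast
qed

text \<open>Permutations act transitively on the \<open>k\<close>-sets, so each \<open>k\<close>-set
  is sent into \<open>F\<close> by the same number of them. Hence the preimages of \<open>F\<close>
  carry on average the fraction \<open>card F / card K\<close> of the total weight, and some
  preimage reaches the average.\<close>

lemma permuted_family_weight:
  fixes w :: "'a set \<Rightarrow> nat"
  assumes S: "finite S" and FK: "F \<subseteq> {A. A \<subseteq> S \<and> card A = k}"
  defines "K \<equiv> {A. A \<subseteq> S \<and> card A = k}"
  shows "\<exists>p. p permutes S \<and> card F * sum w K \<le> card K * (\<Sum>A | A \<in> K \<and> p ` A \<in> F. w A)"
proof (rule ccontr)
  assume neg: "\<nexists>p. p permutes S \<and> card F * sum w K \<le> card K * (\<Sum>A | A \<in> K \<and> p ` A \<in> F. w A)"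
  define P where "P = {p. p permutes S}"
  define N where "N A = card {p \<in> P. p ` A \<in> F}" for A
  have fK: "finite K" unfolding K_def using S by simp
  have fP: "finite P" unfolding P_def using S by (rule finite_permutations)
  have Pne: "P \<noteq> {}" unfolding P_def using permutes_id by blast
  \<comment> \<open>Composition with a permutation taking \<open>A\<close> to \<open>B\<close> is
    injective; exchanging the roles of \<open>A\<close> and \<open>B\<close> gives equality.\<close>
  have Nle: "N B \<le> N A" if AB: "A \<in> K" "B \<in> K" for A B
  proof -
    obtain q where q: "q permutes S" "q ` A = B"
      using ex_permutes_image_eq[OF S, of A B] AB by (auto simp: K_def)
    have "inj_on (\<lambda>p. p \<circ> q) {p \<in> P. p ` B \<in> F}"
    proof (rule inj_onI)
      fix p p' assume eq: "p \<circ> q = p' \<circ> q"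
      show "p = p'"
      proof
        fix x
        obtain y where "x = q y" using permutes_surj[OF q(1)] by blast
        then show "p x = p' x" using fun_cong[OF eq, of y] by simp
      qed
    qed
    moreover have "(\<lambda>p. p \<circ> q) ` {p \<in> P. p ` B \<in> F} \<subseteq> {p \<in> P. p ` A \<in> F}"
    proof (intro image_subsetI CollectI conjI)
      fix p assume p: "p \<in> {p \<in> P. p ` B \<in> F}"
      then show "p \<circ> q \<in> P" using permutes_compose[OF q(1)] by (simp add: P_def)
      show "(p \<circ> q) ` A \<in> F" using p q(2) by (simp only: image_comp[symmetric] mem_Collect_eq)
    qed
    ultimately show ?thesis unfolding N_def using fP by (intro card_inj_on_le) auto
  qed
  have swap: "(\<Sum>p\<in>P. \<Sum>A | A \<in> K \<and> p ` A \<in> F. v A) = (\<Sum>A\<in>K. N A * v A)" for v :: "'a set \<Rightarrow> nat"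
  proof -
    have "(\<Sum>p\<in>P. \<Sum>A | A \<in> K \<and> p ` A \<in> F. v A) = (\<Sum>p\<in>P. \<Sum>A\<in>K. if p ` A \<in> F then v A else 0)"
      by (rule sum.cong[OF refl]) (simp add: fK sum.inter_filter)
    also have "\<dots> = (\<Sum>A\<in>K. \<Sum>p\<in>P. if p ` A \<in> F then v A else 0)" by (rule sum.swap)
    also have "\<dots> = (\<Sum>A\<in>K. N A * v A)"
      by (rule sum.cong[OF refl]) (simp add: fP sum.inter_filter[symmetric] N_def)
    finally show ?thesis .
  qed
  have cnt: "card {A \<in> K. p ` A \<in> F} = card F" if p: "p \<in> P" for p
  proof -
    have perm: "p permutes S" using p by (simp add: P_def)
    have "bij_betw ((`) p) {A \<in> K. p ` A \<in> F} F"
    proof (rule bij_betw_imageI)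
      show "inj_on ((`) p) {A \<in> K. p ` A \<in> F}"
        using permutes_inj[OF perm] by (simp add: inj_on_def inj_image_eq_iff)
      show "(`) p ` {A \<in> K. p ` A \<in> F} = F"
      proof
        show "F \<subseteq> (`) p ` {A \<in> K. p ` A \<in> F}"
        proof
          fix B assume B: "B \<in> F"
          then have BK: "B \<subseteq> S" "card B = k" using FK by auto
          obtain A where A: "A \<subseteq> S" "B = p ` A"
            using BK(1) permutes_image[OF perm] by (metis subset_image_iff)
          have "card A = k"
            using A BK(2) permutes_inj[OF perm] by (metis card_image inj_on_subset subset_UNIV)
          then show "B \<in> (`) p ` {A \<in> K. p ` A \<in> F}" using A B by (auto simp: K_def)
        qed
      qed blast
    qed
    then show ?thesis by (rule bij_betw_same_card)
  qed
  have total: "(\<Sum>A\<in>K. N A) = card P * card F"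
    using swap[of "\<lambda>_. 1"] cnt by simp
  have avg: "card K * N A = card P * card F" if "A \<in> K" for A
  proof -
    have "N B = N A" if "B \<in> K" for B using Nle that \<open>A \<in> K\<close> by (simp add: antisym)
    then show ?thesis using total by simp
  qed
  have "(\<Sum>p\<in>P. card K * (\<Sum>A | A \<in> K \<and> p ` A \<in> F. w A)) < (\<Sum>p\<in>P. card F * sum w K)"
    using fP Pne neg by (intro sum_strict_mono) (auto simp: P_def not_le)
  also have "\<dots> = (\<Sum>A\<in>K. card K * N A * w A)"
    using avg by (simp add: sum_distrib_left mult.assoc)
  also have "\<dots> = (\<Sum>p\<in>P. card K * (\<Sum>A | A \<in> K \<and> p ` A \<in> F. w A))"
    using swap[of w] by (simp add: sum_distrib_left[symmetric] mult.assoc)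
  finally show False by simp
qed

text \<open>Inclusion-exclusion inside \<open>{1..t + 2 * r}\<close>: two subsets with at least
  \<open>t + r\<close> elements each overlap in at least \<open>t\<close>.\<close>

lemma frankl_family_intersecting:
  assumes "A \<in> frankl_family n k t r" "B \<in> frankl_family n k t r"
  shows "t \<le> card (A \<inter> B)"
proof -
  let ?X = "A \<inter> {1..t + 2 * r}" and ?Y = "B \<inter> {1..t + 2 * r}"
  have "card (?X \<union> ?Y) \<le> card {1..t + 2 * r}" by (intro card_mono) auto
  moreover have "card ?X + card ?Y = card (?X \<union> ?Y) + card (?X \<inter> ?Y)"
    by (rule card_Un_Int) auto
  moreover have "card (?X \<inter> ?Y) \<le> card (A \<inter> B)"
  proof (rule card_mono)
    have "A \<inter> B \<subseteq> {1..n}" using assms by (auto simp: frankl_family_def)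
    then show "finite (A \<inter> B)" by (meson finite_atLeastAtMost finite_subset)
  qed blast
  ultimately show ?thesis using assms by (simp add: frankl_family_def)
qed

lemma frankl_max_attained:
  assumes "t \<le> n"
  obtains r where "card (frankl_family n k t r) = frankl_max n k t"
proof -
  have "{card (frankl_family n k t r) | r. t + 2 * r \<le> n} \<subseteq> (\<lambda>r. card (frankl_family n k t r)) ` {..n}"
    by auto
  then have "finite {card (frankl_family n k t r) | r. t + 2 * r \<le> n}"
    by (meson finite_atMost finite_imageI finite_subset)
  moreover have "{card (frankl_family n k t r) | r. t + 2 * r \<le> n} \<noteq> {}"
    using assms by (auto intro: exI[of _ 0])
  ultimately have "frankl_max n k t \<in> {card (frankl_family n k t r) | r. t + 2 * r \<le> n}"
    unfolding frankl_max_def by (rule Max_in)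
  then show thesis using that by auto
qed

text \<open>Weighting each \<open>k\<close>-set by the share of \<open>S\<close> in its clique makes
  the averaging count vertices of \<open>S\<close>. The preimage of a Frankl family under a
  permutation still has pairwise intersections of size at least \<open>t\<close>, so the cliques
  over it form a single clique.\<close>

lemma inflation_dense_clique:
  assumes tn: "t \<le> n" and infl: "is_inflation G (intersection_graph_ge n k t)"
    and big: "33 * (n choose k) \<le> 124 * frankl_max n k t" and kn: "k \<le> n"
    and SV: "S \<subseteq> pverts G"
  shows "\<exists>I\<subseteq>S. (\<forall>x\<in>I. \<forall>y\<in>I. \<not> coadjacent G x y) \<and> 33 * card S \<le> 124 * card I"
proof -
  define K where "K = {A. A \<subseteq> {1..n} \<and> card A = k}"
  obtain C where fin: "\<forall>A\<in>K. finite (C A)"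
    and disj: "disjoint_family_on C K"
    and V: "pverts G = (\<Union>A\<in>K. C A)"
    and E: "parcs G = {(u, v). \<exists>A\<in>K. \<exists>B\<in>K. u \<in> C A \<and> v \<in> C B \<and>
        (if A = B then u \<noteq> v else (A, B) \<in> parcs (intersection_graph_ge n k t))}"
    using infl unfolding is_inflation_def intersection_graph_ge_def K_def by auto
  obtain r where r: "card (frankl_family n k t r) = frankl_max n k t"
    using frankl_max_attained[OF tn] .
  define F where "F = frankl_family n k t r"
  define w where "w A = card (S \<inter> C A)" for A
  have fK: "finite K" by (simp add: K_def)
  have cK: "card K = n choose k" unfolding K_def by (simp add: n_subsets)
  have "\<exists>p. p permutes {1..n} \<and> card F * sum w K \<le> card K * (\<Sum>A | A \<in> K \<and> p ` A \<in> F. w A)"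
    unfolding K_def by (rule permuted_family_weight) (auto simp: F_def frankl_family_def)
  then obtain p where p: "p permutes {1..n}"
    and le: "card F * sum w K \<le> card K * (\<Sum>A | A \<in> K \<and> p ` A \<in> F. w A)" by blast
  define L where "L = {A. A \<in> K \<and> p ` A \<in> F}"
  have LK: "L \<subseteq> K" by (auto simp: L_def)
  have card_UN: "card (\<Union>A\<in>J. S \<inter> C A) = sum w J" if "J \<subseteq> K" for J
    unfolding w_def
  proof (rule card_UN_disjoint)
    show "finite J" using that fK by (meson finite_subset)
    show "\<forall>A\<in>J. finite (S \<inter> C A)" using that fin by blast
    show "\<forall>A\<in>J. \<forall>B\<in>J. A \<noteq> B \<longrightarrow> S \<inter> C A \<inter> (S \<inter> C B) = {}"
      using that disj unfolding disjoint_family_on_def by blast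
  qed
  define I where "I = (\<Union>A\<in>L. S \<inter> C A)"
  have "S = (\<Union>A\<in>K. S \<inter> C A)" using SV V by blast
  then have cS: "card S = sum w K" using card_UN[of K] by simp
  have cI: "card I = sum w L" unfolding I_def by (rule card_UN[OF LK])
  have "card K * (33 * card S) \<le> 124 * card F * card S"
    using mult_right_mono[OF big, of "card S"] r by (simp add: F_def cK mult_ac)
  also have "\<dots> \<le> 124 * (card K * card I)" using le cS cI by (simp add: L_def)
  finally have "card K * (33 * card S) \<le> card K * (124 * card I)" by (simp add: mult_ac)
  moreover have "card K > 0" using kn cK by simp
  ultimately have dens: "33 * card S \<le> 124 * card I" by simp
  have "\<not> coadjacent G x y" if xy: "x \<in> I" "y \<in> I" for x y
  proof (cases "x = y")
    case True
    then show ?thesis by (simp add: coadjacent_def)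
  next
    case False
    obtain A B where AB: "A \<in> L" "B \<in> L" "x \<in> C A" "y \<in> C B" using xy by (auto simp: I_def)
    have "t \<le> card (p ` A \<inter> p ` B)"
      using AB unfolding L_def F_def by (intro frankl_family_intersecting) auto
    also have "p ` A \<inter> p ` B = p ` (A \<inter> B)" using permutes_inj[OF p] by (simp add: image_Int)
    also have "card \<dots> = card (A \<inter> B)"
      using permutes_inj[OF p] by (meson card_image inj_on_subset subset_UNIV)
    finally have "t \<le> card (A \<inter> B)" .
    then have "A \<noteq> B \<Longrightarrow> (A, B) \<in> parcs (intersection_graph_ge n k t)"
      using AB LK by (auto simp: intersection_graph_ge_def K_def)
    then have "(x, y) \<in> parcs G" using AB LK False unfolding E by auto
    then show ?thesis by (simp add: coadjacent_def)
  qed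
  then show ?thesis using dens by (intro exI[of _ I]) (auto simp: I_def)
qed

theorem theorem3p10:
  fixes n k t :: nat and G :: "'a pair_pre_digraph"
  assumes "n \<ge> 1" and "k \<ge> 1" and "t \<ge> 1"
    and "2 * int k - int t \<le> int n"
    and "int n < 3 * int k - 3 * int t + 3"
    and "real (frankl_max n k t) \<ge> (1 / 4 + 1 / 62) * real (n choose k)"
    and "is_inflation G (intersection_graph_ge n k t)"
    and "independence_number G = 2"
  shows "hadwiger_number G \<ge> chromatic_number G"
proof -
  have G: "pair_graph G"
    by (rule pair_graph_inflation[OF pair_graph_intersection_graph_ge assms(7)])
  have tf: "triangle_free (coadjacent G)"
    by (rule triangle_free_coadjacent[OF G]) (simp add: assms(8))
  interpret triangle_free "coadjacent G" by (fact tf)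
  have "real (33 * (n choose k)) \<le> real (124 * frankl_max n k t)" using assms(6) by simp
  then have big: "33 * (n choose k) \<le> 124 * frankl_max n k t" by (simp only: of_nat_le_iff)
  have dense: "\<exists>I\<subseteq>S. indep I \<and> 33 * card S \<le> 124 * card I" if S: "S \<subseteq> pverts G" for S
  \<comment> \<open>For \<open>k > n\<close> the binomial coefficient is 0 and the density
    assumption says nothing, but then \<open>G\<close> has no vertices.\<close>
  proof (cases "k \<le> n")
    case True
    then have "t \<le> n" using assms(1,5) by linarith
    then show ?thesis
      using inflation_dense_clique[OF _ assms(7) big True S] unfolding indep_def by blast
  next
    case False
    have "A \<notin> pverts (intersection_graph_ge n k t)" for A
    proof
      assume "A \<in> pverts (intersection_graph_ge n k t)"
      then have "A \<subseteq> {1..n}" "card A = k" by (simp_all add: intersection_graph_ge_def)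
      then show False using False card_mono[of "{1..n}" A] by simp
    qed
    then have "pverts G = {}" using assms(7) unfolding is_inflation_def by blast
    then show ?thesis using S by (intro exI[of _ "{}"]) (auto simp: indep_def)
  qed
  obtain M m where "matching (coadjacent G) (pverts G) M" "clique_model (pverts G) m"
    "card (pverts G) \<le> m + card M"
    using clique_model_matching[OF pair_graph_finite_verts[OF G] dense] by blast
  then show ?thesis
    using chromatic_number_le_matching[OF G] hadwiger_number_ge_clique_model[OF G tf]
    by fastforce
qed

end
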